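(* Let $N$ be the Hawkes process with exciting functions $(\gamma_{n})_{n\ge0}$ (defined in the context), and assume: (i) $\overline{\gamma}_{0}:=\lim_{t\to\infty}\frac{1}{t}\int_{0}^{t}\gamma_{0}(s)\,ds$ exists and is finite; (ii) $\rho:=\sup_{n\in\mathbb{N}}\int_{0}^{\infty}\gamma_{n}(t)\,dt<1$; (iii) $\lim_{t\to\infty}\sqrt{t}\left[\frac{1}{t}\int_{0}^{t}\gamma_{0}(s)ds-\overline{\gamma}_{0}\right]=0$ and $\lim_{t\to\infty}\sqrt{t}\int_{t}^{\infty}\sum_{p=1}^{\infty}(\gamma_{p}\ast\cdots\ast\gamma_{1})(s)\,ds=0$. Let $a(t)$ be a positive function with $a(t)/\sqrt{t}\to\infty$ and $a(t)/t\to0$ as $t\to\infty$. Then for every Borel set $A\subseteq\mathbb{R}$, $$-\inf_{x\in A^{o}}J(x)\le\liminf_{t\to\infty}\frac{t}{a(t)^{2}}\log\mathbb{P}\left(\frac{N_{t}-mt}{a(t)}\in A\right)\le\limsup_{t\to\infty}\frac{t}{a(t)^{2}}\log\mathbb{P}\left(\frac{N_{t}-mt}{a(t)}\in A\right)\le-\inf_{x\in\overline{A}}J(x),$$ where $J(x)=\frac{x^{2}}{2\sigma^{2}}$, $m:=\sum_{n\ge0}m_{n}$ with $m_{0}:=\overline{\gamma}_{0}$, $m_{n}:=\overline{\gamma}_{0}\prod_{i=1}^{n}\int_{0}^{\infty}\gamma_{i}(u)du$ for $n\ge1$, and $$\sigma^{2}=\sum_{j=0}^{\infty}\left(1+\s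um_{p=1}^{\infty}\prod_{i=j+1}^{p+j}\int_{0}^{\infty}\gamma_{i}(u)du\right)^{2}m_{j}.$$
   Context: Hawkes process with different exciting functions: given nonnegative locally integrable functions $(\gamma_{n})_{n\ge0}$ on $[0,\infty)$, let $(N^{n})_{n\ge0}$ be simple point processes on $(0,\infty)$ without common jumps such that $N^{0}$ is an inhomogeneous Poisson process with intensity $\gamma_{0}(t)$, and for each $n\ge0$, conditional on $N^{0},\dots,N^{n}$, $N^{n+1}$ is an inhomogeneous Poisson process with intensity $\lambda^{n+1}_{t}=\sum_{\tau\in N^{n},\,0<\tau<t}\gamma_{n+1}(t-\tau)$. Set $N:=\sum_{n\ge0}N^{n}$, $N_{t}:=N(0,t]$. $\ast$ denotes convolution on $[0,\infty)$. *)

theory Defs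
  imports "HOL-Probability.Probability"
begin

text \<open>Number of points of a point configuration S (a set of jump times) in a set B;
  infinite if infinitely many.\<close>
definition pcount :: "real set \<Rightarrow> real set \<Rightarrow> ennreal" where
  "pcount S B = (if finite (S \<inter> B) then of_nat (card (S \<inter> B)) else \<infinity>)"

definition poisson_prob :: "ennreal \<Rightarrow> nat \<Rightarrow> ennreal" where
  "poisson_prob L c = (if L = \<infinity> then 0
     else ennreal (exp (- enn2real L) * enn2real L ^ c / fact c))"

text \<open>X is, conditionally on the events in F, an inhomogeneous Poisson process on (0,oo)
  with (random) intensity lam: for disjoint bounded Borel sets B_0..B_(k-1) in (0,oo),
  the counts are conditionally independent Poisson with means int_(B_i) lam.\<close>
definition cond_poisson ::
  "'a measure \<Rightarrow> 'a set set \<Rightarrow> ('a \<Rightarrow> real set) \<Rightarrow> ('a \<Rightarrow> real \<Rightarrow> ennreal) \<Rightarrow> bool" where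
  "cond_poisson M F X lam \<longleftrightarrow>
     (\<forall>E\<in>F. \<forall>k::nat. \<forall>B::nat \<Rightarrow> real set. \<forall>c::nat \<Rightarrow> nat.
        (\<forall>i<k. B i \<in> sets borel \<and> (\<exists>T. B i \<subseteq> {0<..T})) \<longrightarrow> disjoint_family_on B {..<k} \<longrightarrow>
        emeasure M (E \<inter> {\<omega>\<in>space M. \<forall>i<k. pcount (X \<omega>) (B i) = of_nat (c i)})
        = (\<integral>\<^sup>+\<omega>. indicator E \<omega> *
              (\<Prod>i<k. poisson_prob (\<integral>\<^sup>+t. lam \<omega> t * indicator (B i) t \<partial>lborel) (c i)) \<partial>M))"

definition gen_sigma :: "'a measure \<Rightarrow> (nat \<Rightarrow> 'a \<Rightarrow> real set) \<Rightarrow> nat \<Rightarrow> 'a set set" where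
  "gen_sigma M Nn n = sigma_sets (space M)
     {{\<omega>\<in>space M. pcount (Nn j \<omega>) B = c} | j B c. j \<le> n \<and> B \<in> sets borel}"

definition hawkes :: "'a measure \<Rightarrow> (nat \<Rightarrow> real \<Rightarrow> real) \<Rightarrow> (nat \<Rightarrow> 'a \<Rightarrow> real set) \<Rightarrow> bool" where
  "hawkes M \<gamma> Nn \<longleftrightarrow>
     (\<forall>n B. B \<in> sets borel \<longrightarrow> (\<lambda>\<omega>. pcount (Nn n \<omega>) B) \<in> borel_measurable M)
   \<and> (AE \<omega> in M. \<forall>n n'. n \<noteq> n' \<longrightarrow> Nn n \<omega> \<inter> Nn n' \<omega> = {})
   \<and> cond_poisson M {space M} (Nn 0) (\<lambda>\<omega> t. ennreal (\<gamma> 0 t))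
   \<and> (\<forall>n. cond_poisson M (gen_sigma M Nn n) (Nn (Suc n))
          (\<lambda>\<omega> t. \<Sum>\<^sub>\<infinity>\<tau>\<in>Nn n \<omega> \<inter> {0<..<t}. ennreal (\<gamma> (Suc n) (t - \<tau>))))"

definition Ncount :: "(nat \<Rightarrow> 'a \<Rightarrow> real set) \<Rightarrow> real \<Rightarrow> 'a \<Rightarrow> ennreal" where
  "Ncount Nn t \<omega> = (\<Sum>n. pcount (Nn n \<omega>) {0<..t})"

definition hconv :: "(real \<Rightarrow> ennreal) \<Rightarrow> (real \<Rightarrow> ennreal) \<Rightarrow> real \<Rightarrow> ennreal" where
  "hconv f g t = (\<integral>\<^sup>+s. f (t - s) * g s * indicator {0..t} s \<partial>lborel)"

fun gchain :: "(nat \<Rightarrow> real \<Rightarrow> real) \<Rightarrow> nat \<Rightarrow> real \<Rightarrow> ennreal" where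
  "gchain \<gamma> 0 = (\<lambda>_. 0)"
| "gchain \<gamma> (Suc 0) = (\<lambda>t. ennreal (\<gamma> 1 t))"
| "gchain \<gamma> (Suc (Suc p)) = hconv (\<lambda>t. ennreal (\<gamma> (Suc (Suc p)) t)) (gchain \<gamma> (Suc p))"

definition Gam :: "(nat \<Rightarrow> real \<Rightarrow> real) \<Rightarrow> nat \<Rightarrow> real" where
  "Gam \<gamma> i = enn2real (\<integral>\<^sup>+u\<in>{0..}. ennreal (\<gamma> i u) \<partial>lborel)"

definition mgen :: "(nat \<Rightarrow> real \<Rightarrow> real) \<Rightarrow> real \<Rightarrow> nat \<Rightarrow> real" where
  "mgen \<gamma> g0 n = g0 * (\<Prod>i\<in>{1..n}. Gam \<gamma> i)"

definition mrate :: "(nat \<Rightarrow> real \<Rightarrow> real) \<Rightarrow> real \<Rightarrow> real" where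
  "mrate \<gamma> g0 = (\<Sum>n. mgen \<gamma> g0 n)"

definition sigma2 :: "(nat \<Rightarrow> real \<Rightarrow> real) \<Rightarrow> real \<Rightarrow> real" where
  "sigma2 \<gamma> g0 = (\<Sum>j. (1 + (\<Sum>p. \<Prod>i\<in>{Suc j..Suc p + j}. Gam \<gamma> i))\<^sup>2 * mgen \<gamma> g0 j)"

text \<open>Rate function J(x) = x^2/(2 sigma^2), with the convention x^2/0 = oo for x <> 0.\<close>
definition Jrate :: "(nat \<Rightarrow> real \<Rightarrow> real) \<Rightarrow> real \<Rightarrow> real \<Rightarrow> ereal" where
  "Jrate \<gamma> g0 x = (if sigma2 \<gamma> g0 = 0 then (if x = 0 then 0 else \<infinity>)
                    else ereal (x\<^sup>2 / (2 * sigma2 \<gamma> g0)))"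

definition elog :: "real \<Rightarrow> ereal" where
  "elog p = (if p = 0 then -\<infinity> else ereal (ln p))"

definition ldp_quantity ::
  "'a measure \<Rightarrow> (nat \<Rightarrow> real \<Rightarrow> real) \<Rightarrow> (nat \<Rightarrow> 'a \<Rightarrow> real set) \<Rightarrow> real \<Rightarrow> (real \<Rightarrow> real)
     \<Rightarrow> real set \<Rightarrow> real \<Rightarrow> ereal" where
  "ldp_quantity M \<gamma> Nn g0 a A t = ereal (t / (a t)\<^sup>2) *
     elog (measure M {\<omega>\<in>space M. Ncount Nn t \<omega> \<noteq> \<infinity> \<and>
            (enn2real (Ncount Nn t \<omega>) - mrate \<gamma> g0 * t) / a t \<in> A})"

end

theory Submission
  imports Defs
begin

text \<open>
  Restricted to its first generations, the process has an explicit exponential moment: conditionally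
  on generation \<open>n\<close>, the sum of \<open>f\<close> over the points of generation \<open>n + 1\<close> has cumulant
  \<open>\<integral>(exp f - 1) d\<lambda>\<close>, which is again a sum over the points of generation \<open>n\<close>, of a function of
  the remaining time only. Iterating, \<open>ln E exp (\<theta> N t)\<close> is the convolution of \<open>\<gamma> 0\<close> with \<open>exp q - 1\<close>,
  where \<open>q\<close> is the cumulant of the cluster of a single point and solves a fixed point equation that
  contracts with factor \<open>\<rho>\<close> for small \<open>\<theta>\<close>. The contraction gives \<open>exp q - 1 = \<theta> A + \<theta>\<^sup>2 V / 2 + O(\<theta>\<^sup>3)\<close>
  uniformly in time, where \<open>A\<close> and \<open>V\<close> are the first two moments of the cluster size. With
  \<open>\<theta>\<close> replaced by \<open>\<theta> a(t) / t\<close>, the mean term is centred up to \<open>O(sqrt t)\<close> by the rate assumptions,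
  the second term converges by a Cesaro argument, and the cubic error is negligible because
  \<open>a(t) / t\<close> tends to \<open>0\<close>. So the scaled cumulants have a quadratic limit, which gives the upper bound by
  Chernoff and the lower bound by localising the exponential moment at the tilting parameter.
\<close>

section \<open>Convolution and cluster cumulants\<close>

text \<open>The cumulant of a full cluster is never constructed. The hypotheses describe each
  generation only given the earlier ones, so only clusters cut off after finitely many generations
  have moments that can be computed. The estimates hold for all large cut-offs with constants
  independent of the cut-off, and pass to the limit in the moment of the total count. Exponential
  moments are obtained only for parameters up to \<open>\<theta>0\<close>; every fixed tilt \<theta>
  is covered because the parameter in use, \<theta> a(t)/t, eventually lies there. A conditional
  intensity is usable only once the parent generation is known to be almost surely finite on bounded
  intervals, so finiteness has to be carried along the generations. The delicate point is the
  centring: \<gamma> 0 has a mean only in the Cesaro sense and may put much mass near t, where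
  little of a cluster has been seen. The missing part of the expected cluster size is only known to
  be of order 1/sqrt of the remaining time, and is paired with the mass of \<gamma> 0 on windows
  ending at t. The variance vanishes exactly when g0 = 0, whence the degenerate cases in the large
  deviation bounds.\<close>

definition conv :: "(real \<Rightarrow> real) \<Rightarrow> (real \<Rightarrow> real) \<Rightarrow> real \<Rightarrow> real" where
  "conv h f u = (\<integral>v. indicator {0..u} v * h v * f (u - v) \<partial>lborel)"

text \<open>The bound is an explicit parameter so that contraction can be tracked quantitatively: a
  convolution with a kernel of mass at most \<rho> multiplies it by \<rho>.\<close>

definition bdd_borel :: "real \<Rightarrow> (real \<Rightarrow> real) \<Rightarrow> bool" where
  "bdd_borel c f \<longleftrightarrow> f \<in> borel_measurable borel \<and> (\<forall>u. \<bar>f u\<bar> \<le> c)"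

lemma bdd_borelD:
  assumes "bdd_borel c f"
  shows "f \<in> borel_measurable borel" "\<bar>f u\<bar> \<le> c"
  using assms by (auto simp: bdd_borel_def)

lemma bdd_borel_nonneg: "bdd_borel c f \<Longrightarrow> 0 \<le> c"
  unfolding bdd_borel_def by (meson abs_ge_zero order_trans)

lemma bdd_borel_cmult: "bdd_borel c f \<Longrightarrow> bdd_borel (\<bar>a\<bar> * c) (\<lambda>w. a * f w)"
  by (auto simp: bdd_borel_def abs_mult intro: mult_left_mono)

lemma bdd_borel_diff: "bdd_borel c f \<Longrightarrow> bdd_borel c' f' \<Longrightarrow> bdd_borel (c + c') (\<lambda>w. f w - f' w)"
  unfolding bdd_borel_def by (auto intro!: order_trans[OF abs_triangle_ineq4] add_mono)

lemma bdd_borel_const: "bdd_borel \<bar>c\<bar> (\<lambda>_. c)" by (simp add: bdd_borel_def)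

lemma bdd_borel_compose:
  assumes "bdd_borel c h" "p \<in> borel_measurable borel"
  shows "bdd_borel c (\<lambda>u. h (p u))"
  using assms measurable_compose[OF assms(2), of h borel] by (simp add: bdd_borel_def)

lemma bdd_borel_exp_diff:
  assumes "bdd_borel c f"
  shows "bdd_borel (exp c + 1) (\<lambda>s. exp (f s) - 1)"
proof -
  note [measurable] = bdd_borelD(1)[OF assms]
  have "\<bar>exp (f s) - 1\<bar> \<le> exp c + 1" for s
  proof -
    have "exp (f s) \<le> exp c" using bdd_borelD(2)[OF assms, of s] by simp
    moreover have "0 < exp (f s)" by simp
    ultimately show ?thesis by linarith
  qed
  then show ?thesis by (simp add: bdd_borel_def)
qed

lemma indicator_bdd_borel: "B \<in> sets borel \<Longrightarrow> bdd_borel 1 (indicator B)"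
  by (simp add: bdd_borel_def)

text \<open>The intensity of generation 0 is not integrable on the half line in general, so finite
  total mass is requested separately where a limit at infinity is taken.\<close>

definition loc_kernel :: "(real \<Rightarrow> real) \<Rightarrow> bool" where
  "loc_kernel h \<longleftrightarrow> h \<in> borel_measurable borel \<and> (\<forall>t. 0 \<le> h t) \<and> (\<forall>T. integrable lborel (\<lambda>v. indicator {0..T} v * h v))"

lemma loc_kernelD:
  assumes "loc_kernel h"
  shows "h \<in> borel_measurable borel" "0 \<le> h t" "integrable lborel (\<lambda>v. indicator {0..T} v * h v :: real)"
  using assms by (auto simp: loc_kernel_def)

lemma kernel_bound:
  assumes "loc_kernel h" "bdd_borel c f"
  shows "\<bar>indicator {0..u} v * h v * f w\<bar> \<le> c * (indicator {0..u} v * h v)"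
  using mult_left_mono[OF bdd_borelD(2)[OF assms(2), of w] loc_kernelD(2)[OF assms(1), of v]]
    loc_kernelD(2)[OF assms(1), of v]
  by (simp add: abs_mult mult.commute split: split_indicator)

lemma conv_integrable:
  assumes "loc_kernel h" "bdd_borel c f"
  shows "integrable lborel (\<lambda>v. indicator {0..u} v * h v * f (u - v))"
proof (rule Bochner_Integration.integrable_bound)
  note [measurable] = loc_kernelD(1)[OF assms(1)] bdd_borelD(1)[OF assms(2)]
  show "integrable lborel (\<lambda>v. c * (indicator {0..u} v * h v))"
    using loc_kernelD(3)[OF assms(1)] by simp
  show "(\<lambda>v. indicator {0..u} v * h v * f (u - v)) \<in> borel_measurable lborel" by measurable
  show "AE v in lborel. norm (indicator {0..u} v * h v * f (u - v)) \<le> norm (c * (indicator {0..u} v * h v))"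
    unfolding real_norm_def by (intro AE_I2 order_trans[OF kernel_bound[OF assms] abs_ge_self])
qed

lemma conv_measurable:
  assumes "h \<in> borel_measurable borel" "f \<in> borel_measurable borel"
  shows "conv h f \<in> borel_measurable borel"
proof -
  note [measurable] = assms
  have "(\<lambda>v. indicator {0..u} v :: real) = (\<lambda>v. if 0 \<le> v \<and> v \<le> u then 1 else 0)" for u :: real
    by (auto simp: fun_eq_iff)
  then have "conv h f = (\<lambda>u. \<integral>v. (if 0 \<le> v \<and> v \<le> u then 1 else 0) * h v * f (u - v) \<partial>lborel)"
    by (simp add: conv_def[abs_def])
  also have "\<dots> \<in> borel_measurable borel" by measurable
  finally show ?thesis .
qed

lemma conv_mono:
  assumes "loc_kernel h" "bdd_borel c f" "bdd_borel c' f'" "\<And>w. f w \<le> f' w"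
  shows "conv h f u \<le> conv h f' u"
  unfolding conv_def
  using assms(4) loc_kernelD(2)[OF assms(1)]
  by (intro integral_mono conv_integrable[OF assms(1,2)] conv_integrable[OF assms(1,3)]) (auto simp: mult_left_mono)

lemma conv_diff:
  assumes "loc_kernel h" "bdd_borel c f" "bdd_borel c' f'"
  shows "conv h (\<lambda>w. f w - f' w) u = conv h f u - conv h f' u"
  unfolding conv_def
  by (subst Bochner_Integration.integral_diff[symmetric])
    (auto intro!: conv_integrable assms simp: right_diff_distrib)

lemma conv_add:
  assumes "loc_kernel h" "bdd_borel c f" "bdd_borel c' f'"
  shows "conv h (\<lambda>w. f w + f' w) u = conv h f u + conv h f' u"
  unfolding conv_def
  by (subst Bochner_Integration.integral_add[symmetric])
    (auto intro!: conv_integrable assms simp: distrib_left)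

lemma conv_cmult: "conv h (\<lambda>w. a * f w) u = a * conv h f u"
  unfolding conv_def by (simp flip: integral_mult_right_zero add: mult_ac)

lemma conv_bound:
  assumes "loc_kernel h" "bdd_borel c f"
  shows "\<bar>conv h f u\<bar> \<le> c * conv h (\<lambda>_. 1) u"
proof -
  have "\<bar>conv h f u\<bar> \<le> (\<integral>v. norm (indicator {0..u} v * h v * f (u - v)) \<partial>lborel)"
    unfolding conv_def real_norm_def[symmetric] by (rule integral_norm_bound)
  also have "\<dots> \<le> (\<integral>v. c * (indicator {0..u} v * h v) \<partial>lborel)"
    using loc_kernelD(3)[OF assms(1)] kernel_bound[OF assms]
    by (intro integral_mono integrable_norm conv_integrable[OF assms]) auto
  finally show ?thesis by (simp add: conv_def)
qed

lemma conv_sums: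
  assumes h: "loc_kernel h" and f: "\<And>p::nat. bdd_borel (c p) (f p)" and c: "summable c"
  shows "(\<lambda>p. conv h (f p) u) sums conv h (\<lambda>w. \<Sum>p. f p w) u"
proof -
  have sm: "summable (\<lambda>p. \<bar>f p w\<bar>)" for w
    using bdd_borelD(2)[OF f] by (intro summable_comparison_test'[OF c, of 0]) auto
  have "(\<lambda>p. \<integral>v. indicator {0..u} v * h v * f p (u - v) \<partial>lborel) sums
     (\<integral>v. (\<Sum>p. indicator {0..u} v * h v * f p (u - v)) \<partial>lborel)"
  proof (rule sums_integral)
    show "integrable lborel (\<lambda>v. indicator {0..u} v * h v * f p (u - v))" for p
      by (rule conv_integrable[OF h f])
    show "AE v in lborel. summable (\<lambda>p. norm (indicator {0..u} v * h v * f p (u - v)))"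
      using sm by (auto simp: abs_mult intro!: summable_mult)
    show "summable (\<lambda>p. \<integral>v. norm (indicator {0..u} v * h v * f p (u - v)) \<partial>lborel)"
    proof (rule summable_comparison_test'[of _ 0])
      show "summable (\<lambda>p. c p * conv h (\<lambda>_. 1) u)" using c by (rule summable_mult2)
      fix p
      have "(\<integral>v. norm (indicator {0..u} v * h v * f p (u - v)) \<partial>lborel) = conv h (\<lambda>w. \<bar>f p w\<bar>) u"
        unfolding conv_def using loc_kernelD(2)[OF h] by (auto simp: abs_mult intro!: Bochner_Integration.integral_cong)
      moreover have "bdd_borel (c p) (\<lambda>w. \<bar>f p w\<bar>)" using f[of p] by (auto simp: bdd_borel_def)
      ultimately show "norm (\<integral>v. norm (indicator {0..u} v * h v * f p (u - v)) \<partial>lborel) \<le> c p * conv h (\<lambda>_. 1) u"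
        using conv_bound[OF h] by simp
    qed
  qed
  moreover have "(\<Sum>p. indicator {0..u} v * h v * f p (u - v)) = indicator {0..u} v * h v * (\<Sum>p. f p (u - v))" for v
    by (rule suminf_mult[OF summable_rabs_cancel[OF sm]])
  ultimately show ?thesis by (simp add: conv_def)
qed

text \<open>Dominated convergence with majorant \<open>c * h v\<close>: for fixed \<open>v\<close>
  the argument \<open>u - v\<close> tends to infinity. Since \<open>h\<close> vanishes at negative
  times, the integral over the line is the mass of the half line.\<close>

lemma conv_tendsto:
  assumes h: "loc_kernel h" and neg: "\<And>t. t < 0 \<Longrightarrow> h t = 0" and int: "integrable lborel h"
    and f: "bdd_borel c f" and lim: "(f \<longlongrightarrow> L) at_top"
  shows "(conv h f \<longlongrightarrow> (\<integral>v. h v \<partial>lborel) * L) at_top"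
proof -
  note [measurable] = loc_kernelD(1)[OF h] bdd_borelD(1)[OF f]
  have "((\<lambda>u. \<integral>v. indicator {0..u} v * h v * f (u - v) \<partial>lborel) \<longlongrightarrow> (\<integral>v. h v * L \<partial>lborel)) at_top"
  proof (rule integral_dominated_convergence_at_top[where w = "\<lambda>v. c * h v"])
    show "\<forall>\<^sub>F u in at_top. AE v in lborel. norm (indicator {0..u} v * h v * f (u - v)) \<le> c * h v"
    proof (intro always_eventually allI AE_I2)
      fix u v
      have "0 \<le> c * h v" using loc_kernelD(2)[OF h, of v] bdd_borel_nonneg[OF f] by simp
      then show "norm (indicator {0..u} v * h v * f (u - v)) \<le> c * h v"
        using kernel_bound[OF h f, of u v "u - v"] by (auto split: split_indicator)
    qed
    show "AE v in lborel. ((\<lambda>u. indicator {0..u} v * h v * f (u - v)) \<longlongrightarrow> h v * L) at_top"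
    proof (intro AE_I2)
      fix v :: real
      have "filterlim (\<lambda>u. u - v) at_top at_top"
        unfolding filterlim_at_top eventually_at_top_linorder by (metis add_le_imp_le_diff)
      then have 1: "((\<lambda>u. h v * f (u - v)) \<longlongrightarrow> h v * L) at_top"
        by (intro tendsto_mult tendsto_const filterlim_compose[OF lim])
      show "((\<lambda>u. indicator {0..u} v * h v * f (u - v)) \<longlongrightarrow> h v * L) at_top"
      proof (cases "v < 0")
        case False
        have "\<forall>\<^sub>F u in at_top. h v * f (u - v) = indicator {0..u} v * h v * f (u - v)"
          using eventually_ge_at_top[of v] by eventually_elim (use False in simp)
        then show ?thesis using 1 by (rule Lim_transform_eventually[rotated])
      qed (simp add: neg)
    qed
    show "integrable lborel (\<lambda>v. c * h v)" using int by simp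
  qed measurable
  then show ?thesis by (simp add: conv_def[abs_def])
qed

section \<open>Taylor bounds for exp and the contraction principle\<close>

lemma exp_small_bounds:
  fixes x :: real
  assumes "\<bar>x\<bar> \<le> 1"
  shows "\<bar>exp x - 1 - x\<bar> \<le> 2 * x\<^sup>2" "\<bar>exp x - 1 - x - x\<^sup>2 / 2\<bar> \<le> \<bar>x\<bar> ^ 3" "\<bar>exp x - 1\<bar> \<le> \<bar>x\<bar> + 2 * x\<^sup>2"
proof -
  \<comment> \<open>The remainder is evaluated at a point of modulus at most 1, where exp is at most
    3; the constants 2 and 1 are 3/2 and 3/6 rounded up.\<close>
  have e: "exp t \<le> 3" if "\<bar>t\<bar> \<le> \<bar>x\<bar>" for t :: real
    using that assms exp_le by (meson abs_le_D1 exp_le_cancel_iff order_trans)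
  obtain s where s: "\<bar>s\<bar> \<le> \<bar>x\<bar>" "exp x = (\<Sum>m<2. x ^ m / fact m) + exp s / fact 2 * x ^ 2"
    using Maclaurin_exp_le by blast
  then have "\<bar>exp x - 1 - x\<bar> = exp s / 2 * x\<^sup>2" by (simp add: numeral_2_eq_2 lessThan_Suc)
  also have "\<dots> \<le> 2 * x\<^sup>2" using e[OF s(1)] by (intro mult_right_mono) auto
  finally show 1: "\<bar>exp x - 1 - x\<bar> \<le> 2 * x\<^sup>2" .
  then show "\<bar>exp x - 1\<bar> \<le> \<bar>x\<bar> + 2 * x\<^sup>2" by linarith
  obtain s where s: "\<bar>s\<bar> \<le> \<bar>x\<bar>" "exp x = (\<Sum>m<3. x ^ m / fact m) + exp s / fact 3 * x ^ 3"
    using Maclaurin_exp_le by blast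
  then have "\<bar>exp x - 1 - x - x\<^sup>2 / 2\<bar> = \<bar>exp s / 6 * x ^ 3\<bar>" by (simp add: numeral_3_eq_3 lessThan_Suc fact_Suc power2_eq_square)
  also have "\<dots> = exp s / 6 * \<bar>x\<bar> ^ 3" by (simp add: abs_mult power_abs)
  also have "\<dots> \<le> 1 * \<bar>x\<bar> ^ 3" using e[OF s(1)] by (intro mult_right_mono) auto
  finally show "\<bar>exp x - 1 - x - x\<^sup>2 / 2\<bar> \<le> \<bar>x\<bar> ^ 3" by simp
qed

lemma bdd_borel_exp_minus_one:
  assumes "bdd_borel c f" "c \<le> 1"
  shows "bdd_borel (c + 2 * c\<^sup>2) (\<lambda>w. exp (f w) - 1)"
proof -
  note [measurable] = bdd_borelD(1)[OF assms(1)]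
  have "\<bar>exp (f w) - 1\<bar> \<le> c + 2 * c\<^sup>2" for w
  proof -
    have f: "\<bar>f w\<bar> \<le> c" by (rule bdd_borelD(2)[OF assms(1)])
    have "(f w)\<^sup>2 \<le> c\<^sup>2" using f by (rule abs_le_square_iff[THEN iffD1, OF order_trans[OF _ abs_ge_self]])
    then show ?thesis using exp_small_bounds(3)[of "f w"] f assms(2) by linarith
  qed
  then show ?thesis by (simp add: bdd_borel_def)
qed

text \<open>\<open>Q b\<close> stands for: a certain error is, in the sense at hand, eventually at most \<open>b\<close>.\<close>
lemma contraction_bound:
  fixes Q :: "real \<Rightarrow> bool"
  assumes start: "Q B" "0 \<le> B" and step: "\<And>b. 0 \<le> b \<Longrightarrow> Q b \<Longrightarrow> Q (\<rho> * b + K)"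
    and mono: "\<And>b b'. Q b \<Longrightarrow> b \<le> b' \<Longrightarrow> Q b'" and \<rho>: "0 \<le> \<rho>" "\<rho> < 1" and K: "0 \<le> K"
    and c: "K / (1 - \<rho>) < c"
  shows "Q c"
proof -
  \<comment> \<open>Iterating b -> \<rho> b + K approaches the fixed point K/(1 - \<rho>)
    geometrically but need not reach it; the strict gap to \<open>c\<close> lets finitely many
    iterations suffice.\<close>
  have Qn: "Q (\<rho> ^ n * B + K / (1 - \<rho>))" for n
  proof (induction n)
    case 0 show ?case using start K \<rho> by (auto intro: mono)
  next
    case (Suc n)
    have "\<rho> * (\<rho> ^ n * B + K / (1 - \<rho>)) + K = \<rho> ^ Suc n * B + K / (1 - \<rho>)"
      using \<rho> by (simp add: field_simps)
    then show ?case using step[OF _ Suc] start K \<rho> by simp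
  qed
  have "(\<lambda>n. \<rho> ^ n * B + K / (1 - \<rho>)) \<longlonglongrightarrow> 0 * B + K / (1 - \<rho>)"
    using \<rho> by (intro tendsto_intros LIMSEQ_realpow_zero) auto
  then have "\<forall>\<^sub>F n in sequentially. \<rho> ^ n * B + K / (1 - \<rho>) < c"
    using c by (intro order_tendstoD(2)) auto
  then obtain n where "\<rho> ^ n * B + K / (1 - \<rho>) < c" by (auto simp: eventually_sequentially)
  then show ?thesis using Qn[of n] by (auto intro: mono)
qed

section \<open>Iterated convolutions along the generations\<close>

locale kernels =
  fixes g :: "nat \<Rightarrow> real \<Rightarrow> real" and \<rho> :: real
  assumes g_meas [measurable]: "\<And>k. g k \<in> borel_measurable borel"
    and g_nonneg: "\<And>k t. 0 \<le> g k t"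
    and g_neg: "\<And>k t. t < 0 \<Longrightarrow> g k t = 0"
    and g0_loc: "\<And>T. integrable lborel (\<lambda>v. indicator {0..T} v * g 0 v :: real)"
    and g_int: "\<And>k. integrable lborel (g (Suc k))"
    and g_le: "\<And>k. (\<integral>v. g (Suc k) v \<partial>lborel) \<le> \<rho>"
    and \<rho>1: "\<rho> < 1"
begin

definition G :: "nat \<Rightarrow> real" where "G k = (\<integral>v. g k v \<partial>lborel)"

lemma G_nonneg: "0 \<le> G k" unfolding G_def using g_nonneg by (simp add: integral_nonneg)

lemma G_le: "G (Suc k) \<le> \<rho>" unfolding G_def by (rule g_le)

lemma \<rho>0: "0 \<le> \<rho>" using G_nonneg[of "Suc 0"] G_le[of 0] by linarith

lemma loc_kernel_g: "loc_kernel (g k)"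
proof (cases k)
  case 0 then show ?thesis using g_nonneg g_meas g0_loc by (simp add: loc_kernel_def)
next
  case (Suc m)
  then show ?thesis using g_nonneg g_meas integrable_mult_indicator[OF _ g_int[of m]] integrable_real_mult_indicator[OF _ g_int[of m]]
    by (simp add: loc_kernel_def)
qed

lemma conv_one_le: "conv (g (Suc k)) (\<lambda>_. 1) u \<le> \<rho>"
proof -
  have "conv (g (Suc k)) (\<lambda>_. 1) u \<le> G (Suc k)"
    unfolding conv_def G_def using g_nonneg loc_kernelD(3)[OF loc_kernel_g] g_int
    by (intro integral_mono) (auto split: split_indicator)
  then show ?thesis using G_le by (rule order_trans)
qed

lemma conv_contracts:
  assumes "bdd_borel c f"
  shows "bdd_borel (\<rho> * c) (conv (g (Suc k)) f)"
proof -
  have "\<bar>conv (g (Suc k)) f u\<bar> \<le> \<rho> * c" for u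
    using conv_bound[OF loc_kernel_g[of "Suc k"] assms, of u]
      mult_left_mono[OF conv_one_le[of k u] bdd_borel_nonneg[OF assms]]
    by (simp add: mult.commute)
  then show ?thesis using conv_measurable[OF g_meas bdd_borelD(1)[OF assms]]
    by (simp add: bdd_borel_def)
qed

text \<open>Expected sum of \<open>f\<close> (remaining time) over the descendants exactly
  \<open>p\<close> generations below a point of generation \<open>k\<close>. The kernels differ
  between generations, so \<open>k\<close> moves along; the kernel of the nearest generation is
  outermost.\<close>

primrec iter_conv :: "nat \<Rightarrow> nat \<Rightarrow> (real \<Rightarrow> real) \<Rightarrow> real \<Rightarrow> real" where
  "iter_conv 0 k f = f"
| "iter_conv (Suc p) k f = conv (g (Suc k)) (iter_conv p (Suc k) f)"

lemma iter_conv_bounded: "bdd_borel c f \<Longrightarrow> bdd_borel (\<rho> ^ p * c) (iter_conv p k f)"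
proof (induction p arbitrary: k)
  case (Suc p)
  then show ?case using conv_contracts[OF Suc.IH[OF Suc.prems]] by (simp add: mult.assoc)
qed simp

text \<open>Neumann series for the linear system in which level \<open>k\<close> equals
  \<open>f k\<close> plus the convolution of \<open>g (Suc k)\<close> with level
  \<open>Suc k\<close>.\<close>

definition gen_sum :: "(nat \<Rightarrow> real \<Rightarrow> real) \<Rightarrow> nat \<Rightarrow> real \<Rightarrow> real" where
  "gen_sum f k u = (\<Sum>p. iter_conv p k (f (k + p)) u)"

lemma summable_rho: "summable (\<lambda>p. \<rho> ^ p * c)"
  using \<rho>0 \<rho>1 by (intro summable_mult2 summable_geometric) auto

lemma gen_sum_summable:
  assumes "\<And>k. bdd_borel c (f k)"
  shows "summable (\<lambda>p. iter_conv p k (f (k + p)) u)"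
  using bdd_borelD(2)[OF iter_conv_bounded[OF assms]]
  by (intro summable_comparison_test'[OF summable_rho[of c], of 0]) auto

lemma gen_sum_bounded:
  assumes "\<And>k. bdd_borel c (f k)"
  shows "bdd_borel (c / (1 - \<rho>)) (gen_sum f k)"
proof -
  have [measurable]: "iter_conv p k (f (k + p)) \<in> borel_measurable borel" for p
    by (rule bdd_borelD(1)[OF iter_conv_bounded[OF assms]])
  have "gen_sum f k \<in> borel_measurable borel" unfolding gen_sum_def[abs_def] by measurable
  moreover have "\<bar>gen_sum f k u\<bar> \<le> c / (1 - \<rho>)" for u
  proof -
    have s: "summable (\<lambda>p. \<bar>iter_conv p k (f (k + p)) u\<bar>)"
      using bdd_borelD(2)[OF iter_conv_bounded[OF assms]]
      by (intro summable_comparison_test'[OF summable_rho[of c], of 0]) auto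
    have "\<bar>gen_sum f k u\<bar> \<le> (\<Sum>p. \<bar>iter_conv p k (f (k + p)) u\<bar>)"
      unfolding gen_sum_def by (rule summable_rabs[OF s])
    also have "\<dots> \<le> (\<Sum>p. \<rho> ^ p * c)"
      by (intro suminf_le s summable_rho bdd_borelD(2)[OF iter_conv_bounded[OF assms]])
    also have "\<dots> = c / (1 - \<rho>)"
      using \<rho>0 \<rho>1 by (simp add: suminf_mult2[symmetric] suminf_geometric)
    finally show ?thesis .
  qed
  ultimately show ?thesis by (simp add: bdd_borel_def)
qed

lemma gen_sum_rec:
  assumes "\<And>k. bdd_borel c (f k)"
  shows "gen_sum f k u = f k u + conv (g (Suc k)) (gen_sum f (Suc k)) u"
proof -
  have "gen_sum f k u = iter_conv 0 k (f (k + 0)) u + (\<Sum>p. iter_conv (Suc p) k (f (k + Suc p)) u)"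
    unfolding gen_sum_def using suminf_split_head[OF gen_sum_summable[where f = f and c = c and k = k and u = u]] assms by simp
  also have "(\<Sum>p. iter_conv (Suc p) k (f (k + Suc p)) u) = (\<Sum>p. conv (g (Suc k)) (iter_conv p (Suc k) (f (Suc k + p))) u)"
    by simp
  also have "\<dots> = conv (g (Suc k)) (gen_sum f (Suc k)) u"
    unfolding gen_sum_def[abs_def]
    by (rule sums_unique[symmetric], rule conv_sums[OF loc_kernel_g iter_conv_bounded[OF assms] summable_rho])
  finally show ?thesis by simp
qed

lemma iter_conv_tendsto:
  assumes "bdd_borel c f" "(f \<longlongrightarrow> L) at_top"
  shows "(iter_conv p k f \<longlongrightarrow> (\<Prod>i\<in>{Suc k..p + k}. G i) * L) at_top"
proof (induction p arbitrary: k)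
  case (Suc p)
  have "{Suc k..Suc p + k} = insert (Suc k) {Suc (Suc k)..p + Suc k}" by auto
  then have "(\<Prod>i\<in>{Suc k..Suc p + k}. G i) * L = G (Suc k) * ((\<Prod>i\<in>{Suc (Suc k)..p + Suc k}. G i) * L)"
    by (simp only: prod.insert[OF finite_atLeastAtMost] atLeastAtMost_iff Suc_n_not_le_n simp_thms if_False mult.assoc)
  moreover have "(conv (g (Suc k)) (iter_conv p (Suc k) f) \<longlongrightarrow> G (Suc k) * ((\<Prod>i\<in>{Suc (Suc k)..p + Suc k}. G i) * L)) at_top"
    unfolding G_def[of "Suc k"]
    by (rule conv_tendsto[OF loc_kernel_g g_neg g_int iter_conv_bounded[OF assms(1)] Suc.IH])
  ultimately show ?case by (simp only: iter_conv.simps)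
qed (use assms in simp)

text \<open>Tannery's theorem: term \<open>p\<close> is at most \<rho>^p c uniformly in
  \<open>u\<close>, so the limit may be taken term by term.\<close>

lemma gen_sum_tendsto:
  assumes "\<And>k. bdd_borel c (f k)" "\<And>k. (f k \<longlongrightarrow> L k) at_top"
  shows "(gen_sum f k \<longlongrightarrow> (\<Sum>p. (\<Prod>i\<in>{Suc k..p + k}. G i) * L (k + p))) at_top"
    "summable (\<lambda>p. (\<Prod>i\<in>{Suc k..p + k}. G i) * L (k + p))"
proof -
  have "eventually (\<lambda>u. summable (\<lambda>p. norm (iter_conv p k (f (k + p)) u))) at_top \<and>
     summable (\<lambda>p. norm ((\<Prod>i\<in>{Suc k..p + k}. G i) * L (k + p))) \<and>
     ((\<lambda>u. \<Sum>p. iter_conv p k (f (k + p)) u) \<longlongrightarrow> (\<Sum>p. (\<Prod>i\<in>{Suc k..p + k}. G i) * L (k + p))) at_top"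
  proof (rule tannerys_theorem[where M = "\<lambda>p. \<rho> ^ p * c"])
    show "((\<lambda>u. iter_conv p k (f (k + p)) u) \<longlongrightarrow> (\<Prod>i\<in>{Suc k..p + k}. G i) * L (k + p)) at_top" for p
      by (rule iter_conv_tendsto[OF assms(1,2)])
    show "\<forall>\<^sub>F (p, u) in at_top \<times>\<^sub>F at_top. norm (iter_conv p k (f (k + p)) u) \<le> \<rho> ^ p * c"
      using bdd_borelD(2)[OF iter_conv_bounded[OF assms(1)]] by (intro always_eventually) auto
  qed (auto simp: summable_rho)
  then show "(gen_sum f k \<longlongrightarrow> (\<Sum>p. (\<Prod>i\<in>{Suc k..p + k}. G i) * L (k + p))) at_top"
    "summable (\<lambda>p. (\<Prod>i\<in>{Suc k..p + k}. G i) * L (k + p))"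
    by (auto simp: gen_sum_def[abs_def] intro: summable_norm_cancel)
qed

text \<open>\<open>EA\<close> and \<open>EV\<close> are the first and second moment of the size,
  root included, of the cluster of a generation \<open>k\<close> point with remaining time
  \<open>u\<close>. The square in \<open>EV\<close> is the squared mean; the remaining variance is
  that of a Poisson sum of clusters, hence an expected sum of second moments one generation further
  on.\<close>

definition EA :: "nat \<Rightarrow> real \<Rightarrow> real" where "EA = gen_sum (\<lambda>_ _. 1)"
definition EV :: "nat \<Rightarrow> real \<Rightarrow> real" where "EV = gen_sum (\<lambda>k u. (EA k u)\<^sup>2)"
definition \<alpha> :: "nat \<Rightarrow> real" where "\<alpha> k = (\<Sum>p. \<Prod>i\<in>{Suc k..p + k}. G i)"

lemma EA_bounded: "bdd_borel (1 / (1 - \<rho>)) (EA k)"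
  unfolding EA_def by (rule gen_sum_bounded) (simp add: bdd_borel_def)

lemma EA_sq_bounded: "bdd_borel ((1 / (1 - \<rho>))\<^sup>2) (\<lambda>u. (EA k u)\<^sup>2)"
proof -
  note [measurable] = bdd_borelD(1)[OF EA_bounded]
  show ?thesis using power_mono[OF bdd_borelD(2)[OF EA_bounded], of k _ 2]
    by (simp add: bdd_borel_def del: power_divide)
qed

lemma EV_bounded: "bdd_borel ((1 / (1 - \<rho>))\<^sup>2 / (1 - \<rho>)) (EV k)"
  unfolding EV_def by (rule gen_sum_bounded[OF EA_sq_bounded])

lemma EA_rec: "EA k u = 1 + conv (g (Suc k)) (EA (Suc k)) u"
  unfolding EA_def by (rule gen_sum_rec[of 1]) (simp add: bdd_borel_def)

lemma EV_rec: "EV k u = (EA k u)\<^sup>2 + conv (g (Suc k)) (EV (Suc k)) u"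
  unfolding EV_def by (rule gen_sum_rec[OF EA_sq_bounded])

lemma EA_tendsto: "(EA k \<longlongrightarrow> \<alpha> k) at_top"
  using gen_sum_tendsto(1)[of 1 "\<lambda>_ _. 1" "\<lambda>_. 1 :: real" k] by (simp add: EA_def \<alpha>_def bdd_borel_def)

lemma \<alpha>_summable: "summable (\<lambda>p. \<Prod>i\<in>{Suc k..p + k}. G i)"
  using gen_sum_tendsto(2)[of 1 "\<lambda>_ _. 1" "\<lambda>_. 1 :: real" k] by (simp add: bdd_borel_def)

lemma EV_tendsto: "(EV 0 \<longlongrightarrow> (\<Sum>j. (\<Prod>i\<in>{1..j}. G i) * (\<alpha> j)\<^sup>2)) at_top"
  using gen_sum_tendsto(1)[OF EA_sq_bounded tendsto_power[OF EA_tendsto], where k = 0] by (simp add: EV_def)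

section \<open>Small parameter expansion of the cut-off cumulants\<close>

definition \<kappa> :: real where "\<kappa> = 2 / (1 - \<rho>)"
text \<open>Chosen together with \<open>\<kappa>\<close> so that q -> \<theta> + g * (exp q - 1)
  maps the ball of radius \<kappa>|\<theta>| into itself. By |exp x - 1| \<le> |x| + 2 x^2 the image
  has radius at most |\<theta>| (1 + \<rho> \<kappa> + 2 \<kappa>^2 |\<theta>|); the identity
  \<kappa> - \<rho> \<kappa> = 2 pays 1 for \<theta> and 1 for the quadratic term, which
  \<open>\<theta>0\<close> keeps below 1.\<close>

definition \<theta>0 :: real where "\<theta>0 = 1 / (2 * \<kappa>\<^sup>2)"

lemma \<kappa>: "2 \<le> \<kappa>" "1 / (1 - \<rho>) \<le> \<kappa>" "\<kappa> - \<rho> * \<kappa> = 2" and \<theta>0: "0 < \<theta>0"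
proof -
  show "2 \<le> \<kappa>" using \<rho>0 \<rho>1 by (simp add: \<kappa>_def le_divide_eq)
  then show "0 < \<theta>0" by (simp add: \<theta>0_def)
  show "1 / (1 - \<rho>) \<le> \<kappa>" using \<rho>1 by (simp add: \<kappa>_def divide_right_mono)
  have "\<kappa> * (1 - \<rho>) = 2" using \<rho>1 unfolding \<kappa>_def times_divide_eq_left
    by (intro nonzero_mult_div_cancel_right) auto
  then show "\<kappa> - \<rho> * \<kappa> = 2" by (simp add: algebra_simps)
qed

lemma \<theta>_small:
  assumes "\<bar>\<theta>\<bar> \<le> \<theta>0"
  shows "2 * \<kappa>\<^sup>2 * \<bar>\<theta>\<bar> \<le> 1" "\<kappa> * \<bar>\<theta>\<bar> \<le> 1"
proof -
  show 1: "2 * \<kappa>\<^sup>2 * \<bar>\<theta>\<bar> \<le> 1" using assms \<kappa>(1) by (simp add: \<theta>0_def field_simps)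
  have "\<kappa> * \<bar>\<theta>\<bar> * 1 \<le> \<kappa> * \<bar>\<theta>\<bar> * (2 * \<kappa>)" using \<kappa>(1) by (intro mult_left_mono) auto
  then show "\<kappa> * \<bar>\<theta>\<bar> \<le> 1" using 1 by (simp add: power2_eq_square algebra_simps)
qed

text \<open>Picard iterates started at the constant \<theta>, the cumulant of a point without
  offspring; each iteration adds one generation of descendants.\<close>

primrec cumulant :: "real \<Rightarrow> nat \<Rightarrow> nat \<Rightarrow> real \<Rightarrow> real" where
  "cumulant \<theta> 0 k = (\<lambda>_. \<theta>)"
| "cumulant \<theta> (Suc n) k = (\<lambda>u. \<theta> + conv (g (Suc k)) (\<lambda>w. exp (cumulant \<theta> n (Suc k) w) - 1) u)"

lemma cumulant_bounded:
  assumes \<theta>: "\<bar>\<theta>\<bar> \<le> \<theta>0"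
  shows "bdd_borel (\<kappa> * \<bar>\<theta>\<bar>) (cumulant \<theta> n k)"
proof (induction n arbitrary: k)
  case 0
  have "1 * \<bar>\<theta>\<bar> \<le> \<kappa> * \<bar>\<theta>\<bar>" using \<kappa>(1) by (intro mult_right_mono) auto
  then show ?case by (simp add: bdd_borel_def)
next
  case (Suc n)
  let ?f = "conv (g (Suc k)) (\<lambda>w. exp (cumulant \<theta> n (Suc k) w) - 1)"
  have f: "bdd_borel (\<rho> * (\<kappa> * \<bar>\<theta>\<bar> + 2 * (\<kappa> * \<bar>\<theta>\<bar>)\<^sup>2)) ?f"
    using \<theta>_small[OF \<theta>] by (intro conv_contracts bdd_borel_exp_minus_one Suc.IH) auto
  note [measurable] = bdd_borelD(1)[OF f]
  have "\<bar>\<theta>\<bar> + \<rho> * (\<kappa> * \<bar>\<theta>\<bar> + 2 * (\<kappa> * \<bar>\<theta>\<bar>)\<^sup>2) = \<bar>\<theta>\<bar> * (1 + \<rho> * \<kappa> + \<rho> * (2 * \<kappa>\<^sup>2 * \<bar>\<theta>\<bar>))"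
    by (simp add: power2_eq_square algebra_simps)
  also have "\<dots> \<le> \<bar>\<theta>\<bar> * (1 + \<rho> * \<kappa> + 1 * 1)"
    using \<theta>_small[OF \<theta>] \<rho>0 \<rho>1 by (intro mult_left_mono add_left_mono mult_mono) auto
  also have "\<dots> = \<kappa> * \<bar>\<theta>\<bar>" using \<kappa>(3) by (simp add: algebra_simps)
  finally have "\<bar>\<theta> + ?f u\<bar> \<le> \<kappa> * \<bar>\<theta>\<bar>" for u
    using bdd_borelD(2)[OF f, of u] by linarith
  then show ?case by (simp add: bdd_borel_def)
qed

lemma cumulant_exp_bounded:
  assumes \<theta>: "\<bar>\<theta>\<bar> \<le> \<theta>0"
  shows "bdd_borel (\<kappa> * \<bar>\<theta>\<bar> + 2 * (\<kappa> * \<bar>\<theta>\<bar>)\<^sup>2) (\<lambda>w. exp (cumulant \<theta> n k w) - 1)"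
  using \<theta>_small[OF \<theta>] by (intro bdd_borel_exp_minus_one cumulant_bounded \<theta>)

lemma EA_le: "\<bar>EA k u\<bar> \<le> \<kappa>"
  using bdd_borelD(2)[OF EA_bounded] \<kappa>(2) by (rule order_trans)

text \<open>By the recursion for \<open>EA\<close>, the error at stage \<open>Suc n\<close> is the
  convolution of exp q - 1 - \<theta> \<open>EA\<close> at stage \<open>n\<close>. Replacing exp q -
  1 by q costs 2 q^2 \<le> 2 \<kappa>^2 \<theta>^2; the rest is the previous error, contracted by
  \<rho>.\<close>

lemma cumulant_first_order:
  assumes \<theta>: "\<bar>\<theta>\<bar> \<le> \<theta>0" "\<theta> \<noteq> 0"
  shows "\<forall>\<^sub>F n in sequentially. \<forall>k u. \<bar>cumulant \<theta> n k u - \<theta> * EA k u\<bar> \<le> (3 * \<kappa>\<^sup>2 / (1 - \<rho>)) * \<theta>\<^sup>2"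
proof (rule contraction_bound[where \<rho> = \<rho> and B = "2 * \<kappa> * \<bar>\<theta>\<bar>" and K = "2 * \<kappa>\<^sup>2 * \<theta>\<^sup>2"])
  have "\<bar>cumulant \<theta> n k u - \<theta> * EA k u\<bar> \<le> 2 * \<kappa> * \<bar>\<theta>\<bar>" for n k u
  proof -
    have "\<bar>\<theta> * EA k u\<bar> \<le> \<kappa> * \<bar>\<theta>\<bar>"
      using mult_left_mono[OF EA_le[of k u], of "\<bar>\<theta>\<bar>"] by (simp add: abs_mult mult.commute)
    then show ?thesis using bdd_borelD(2)[OF cumulant_bounded[OF \<theta>(1)], of n k u] by linarith
  qed
  then show "\<forall>\<^sub>F n in sequentially. \<forall>k u. \<bar>cumulant \<theta> n k u - \<theta> * EA k u\<bar> \<le> 2 * \<kappa> * \<bar>\<theta>\<bar>" by simp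
  show "0 \<le> 2 * \<kappa> * \<bar>\<theta>\<bar>" "0 \<le> 2 * \<kappa>\<^sup>2 * \<theta>\<^sup>2" using \<kappa>(1) by auto
  \<comment> \<open>The 3 in place of 2 creates the strict gap that \<open>contraction_bound\<close>
    asks for; this is where \<theta> \<noteq> 0 enters.\<close>
  have "2 * \<kappa>\<^sup>2 * \<theta>\<^sup>2 < 3 * \<kappa>\<^sup>2 * \<theta>\<^sup>2" using \<kappa>(1) \<theta> by simp
  then show "2 * \<kappa>\<^sup>2 * \<theta>\<^sup>2 / (1 - \<rho>) < 3 * \<kappa>\<^sup>2 / (1 - \<rho>) * \<theta>\<^sup>2"
    using \<rho>1 by (simp add: divide_strict_right_mono)
  fix b assume b: "0 \<le> b" "\<forall>\<^sub>F n in sequentially. \<forall>k u. \<bar>cumulant \<theta> n k u - \<theta> * EA k u\<bar> \<le> b"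
  from b(2) have "\<forall>\<^sub>F n in sequentially. \<forall>k u. \<bar>cumulant \<theta> (Suc n) k u - \<theta> * EA k u\<bar> \<le> \<rho> * b + 2 * \<kappa>\<^sup>2 * \<theta>\<^sup>2"
  proof (eventually_elim, intro allI)
    fix n k u assume n: "\<forall>k u. \<bar>cumulant \<theta> n k u - \<theta> * EA k u\<bar> \<le> b"
    let ?h = "\<lambda>w. exp (cumulant \<theta> n (Suc k) w) - 1 - \<theta> * EA (Suc k) w"
    have bd: "bdd_borel (\<kappa> * \<bar>\<theta>\<bar> + 2 * (\<kappa> * \<bar>\<theta>\<bar>)\<^sup>2 + \<bar>\<theta>\<bar> * (1 / (1 - \<rho>))) ?h"
      by (intro bdd_borel_diff cumulant_exp_bounded bdd_borel_cmult EA_bounded \<theta>)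
    have "\<bar>?h w\<bar> \<le> b + 2 * \<kappa>\<^sup>2 * \<theta>\<^sup>2" for w
    proof -
      let ?x = "cumulant \<theta> n (Suc k) w"
      have x: "\<bar>?x\<bar> \<le> \<kappa> * \<bar>\<theta>\<bar>" by (rule bdd_borelD(2)[OF cumulant_bounded[OF \<theta>(1)]])
      then have "?x\<^sup>2 \<le> (\<kappa> * \<bar>\<theta>\<bar>)\<^sup>2" using \<kappa>(1) by (intro abs_le_square_iff[THEN iffD1]) (simp add: abs_mult)
      then show ?thesis
        using exp_small_bounds(1)[of ?x] x \<theta>_small[OF \<theta>(1)] n[rule_format, of "Suc k" w] by (simp add: power_mult_distrib)
    qed
    then have "bdd_borel (b + 2 * \<kappa>\<^sup>2 * \<theta>\<^sup>2) ?h" using bd by (simp add: bdd_borel_def)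
    from bdd_borelD(2)[OF conv_contracts[OF this], of k u]
    have 1: "\<bar>conv (g (Suc k)) ?h u\<bar> \<le> \<rho> * b + \<rho> * (2 * \<kappa>\<^sup>2 * \<theta>\<^sup>2)" by (simp add: distrib_left)
    have 2: "\<rho> * (2 * \<kappa>\<^sup>2 * \<theta>\<^sup>2) \<le> 1 * (2 * \<kappa>\<^sup>2 * \<theta>\<^sup>2)" using \<rho>1 by (intro mult_right_mono) auto
    have "conv (g (Suc k)) ?h u = conv (g (Suc k)) (\<lambda>w. exp (cumulant \<theta> n (Suc k) w) - 1) u - \<theta> * conv (g (Suc k)) (EA (Suc k)) u"
      by (simp only: conv_diff[OF loc_kernel_g cumulant_exp_bounded[OF \<theta>(1)] bdd_borel_cmult[OF EA_bounded]] conv_cmult)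
    also have "\<dots> = cumulant \<theta> (Suc n) k u - \<theta> * EA k u"
      by (simp add: EA_rec[of k u] distrib_left)
    finally show "\<bar>cumulant \<theta> (Suc n) k u - \<theta> * EA k u\<bar> \<le> \<rho> * b + 2 * \<kappa>\<^sup>2 * \<theta>\<^sup>2" using 1 2 by linarith
  qed
  then show "\<forall>\<^sub>F n in sequentially. \<forall>k u. \<bar>cumulant \<theta> n k u - \<theta> * EA k u\<bar> \<le> \<rho> * b + 2 * \<kappa>\<^sup>2 * \<theta>\<^sup>2"
    by (rule eventually_sequentially_Suc[THEN iffD1])
next
  fix b b' :: real assume "\<forall>\<^sub>F n in sequentially. \<forall>k u. \<bar>cumulant \<theta> n k u - \<theta> * EA k u\<bar> \<le> b" "b \<le> b'"
  then show "\<forall>\<^sub>F n in sequentially. \<forall>k u. \<bar>cumulant \<theta> n k u - \<theta> * EA k u\<bar> \<le> b'"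
    by (auto elim!: eventually_mono intro: order_trans)
qed (use \<rho>0 \<rho>1 in auto)

text \<open>The remainder of exp q - 1 and not of q, because exp q - 1 is what gets convolved, both
  with the next kernel and with the intensity of generation 0.\<close>

definition rmd :: "real \<Rightarrow> nat \<Rightarrow> nat \<Rightarrow> real \<Rightarrow> real" where
  "rmd \<theta> n k w = exp (cumulant \<theta> n k w) - 1 - \<theta> * EA k w - \<theta>\<^sup>2 / 2 * EV k w"

lemma rmd_bounded:
  assumes \<theta>: "\<bar>\<theta>\<bar> \<le> \<theta>0"
  shows "bdd_borel (\<kappa> * \<bar>\<theta>\<bar> + 2 * (\<kappa> * \<bar>\<theta>\<bar>)\<^sup>2 + \<bar>\<theta>\<bar> * (1 / (1 - \<rho>))
    + \<bar>\<theta>\<^sup>2 / 2\<bar> * ((1 / (1 - \<rho>))\<^sup>2 / (1 - \<rho>))) (rmd \<theta> n k)"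
  unfolding rmd_def[abs_def]
  by (intro bdd_borel_diff cumulant_exp_bounded bdd_borel_cmult EA_bounded EV_bounded \<theta>)

lemma conv_rmd:
  assumes \<theta>: "\<bar>\<theta>\<bar> \<le> \<theta>0" and h: "loc_kernel h"
  shows "conv h (rmd \<theta> n k) u = conv h (\<lambda>w. exp (cumulant \<theta> n k w) - 1) u - \<theta> * conv h (EA k) u - \<theta>\<^sup>2 / 2 * conv h (EV k) u"
  unfolding rmd_def[abs_def]
  by (simp only: conv_cmult
      conv_diff[OF h bdd_borel_diff[OF cumulant_exp_bounded[OF \<theta>(1)] bdd_borel_cmult[OF EA_bounded]] bdd_borel_cmult[OF EV_bounded]]
      conv_diff[OF h cumulant_exp_bounded[OF \<theta>(1)] bdd_borel_cmult[OF EA_bounded]])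

text \<open>The summands are the cubic Taylor error, the error of replacing q^2 by (\<theta>
  \<open>EA\<close>)^2 through the first order bound, and 1 for the strict gap; dividing by 1 -
  \<rho> accounts for the propagation through the generations.\<close>

definition C0 :: real where "C0 = (\<kappa> ^ 3 + 3 * \<kappa> ^ 3 / (1 - \<rho>) + 1) / (1 - \<rho>)"

text \<open>By the recursions for \<open>EA\<close> and \<open>EV\<close>, convolving the remainder
  at stage \<open>n\<close> gives exactly q - \<theta> \<open>EA\<close> - \<theta>^2/2
  (\<open>EV\<close> - \<open>EA\<close>^2) at stage \<open>Suc n\<close>. Returning from q to exp q
  - 1 adds q^2/2, which by the first order bound is the missing \<theta>^2 \<open>EA\<close>^2/2 up
  to a cubic error.\<close>

lemma cumulant_second_order:
  assumes \<theta>: "\<bar>\<theta>\<bar> \<le> \<theta>0" "\<theta> \<noteq> 0"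
  shows "\<forall>\<^sub>F n in sequentially. \<forall>k u. \<bar>rmd \<theta> n k u\<bar> \<le> C0 * \<bar>\<theta>\<bar> ^ 3"
proof -
  define B where "B = \<kappa> * \<bar>\<theta>\<bar> + 2 * (\<kappa> * \<bar>\<theta>\<bar>)\<^sup>2 + \<bar>\<theta>\<bar> * (1 / (1 - \<rho>))
    + \<bar>\<theta>\<^sup>2 / 2\<bar> * ((1 / (1 - \<rho>))\<^sup>2 / (1 - \<rho>))"
  define D where "D = 3 * \<kappa>\<^sup>2 / (1 - \<rho>)"
  define K where "K = (\<kappa> ^ 3 + D * \<kappa>) * \<bar>\<theta>\<bar> ^ 3"
  note RB = rmd_bounded[OF \<theta>(1), folded B_def]
  show ?thesis
  proof (rule contraction_bound[where \<rho> = \<rho> and B = B and K = K])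
    show "\<forall>\<^sub>F n in sequentially. \<forall>k u. \<bar>rmd \<theta> n k u\<bar> \<le> B" using bdd_borelD(2)[OF RB] by simp
    show "0 \<le> B" by (rule bdd_borel_nonneg[OF RB])
    show "0 \<le> K" using \<kappa>(1) \<rho>1 by (auto simp: K_def D_def)
    have "K < (\<kappa> ^ 3 + D * \<kappa> + 1) * \<bar>\<theta>\<bar> ^ 3" using \<theta> unfolding K_def by (intro mult_strict_right_mono) auto
    then have "K / (1 - \<rho>) < (\<kappa> ^ 3 + D * \<kappa> + 1) * \<bar>\<theta>\<bar> ^ 3 / (1 - \<rho>)"
      using \<rho>1 by (intro divide_strict_right_mono) auto
    also have "\<dots> = C0 * \<bar>\<theta>\<bar> ^ 3" by (simp add: C0_def D_def power2_eq_square power3_eq_cube)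
    finally show "K / (1 - \<rho>) < C0 * \<bar>\<theta>\<bar> ^ 3" .
    fix b assume b: "0 \<le> b" "\<forall>\<^sub>F n in sequentially. \<forall>k u. \<bar>rmd \<theta> n k u\<bar> \<le> b"
    from b(2) have "\<forall>\<^sub>F n in sequentially. \<forall>k u. \<bar>cumulant \<theta> (Suc n) k u - \<theta> * EA k u - \<theta>\<^sup>2 / 2 * (EV k u - (EA k u)\<^sup>2)\<bar> \<le> \<rho> * b"
    proof (eventually_elim, intro allI)
      fix n k u assume n: "\<forall>k u. \<bar>rmd \<theta> n k u\<bar> \<le> b"
      then have "bdd_borel b (rmd \<theta> n (Suc k))" using RB by (simp add: bdd_borel_def)
      from bdd_borelD(2)[OF conv_contracts[OF this], of k u]
      have "\<bar>conv (g (Suc k)) (rmd \<theta> n (Suc k)) u\<bar> \<le> \<rho> * b" .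
      also have "conv (g (Suc k)) (rmd \<theta> n (Suc k)) u = cumulant \<theta> (Suc n) k u - \<theta> * EA k u - \<theta>\<^sup>2 / 2 * (EV k u - (EA k u)\<^sup>2)"
        by (simp add: conv_rmd[OF \<theta>(1) loc_kernel_g] EA_rec[of k u] EV_rec[of k u] algebra_simps)
      finally show "\<bar>cumulant \<theta> (Suc n) k u - \<theta> * EA k u - \<theta>\<^sup>2 / 2 * (EV k u - (EA k u)\<^sup>2)\<bar> \<le> \<rho> * b" .
    qed
    moreover have "\<forall>\<^sub>F n in sequentially. \<forall>k u. \<bar>cumulant \<theta> (Suc n) k u - \<theta> * EA k u\<bar> \<le> D * \<theta>\<^sup>2"
      unfolding D_def using cumulant_first_order[OF \<theta>] by (rule eventually_sequentially_Suc[THEN iffD2])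
    ultimately have "\<forall>\<^sub>F n in sequentially. \<forall>k u. \<bar>rmd \<theta> (Suc n) k u\<bar> \<le> \<rho> * b + K"
    proof (eventually_elim, intro allI)
      fix n k u
      assume n: "\<forall>k u. \<bar>cumulant \<theta> (Suc n) k u - \<theta> * EA k u - \<theta>\<^sup>2 / 2 * (EV k u - (EA k u)\<^sup>2)\<bar> \<le> \<rho> * b"
        "\<forall>k u. \<bar>cumulant \<theta> (Suc n) k u - \<theta> * EA k u\<bar> \<le> D * \<theta>\<^sup>2"
      define x where "x = cumulant \<theta> (Suc n) k u"
      define y where "y = \<theta> * EA k u"
      have x: "\<bar>x\<bar> \<le> \<kappa> * \<bar>\<theta>\<bar>" unfolding x_def by (rule bdd_borelD(2)[OF cumulant_bounded[OF \<theta>(1)]])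
      have y: "\<bar>y\<bar> \<le> \<kappa> * \<bar>\<theta>\<bar>" unfolding y_def
        using mult_left_mono[OF EA_le[of k u], of "\<bar>\<theta>\<bar>"] by (simp add: abs_mult mult.commute)
      have "\<bar>x\<bar> ^ 3 \<le> (\<kappa> * \<bar>\<theta>\<bar>) ^ 3" using x by (intro power_mono) auto
      then have 1: "\<bar>exp x - 1 - x - x\<^sup>2 / 2\<bar> \<le> \<kappa> ^ 3 * \<bar>\<theta>\<bar> ^ 3"
        using exp_small_bounds(2)[of x] x \<theta>_small[OF \<theta>(1)] by (simp add: power_mult_distrib)
      have "\<bar>x\<^sup>2 - y\<^sup>2\<bar> = \<bar>x - y\<bar> * \<bar>x + y\<bar>" by (simp add: power2_eq_square algebra_simps flip: abs_mult)
      also have "\<dots> \<le> (D * \<theta>\<^sup>2) * (2 * \<kappa> * \<bar>\<theta>\<bar>)"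
        using n(2)[rule_format, of k u] x y by (intro mult_mono) (auto simp: x_def y_def)
      also have "\<dots> = 2 * (D * \<kappa> * \<bar>\<theta>\<bar> ^ 3)" by (simp add: power3_eq_cube power2_eq_square abs_mult_self_eq)
      finally have 2: "\<bar>x\<^sup>2 - y\<^sup>2\<bar> \<le> 2 * (D * \<kappa> * \<bar>\<theta>\<bar> ^ 3)" .
      have "rmd \<theta> (Suc n) k u = (x - y - \<theta>\<^sup>2 / 2 * (EV k u - (EA k u)\<^sup>2)) + (exp x - 1 - x - x\<^sup>2 / 2) + (x\<^sup>2 - y\<^sup>2) / 2"
        by (simp add: rmd_def x_def y_def power_mult_distrib algebra_simps diff_divide_distrib del: cumulant.simps)
      moreover have "K = \<kappa> ^ 3 * \<bar>\<theta>\<bar> ^ 3 + D * \<kappa> * \<bar>\<theta>\<bar> ^ 3" by (simp add: K_def distrib_right)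
      moreover have "\<bar>r\<bar> \<le> c + e" if "r = p + q + s / 2" "e = a + a'" "\<bar>q\<bar> \<le> a" "\<bar>s\<bar> \<le> 2 * a'" "\<bar>p\<bar> \<le> c"
        for r p q s a a' c e :: real using that by linarith
      ultimately show "\<bar>rmd \<theta> (Suc n) k u\<bar> \<le> \<rho> * b + K"
        using 1 2 n(1)[rule_format, of k u, folded x_def y_def] by blast
    qed
    then show "\<forall>\<^sub>F n in sequentially. \<forall>k u. \<bar>rmd \<theta> n k u\<bar> \<le> \<rho> * b + K"
      by (rule eventually_sequentially_Suc[THEN iffD1])
  next
    fix b b' :: real assume "\<forall>\<^sub>F n in sequentially. \<forall>k u. \<bar>rmd \<theta> n k u\<bar> \<le> b" "b \<le> b'"
    then show "\<forall>\<^sub>F n in sequentially. \<forall>k u. \<bar>rmd \<theta> n k u\<bar> \<le> b'"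
      by (auto elim!: eventually_mono intro: order_trans)
  qed (use \<rho>0 \<rho>1 in auto)
qed

lemma conv_cumulant_second_order:
  assumes \<theta>: "\<bar>\<theta>\<bar> \<le> \<theta>0" "\<theta> \<noteq> 0"
  shows "\<forall>\<^sub>F n in sequentially. \<bar>conv (g 0) (\<lambda>w. exp (cumulant \<theta> n 0 w) - 1) t - \<theta> * conv (g 0) (EA 0) t
    - \<theta>\<^sup>2 / 2 * conv (g 0) (EV 0) t\<bar> \<le> C0 * \<bar>\<theta>\<bar> ^ 3 * conv (g 0) (\<lambda>_. 1) t"
  using cumulant_second_order[OF \<theta>]
proof eventually_elim
  case (elim n)
  then have "bdd_borel (C0 * \<bar>\<theta>\<bar> ^ 3) (rmd \<theta> n 0)" using rmd_bounded[OF \<theta>(1)] by (simp add: bdd_borel_def)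
  from conv_bound[OF loc_kernel_g this, of 0 t] show ?case by (simp add: conv_rmd[OF \<theta>(1) loc_kernel_g])
qed

end

section \<open>Mean values in the large time limit\<close>

locale cesaro_kernels = kernels +
  fixes g0 :: real
  assumes mean: "((\<lambda>t. conv (g 0) (\<lambda>_. 1) t / t) \<longlongrightarrow> g0) at_top"
    and mean_rate: "((\<lambda>t. sqrt t * (conv (g 0) (\<lambda>_. 1) t / t - g0)) \<longlongrightarrow> 0) at_top"
    and tail_rate: "((\<lambda>t. ennreal (sqrt t) * (\<integral>\<^sup>+s\<in>{t..}. (\<Sum>p. gchain g (Suc p) s) \<partial>lborel)) \<longlongrightarrow> 0) at_top"
begin

section \<open>Cesaro limits against the intensity of generation 0\<close>

definition \<Gamma> :: "real \<Rightarrow> real" where "\<Gamma> t = conv (g 0) (\<lambda>_. 1) t"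

lemma \<Gamma>_eq: "\<Gamma> t = (\<integral>v. indicator {0..t} v * g 0 v \<partial>lborel)"
  by (simp add: \<Gamma>_def conv_def)

lemma \<Gamma>_nonneg: "0 \<le> \<Gamma> t"
  unfolding \<Gamma>_eq by (intro Bochner_Integration.integral_nonneg) (simp add: g_nonneg)

lemma \<Gamma>_mono: "s \<le> t \<Longrightarrow> \<Gamma> s \<le> \<Gamma> t"
  unfolding \<Gamma>_eq by (intro integral_mono g0_loc) (auto simp: g_nonneg indicator_def)

lemma g0_nonneg: "0 \<le> g0"
  by (rule tendsto_lowerbound[OF mean]) (auto intro!: eventually_mono[OF eventually_gt_at_top[of 0]]
      simp: \<Gamma>_nonneg[unfolded \<Gamma>_def])

text \<open>For comparison with the limit of \<Gamma>(t)/t: a window of fixed length ending at t has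
  \<open>g 0\<close>-mass o(t), however irregular \<open>g 0\<close> is.\<close>

lemma \<Gamma>_shift_tendsto: "((\<lambda>t. \<Gamma> (t - K) / t) \<longlongrightarrow> g0) at_top"
proof -
  have f: "filterlim (\<lambda>t. t - K) at_top at_top"
    unfolding filterlim_at_top eventually_at_top_linorder by (metis add_le_imp_le_diff)
  have "((\<lambda>t. \<Gamma> (t - K) / (t - K) * ((t - K) / t)) \<longlongrightarrow> g0 * 1) at_top"
  proof (rule tendsto_mult)
    show "((\<lambda>t. \<Gamma> (t - K) / (t - K)) \<longlongrightarrow> g0) at_top"
      using filterlim_compose[OF mean f] by (simp add: \<Gamma>_def)
    have "((\<lambda>t. 1 - K * inverse t) \<longlongrightarrow> 1 - K * 0) at_top"
      by (intro tendsto_intros tendsto_inverse_0_at_top filterlim_ident)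
    then have "((\<lambda>t. 1 - K * inverse t) \<longlongrightarrow> 1) at_top" by simp
    then show "((\<lambda>t. (t - K) / t) \<longlongrightarrow> 1) at_top"
      by (rule Lim_transform_eventually)
        (auto intro!: eventually_mono[OF eventually_gt_at_top[of 0]] simp: field_simps)
  qed
  then have "((\<lambda>t. \<Gamma> (t - K) / (t - K) * ((t - K) / t)) \<longlongrightarrow> g0) at_top" by simp
  then show ?thesis
    by (rule Lim_transform_eventually) (rule eventually_mono[OF eventually_gt_at_top[of "max 0 K"]], simp)
qed

lemma conv_initial:
  assumes "0 \<le> K"
  shows "conv (g 0) (indicator {..<K}) t \<le> \<Gamma> t - \<Gamma> (t - K)"
proof -
  have "conv (g 0) (indicator {..<K}) t = (\<integral>v. indicator {0..t} v * g 0 v * indicator {..<K} (t - v) \<partial>lborel)"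
    by (simp add: conv_def)
  also have "\<dots> \<le> (\<integral>v. indicator {0..t} v * g 0 v - indicator {0..t - K} v * g 0 v \<partial>lborel)"
  proof (rule integral_mono)
    show "integrable lborel (\<lambda>v. indicator {0..t} v * g 0 v * indicator {..<K} (t - v))"
      by (rule conv_integrable[OF loc_kernel_g, of 1]) (simp add: bdd_borel_def)
    show "indicator {0..t} v * g 0 v * indicator {..<K} (t - v) \<le> indicator {0..t} v * g 0 v - indicator {0..t - K} v * g 0 v" for v
      using assms by (auto simp: indicator_def)
  qed (intro Bochner_Integration.integrable_diff g0_loc)
  finally show ?thesis
    by (simp add: \<Gamma>_eq Bochner_Integration.integral_diff[OF g0_loc g0_loc])
qed

text \<open>Where the remaining time is at least \<open>K\<close>, \<open>h\<close> is below
  \<open>e\<close> and contributes at most e \<Gamma>(t). On the last \<open>K\<close> time units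
  \<open>h\<close> is merely bounded, but the \<open>g 0\<close>-mass there is o(t).\<close>

lemma conv_cesaro_0:
  assumes h: "bdd_borel c h" and lim: "(h \<longlongrightarrow> 0) at_top"
  shows "((\<lambda>t. conv (g 0) h t / t) \<longlongrightarrow> 0) at_top"
proof (rule tendstoI)
  fix r :: real assume r: "0 < r"
  \<comment> \<open>The 1 keeps the choice valid for g0 = 0.\<close>
  define e where "e = r / (g0 + 1)"
  have e: "0 < e" "e * g0 < r" using r g0_nonneg by (auto simp: e_def field_simps)
  have c: "0 \<le> c" by (rule bdd_borel_nonneg[OF h])
  have "\<forall>\<^sub>F u in at_top. \<bar>h u\<bar> < e" using tendstoD[OF lim e(1)] by simp
  then obtain K0 where K0: "\<And>u. K0 \<le> u \<Longrightarrow> \<bar>h u\<bar> < e" by (auto simp: eventually_at_top_linorder)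
  define K where "K = max 0 K0"
  have K: "0 \<le> K" "\<And>u. K \<le> u \<Longrightarrow> \<bar>h u\<bar> < e" using K0 by (auto simp: K_def)
  have bd: "\<bar>conv (g 0) h t\<bar> \<le> e * \<Gamma> t + c * (\<Gamma> t - \<Gamma> (t - K))" for t
  proof -
    note [measurable] = bdd_borelD(1)[OF h]
    have b1: "bdd_borel \<bar>e\<bar> (\<lambda>_. e)" by (rule bdd_borel_const)
    have b2: "bdd_borel (\<bar>c\<bar> * 1) (\<lambda>u. c * indicator {..<K} u)"
      by (rule bdd_borel_cmult) (simp add: bdd_borel_def)
    have ha: "bdd_borel c (\<lambda>u. \<bar>h u\<bar>)" using h by (simp add: bdd_borel_def)
    have "\<bar>h u\<bar> \<le> e + c * indicator {..<K} u" for u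
      using K(2)[of u] bdd_borelD(2)[OF h, of u] e(1) by (auto simp: indicator_def)
    moreover have "bdd_borel (\<bar>e\<bar> + \<bar>c\<bar> * 1) (\<lambda>u. e + c * indicator {..<K} u)"
      using e c by (auto simp: bdd_borel_def indicator_def)
    ultimately have le: "conv (g 0) (\<lambda>u. \<bar>h u\<bar>) t \<le> conv (g 0) (\<lambda>u. e + c * indicator {..<K} u) t"
      by (intro conv_mono[OF loc_kernel_g ha]) auto
    have "conv (g 0) h t \<le> conv (g 0) (\<lambda>u. \<bar>h u\<bar>) t" by (rule conv_mono[OF loc_kernel_g h ha]) simp
    moreover have "conv (g 0) (\<lambda>u. - 1 * \<bar>h u\<bar>) t \<le> conv (g 0) h t"
      by (rule conv_mono[OF loc_kernel_g bdd_borel_cmult[OF ha] h]) simp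
    ultimately have "\<bar>conv (g 0) h t\<bar> \<le> conv (g 0) (\<lambda>u. \<bar>h u\<bar>) t" unfolding conv_cmult by linarith
    also note le
    also have "conv (g 0) (\<lambda>u. e + c * indicator {..<K} u) t = e * \<Gamma> t + c * conv (g 0) (indicator {..<K}) t"
      using conv_cmult[of "g 0" e "\<lambda>_. 1" t] by (simp add: conv_add[OF loc_kernel_g b1 b2] conv_cmult \<Gamma>_def)
    also have "\<dots> \<le> e * \<Gamma> t + c * (\<Gamma> t - \<Gamma> (t - K))"
      using c by (intro add_left_mono mult_left_mono conv_initial K) auto
    finally show ?thesis .
  qed
  have "((\<lambda>t. e * (\<Gamma> t / t) + c * (\<Gamma> t / t - \<Gamma> (t - K) / t)) \<longlongrightarrow> e * g0 + c * (g0 - g0)) at_top"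
    by (intro tendsto_intros \<Gamma>_shift_tendsto mean[folded \<Gamma>_def])
  then have "\<forall>\<^sub>F t in at_top. e * (\<Gamma> t / t) + c * (\<Gamma> t / t - \<Gamma> (t - K) / t) < r"
    using e(2) by (intro order_tendstoD(2)) auto
  then show "\<forall>\<^sub>F t in at_top. dist (conv (g 0) h t / t) 0 < r"
    using eventually_gt_at_top[of 0]
  proof eventually_elim
    case (elim t)
    have "\<bar>conv (g 0) h t\<bar> / t \<le> (e * \<Gamma> t + c * (\<Gamma> t - \<Gamma> (t - K))) / t"
      using bd elim(2) by (intro divide_right_mono) auto
    also have "\<dots> = e * (\<Gamma> t / t) + c * (\<Gamma> t / t - \<Gamma> (t - K) / t)"
      using elim(2) by (simp add: field_simps)
    also note elim(1)
    finally show ?case using elim(2) by simp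
  qed
qed

lemma conv_cesaro:
  assumes f: "bdd_borel c f" and lim: "(f \<longlongrightarrow> \<phi>) at_top"
  shows "((\<lambda>t. conv (g 0) f t / t) \<longlongrightarrow> g0 * \<phi>) at_top"
proof -
  have b: "bdd_borel (\<bar>\<phi>\<bar>) (\<lambda>_. \<phi>)" by (rule bdd_borel_const)
  have "((\<lambda>u. f u - \<phi>) \<longlongrightarrow> \<phi> - \<phi>) at_top" by (intro tendsto_intros lim)
  then have "((\<lambda>t. conv (g 0) (\<lambda>u. f u - \<phi>) t / t) \<longlongrightarrow> 0) at_top"
    by (intro conv_cesaro_0[OF bdd_borel_diff[OF f b]]) simp
  then have "((\<lambda>t. conv (g 0) (\<lambda>u. f u - \<phi>) t / t + \<phi> * (\<Gamma> t / t)) \<longlongrightarrow> 0 + \<phi> * g0) at_top"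
    by (intro tendsto_intros mean[folded \<Gamma>_def])
  moreover have "conv (g 0) (\<lambda>u. f u - \<phi>) t / t + \<phi> * (\<Gamma> t / t) = conv (g 0) f t / t" for t
    using conv_cmult[of "g 0" \<phi> "\<lambda>_. 1" t] by (simp add: conv_diff[OF loc_kernel_g f b] \<Gamma>_def diff_divide_distrib)
  ultimately show ?thesis by (simp add: mult.commute)
qed

section \<open>Centring of the mean up to order sqrt t\<close>

lemma \<Gamma>_rate:
  obtains C where "0 \<le> C" "\<And>t x. 1 \<le> t \<Longrightarrow> 0 \<le> x \<Longrightarrow> x \<le> t \<Longrightarrow> \<bar>\<Gamma> x - g0 * x\<bar> \<le> C * sqrt t"
proof -
  have "\<forall>\<^sub>F t in at_top. \<bar>sqrt t * (\<Gamma> t / t - g0)\<bar> < 1"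
    using tendstoD[OF mean_rate zero_less_one] by (simp add: \<Gamma>_def)
  then obtain x0 where x0: "\<And>t. x0 \<le> t \<Longrightarrow> \<bar>sqrt t * (\<Gamma> t / t - g0)\<bar> < 1"
    by (auto simp: eventually_at_top_linorder)
  \<comment> \<open>Uniformity over all x \<le> t is wanted since windows of every length ending at
    t will occur. Beyond \<open>y\<close> the rate hypothesis gives an error of at most sqrt x;
    below \<open>y\<close> monotonicity of \<Gamma> gives a constant, absorbed because sqrt t \<ge>
    1.\<close>
  define y where "y = max 1 x0"
  define C where "C = 1 + \<Gamma> y + g0 * y"
  have y: "1 \<le> y" "x0 \<le> y" by (auto simp: y_def)
  have C: "1 \<le> C" using y g0_nonneg \<Gamma>_nonneg[of y] by (simp add: C_def)
  show thesis
  proof (rule that)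
    show "0 \<le> C" using C by simp
    fix t x :: real assume t: "1 \<le> t" and x: "0 \<le> x" "x \<le> t"
    have st: "1 \<le> sqrt t" using t by simp
    show "\<bar>\<Gamma> x - g0 * x\<bar> \<le> C * sqrt t"
    proof (cases "y \<le> x")
      case True
      then have xpos: "0 < x" using y by linarith
      have "\<bar>\<Gamma> x - g0 * x\<bar> = sqrt x * \<bar>sqrt x * (\<Gamma> x / x - g0)\<bar>"
      proof -
        have "\<Gamma> x - g0 * x = sqrt x * (sqrt x * (\<Gamma> x / x - g0))"
          using xpos by (simp add: right_diff_distrib flip: mult.assoc)
        then show ?thesis using xpos by (simp add: abs_mult)
      qed
      also have "\<dots> \<le> sqrt x * 1" using x0[of x] True y xpos by (intro mult_left_mono) auto
      also have "\<dots> \<le> sqrt t * 1" using x by simp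
      also have "\<dots> \<le> C * sqrt t" using C st by (simp add: mult_right_mono)
      finally show ?thesis .
    next
      case False
      have "g0 * x \<le> g0 * y" using False g0_nonneg by (intro mult_left_mono) auto
      moreover have "0 \<le> g0 * x" "\<Gamma> x \<le> \<Gamma> y" "0 \<le> \<Gamma> x" "0 \<le> \<Gamma> y" using g0_nonneg x False \<Gamma>_mono \<Gamma>_nonneg by auto
      ultimately have "\<bar>\<Gamma> x - g0 * x\<bar> \<le> C" unfolding C_def by linarith
      also have "\<dots> \<le> C * sqrt t" using C st mult_left_mono[of 1 "sqrt t" C] by simp
      finally show ?thesis .
    qed
  qed
qed

lemma hconv_meas:
  assumes [measurable]: "p \<in> borel_measurable borel" "q \<in> borel_measurable borel"
  shows "hconv p q \<in> borel_measurable borel"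
proof -
  have "hconv p q = (\<lambda>t. \<integral>\<^sup>+s. p (t - s) * q s * (if 0 \<le> s \<and> s \<le> t then 1 else 0) \<partial>lborel)"
    unfolding hconv_def[abs_def] by (intro ext nn_integral_cong) (auto simp: indicator_def)
  also have "\<dots> \<in> borel_measurable borel" by measurable
  finally show ?thesis .
qed

lemma gchain_meas [measurable]: "gchain g (Suc p) \<in> borel_measurable borel"
proof (induction p)
  case (Suc p)
  then show ?case unfolding gchain.simps by (intro hconv_meas) measurable
qed simp

text \<open>Expected number of descendants of all generations, per unit of delay, of a point of
  generation 0. With values in \<open>ennreal\<close> the series needs no pointwise
  convergence.\<close>

definition dens :: "real \<Rightarrow> ennreal" where "dens s = (\<Sum>p. gchain g (Suc p) s)"

lemma dens_meas [measurable]: "dens \<in> borel_measurable borel"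
  unfolding dens_def[abs_def] by (intro borel_measurable_suminf_order gchain_meas)

text \<open>\<open>iter_conv\<close> has the kernel of the first generation outermost,
  \<open>gchain\<close> that of the last. Pushing the last kernel onto \<open>f\<close> reconciles
  the two.\<close>

lemma iter_conv_last: "iter_conv (Suc p) k f = iter_conv p k (conv (g (Suc (p + k))) f)"
proof (induction p arbitrary: k)
  case (Suc p)
  have "iter_conv (Suc (Suc p)) k f = conv (g (Suc k)) (iter_conv (Suc p) (Suc k) f)" by (rule iter_conv.simps)
  also have "\<dots> = conv (g (Suc k)) (iter_conv p (Suc k) (conv (g (Suc (p + Suc k))) f))" by (simp only: Suc.IH)
  finally show ?case by simp
qed simp

lemma conv_nn:
  assumes f: "bdd_borel c f" "\<And>w. 0 \<le> f w"
  shows "ennreal (conv (g k) f u) = (\<integral>\<^sup>+v. ennreal (g k v) * ennreal (f (u - v)) * indicator {0..u} v \<partial>lborel)"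
proof -
  have "ennreal (conv (g k) f u) = (\<integral>\<^sup>+v. ennreal (indicator {0..u} v * g k v * f (u - v)) \<partial>lborel)"
    unfolding conv_def using f(2)
    by (intro nn_integral_eq_integral[symmetric] conv_integrable[OF loc_kernel_g f(1)]) (simp add: g_nonneg)
  also have "\<dots> = (\<integral>\<^sup>+v. ennreal (g k v) * ennreal (f (u - v)) * indicator {0..u} v \<partial>lborel)"
    using f(2) by (intro nn_integral_cong) (auto simp: indicator_def ennreal_mult g_nonneg)
  finally show ?thesis .
qed

lemma conv_nonneg: "(\<And>w. 0 \<le> f w) \<Longrightarrow> 0 \<le> conv (g k) f u"
  unfolding conv_def by (intro Bochner_Integration.integral_nonneg) (simp add: g_nonneg)

lemma iter_conv_nonneg: "(\<And>w. 0 \<le> f w) \<Longrightarrow> 0 \<le> iter_conv p k f u"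
  by (induction p arbitrary: k u) (auto intro: conv_nonneg)

lemma iter_conv_gchain:
  assumes f: "bdd_borel c f" "\<And>w. 0 \<le> f w"
  shows "ennreal (iter_conv (Suc p) 0 f u) = (\<integral>\<^sup>+w. gchain g (Suc p) w * ennreal (f (u - w)) * indicator {0..u} w \<partial>lborel)"
  using f
proof (induction p arbitrary: f c)
  case 0
  then show ?case using conv_nn[of c f "Suc 0" u] by simp
next
  case (Suc p)
  note f = Suc.prems
  note [measurable] = bdd_borelD(1)[OF f(1)]
  let ?n = "Suc (Suc p)"
  \<comment> \<open>Here \<open>w\<close> is the delay down to generation p + 1 and \<open>s\<close>
    the delay down to generation p + 2; after substituting s = w + v both iterated integrals run
    over 0 \<le> w \<le> s \<le> u and Tonelli applies.\<close>
  let ?k = "\<lambda>w s. gchain g (Suc p) w * ennreal (g ?n (s - w)) * ennreal (f (u - s)) * (if 0 \<le> w \<and> w \<le> s \<and> s \<le> u then 1 else 0)"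
  have "ennreal (iter_conv (Suc (Suc p)) 0 f u) = ennreal (iter_conv (Suc p) 0 (conv (g ?n) f) u)"
    by (simp only: iter_conv_last[of "Suc p"] add_0_right)
  also have "\<dots> = (\<integral>\<^sup>+w. gchain g (Suc p) w * ennreal (conv (g ?n) f (u - w)) * indicator {0..u} w \<partial>lborel)"
    by (rule Suc.IH[OF conv_contracts[OF f(1)] conv_nonneg[OF f(2)]])
  also have "\<dots> = (\<integral>\<^sup>+w. (\<integral>\<^sup>+s. ?k w s \<partial>lborel) \<partial>lborel)"
  proof (intro nn_integral_cong)
    fix w
    have "ennreal (conv (g ?n) f (u - w)) = (\<integral>\<^sup>+v. ennreal (g ?n v) * ennreal (f (u - w - v)) * indicator {0..u - w} v \<partial>lborel)"
      by (rule conv_nn[OF f])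
    also have "\<dots> = (\<integral>\<^sup>+s. ennreal (g ?n (- w + 1 * s)) * ennreal (f (u - w - (- w + 1 * s))) * indicator {0..u - w} (- w + 1 * s) \<partial>lborel)"
      by (subst nn_integral_real_affine[where c = 1 and t = "- w"]) auto
    finally have "gchain g (Suc p) w * ennreal (conv (g ?n) f (u - w)) * indicator {0..u} w
      = (\<integral>\<^sup>+s. gchain g (Suc p) w * (ennreal (g ?n (- w + 1 * s)) * ennreal (f (u - w - (- w + 1 * s))) * indicator {0..u - w} (- w + 1 * s)) * indicator {0..u} w \<partial>lborel)"
      by (simp add: nn_integral_cmult nn_integral_multc)
    also have "\<dots> = (\<integral>\<^sup>+s. ?k w s \<partial>lborel)"
      by (intro nn_integral_cong) (auto simp: indicator_def mult_ac)
    finally show "gchain g (Suc p) w * ennreal (conv (g ?n) f (u - w)) * indicator {0..u} w = (\<integral>\<^sup>+s. ?k w s \<partial>lborel)" .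
  qed
  also have "\<dots> = (\<integral>\<^sup>+s. (\<integral>\<^sup>+w. ?k w s \<partial>lborel) \<partial>lborel)"
    by (rule lborel_pair.Fubini'[symmetric]) measurable
  also have "\<dots> = (\<integral>\<^sup>+s. gchain g (Suc (Suc p)) s * ennreal (f (u - s)) * indicator {0..u} s \<partial>lborel)"
  proof (intro nn_integral_cong)
    fix s
    have "gchain g (Suc (Suc p)) s * ennreal (f (u - s)) * indicator {0..u} s
      = (\<integral>\<^sup>+w. ennreal (g ?n (s - w)) * gchain g (Suc p) w * indicator {0..s} w * ennreal (f (u - s)) * indicator {0..u} s \<partial>lborel)"
      unfolding gchain.simps hconv_def by (simp add: nn_integral_multc)
    also have "\<dots> = (\<integral>\<^sup>+w. ?k w s \<partial>lborel)"
      by (intro nn_integral_cong) (auto simp: indicator_def mult_ac)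
    finally show "(\<integral>\<^sup>+w. ?k w s \<partial>lborel) = gchain g (Suc (Suc p)) s * ennreal (f (u - s)) * indicator {0..u} s" by simp
  qed
  finally show ?case .
qed

lemma EA_dens: "1 \<le> EA 0 u" "ennreal (EA 0 u - 1) = (\<integral>\<^sup>+w. dens w * indicator {0..u} w \<partial>lborel)"
proof -
  have b: "bdd_borel 1 (\<lambda>_. 1)" by (simp add: bdd_borel_def)
  have s: "summable (\<lambda>p. iter_conv p 0 (\<lambda>_. 1) u)"
    using gen_sum_summable[where f = "\<lambda>_ _. 1" and c = 1 and k = 0 and u = u] by (simp add: bdd_borel_def)
  have eq: "EA 0 u - 1 = (\<Sum>p. iter_conv (Suc p) 0 (\<lambda>_. 1) u)"
    using suminf_split_head[OF s] by (simp add: EA_def gen_sum_def)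
  have nn: "0 \<le> iter_conv p 0 (\<lambda>_. 1) u" for p by (rule iter_conv_nonneg) simp
  have s': "summable (\<lambda>p. iter_conv (Suc p) 0 (\<lambda>_. 1) u)" using s by (rule summable_Suc_iff[THEN iffD2])
  show "1 \<le> EA 0 u" using suminf_nonneg[OF s' nn] eq by linarith
  have "ennreal (EA 0 u - 1) = (\<Sum>p. ennreal (iter_conv (Suc p) 0 (\<lambda>_. 1) u))"
    unfolding eq by (rule suminf_ennreal2[symmetric, OF nn s'])
  also have "\<dots> = (\<Sum>p. \<integral>\<^sup>+w. gchain g (Suc p) w * indicator {0..u} w \<partial>lborel)"
    by (intro suminf_cong) (simp add: iter_conv_gchain[OF b] del: iter_conv.simps gchain.simps)
  also have "\<dots> = (\<integral>\<^sup>+w. (\<Sum>p. gchain g (Suc p) w * indicator {0..u} w) \<partial>lborel)"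
    by (rule nn_integral_suminf[symmetric]) measurable
  also have "\<dots> = (\<integral>\<^sup>+w. dens w * indicator {0..u} w \<partial>lborel)"
    by (simp only: dens_def ennreal_suminf_multc)
  finally show "ennreal (EA 0 u - 1) = (\<integral>\<^sup>+w. dens w * indicator {0..u} w \<partial>lborel)" .
qed

text \<open>Expected number of descendants missed when the cluster of a generation 0 point is
  observed only for time \<open>u\<close>; for \<open>u\<close> \<ge> 0 it is the tail integral of
  \<open>dens\<close>.\<close>

definition T :: "real \<Rightarrow> real" where "T u = \<alpha> 0 - EA 0 u"

text \<open>Monotone convergence over [0, n], compared with the known limit of \<open>EA 0\<close>.
  Finiteness of the total permits the cancellation behind \<open>T_dens\<close> and bounds the total
  weight of the layers in \<open>conv_T_rate\<close>.\<close>

lemma dens_total: "(\<integral>\<^sup>+w. dens w * indicator {0..} w \<partial>lborel) = ennreal (\<alpha> 0 - 1)"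
proof (rule LIMSEQ_unique)
  show "(\<lambda>n. \<integral>\<^sup>+w. dens w * indicator {0..real n} w \<partial>lborel) \<longlonglongrightarrow> (\<integral>\<^sup>+w. dens w * indicator {0..} w \<partial>lborel)"
  proof (rule nn_integral_LIMSEQ)
    show "incseq (\<lambda>n w. dens w * indicator {0..real n} w)"
      by (intro incseq_SucI le_funI mult_left_mono) (auto simp: indicator_def)
    show "(\<lambda>n. dens w * indicator {0..real n} w) \<longlonglongrightarrow> dens w * indicator {0..} w" for w
    proof (rule tendsto_eventually)
      obtain N where "w \<le> real N" using real_arch_simple by blast
      then show "\<forall>\<^sub>F n in sequentially. dens w * indicator {0..real n} w = dens w * indicator {0..} w"
        by (auto simp: eventually_sequentially indicator_def intro!: exI[of _ N])
    qed
  qed measurable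
  have "(\<lambda>n. EA 0 (real n) - 1) \<longlonglongrightarrow> \<alpha> 0 - 1"
    by (intro tendsto_intros filterlim_compose[OF EA_tendsto filterlim_real_sequentially])
  then show "(\<lambda>n. \<integral>\<^sup>+w. dens w * indicator {0..real n} w \<partial>lborel) \<longlonglongrightarrow> ennreal (\<alpha> 0 - 1)"
    unfolding EA_dens(2)[symmetric] by (rule tendsto_ennrealI)
qed

lemma \<alpha>0_ge: "1 \<le> \<alpha> 0"
  by (rule tendsto_lowerbound[OF EA_tendsto]) (auto simp: EA_dens(1))

lemma T_nonneg: "0 \<le> T u"
proof -
  have "ennreal (EA 0 u - 1) \<le> ennreal (\<alpha> 0 - 1)"
    unfolding EA_dens(2) dens_total[symmetric]
    by (intro nn_integral_mono mult_left_mono) (auto simp: indicator_def)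
  then show ?thesis using \<alpha>0_ge by (simp add: T_def)
qed

lemma T_le: "T u \<le> \<alpha> 0"
  using EA_dens(1)[of u] by (simp add: T_def)

lemma T_bounded: "bdd_borel (\<alpha> 0) T"
proof -
  note [measurable] = bdd_borelD(1)[OF EA_bounded]
  have "T \<in> borel_measurable borel" unfolding T_def[abs_def] by measurable
  then show ?thesis using T_nonneg T_le by (simp add: bdd_borel_def)
qed

lemma T_dens:
  assumes "0 \<le> u"
  shows "ennreal (T u) = (\<integral>\<^sup>+w. dens w * indicator {u<..} w \<partial>lborel)"
proof -
  have "ennreal (EA 0 u - 1) + ennreal (T u) = ennreal (\<alpha> 0 - 1)"
    using EA_dens(1)[of u] T_nonneg[of u] by (simp add: T_def flip: ennreal_plus)
  also have "\<dots> = (\<integral>\<^sup>+w. dens w * indicator {0..u} w + dens w * indicator {u<..} w \<partial>lborel)"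
    unfolding dens_total[symmetric] using assms by (intro nn_integral_cong) (auto simp: indicator_def)
  also have "\<dots> = ennreal (EA 0 u - 1) + (\<integral>\<^sup>+w. dens w * indicator {u<..} w \<partial>lborel)"
    unfolding EA_dens(2) by (rule nn_integral_add) measurable
  finally show ?thesis by (simp add: ennreal_add_left_cancel)
qed

lemma T_rate:
  obtains u0 where "1 \<le> u0" "\<And>u. u0 \<le> u \<Longrightarrow> T u \<le> 1 / sqrt u"
proof -
  have "\<forall>\<^sub>F t in at_top. ennreal (sqrt t) * (\<integral>\<^sup>+s\<in>{t..}. (\<Sum>p. gchain g (Suc p) s) \<partial>lborel) < 1"
    by (rule order_tendstoD(2)[OF tail_rate]) simp
  then obtain u1 where u1: "\<And>u. u1 \<le> u \<Longrightarrow> ennreal (sqrt u) * (\<integral>\<^sup>+s. dens s * indicator {u..} s \<partial>lborel) < 1"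
    by (auto simp: eventually_at_top_linorder dens_def)
  have "T u \<le> 1 / sqrt u" if "max 1 u1 \<le> u" for u
  proof -
    have "ennreal (sqrt u * T u) = ennreal (sqrt u) * (\<integral>\<^sup>+w. dens w * indicator {u<..} w \<partial>lborel)"
      using that T_nonneg by (simp add: ennreal_mult T_dens)
    also have "\<dots> \<le> ennreal (sqrt u) * (\<integral>\<^sup>+s. dens s * indicator {u..} s \<partial>lborel)"
      by (intro mult_left_mono nn_integral_mono) (auto simp: indicator_def)
    also have "\<dots> < 1" using u1 that by simp
    finally have "ennreal (sqrt u * T u) \<le> 1" by (rule less_imp_le)
    then have "sqrt u * T u \<le> 1" by (simp only: ennreal_le_1)
    then show ?thesis using that by (simp add: field_simps)
  qed
  then show thesis using that[of "max 1 u1"] by simp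
qed

text \<open>Integration by parts in disguise: it lets the mass of \<open>g 0\<close> near \<open>t\<close>, which is only
  controlled in the mean, be compared with Lebesgue measure.\<close>
lemma T_layers:
  assumes [measurable]: "k \<in> borel_measurable borel" and t: "0 \<le> t"
  shows "(\<integral>\<^sup>+v. k v * indicator {0..t} v * ennreal (T (t - v)) \<partial>lborel)
    = (\<integral>\<^sup>+w. dens w * indicator {0..} w * (\<integral>\<^sup>+v. k v * indicator {0..t} v * indicator {t - w<..} v \<partial>lborel) \<partial>lborel)"
proof -
  let ?f = "\<lambda>v w. dens w * k v * (if 0 \<le> w \<and> 0 \<le> v \<and> v \<le> t \<and> t - w < v then 1 else 0)"
  have "(\<integral>\<^sup>+v. k v * indicator {0..t} v * ennreal (T (t - v)) \<partial>lborel) = (\<integral>\<^sup>+v. (\<integral>\<^sup>+w. ?f v w \<partial>lborel) \<partial>lborel)"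
  proof (intro nn_integral_cong)
    fix v
    show "k v * indicator {0..t} v * ennreal (T (t - v)) = (\<integral>\<^sup>+w. ?f v w \<partial>lborel)"
    proof (cases "v \<in> {0..t}")
      case True
      then have "k v * indicator {0..t} v * ennreal (T (t - v)) = (\<integral>\<^sup>+w. k v * (dens w * indicator {t - v<..} w) \<partial>lborel)"
        by (simp add: T_dens nn_integral_cmult)
      also have "\<dots> = (\<integral>\<^sup>+w. ?f v w \<partial>lborel)"
        using True by (intro nn_integral_cong) (auto simp: indicator_def mult_ac)
      finally show ?thesis .
    next
      case False
      then have "(\<integral>\<^sup>+w. ?f v w \<partial>lborel) = (\<integral>\<^sup>+(w::real). 0 \<partial>lborel)" by (intro nn_integral_cong) auto
      then show ?thesis using False by simp
    qed
  qed
  also have "\<dots> = (\<integral>\<^sup>+w. (\<integral>\<^sup>+v. ?f v w \<partial>lborel) \<partial>lborel)"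
    by (rule lborel_pair.Fubini'[symmetric]) measurable
  also have "\<dots> = (\<integral>\<^sup>+w. dens w * indicator {0..} w * (\<integral>\<^sup>+v. k v * indicator {0..t} v * indicator {t - w<..} v \<partial>lborel) \<partial>lborel)"
  proof (intro nn_integral_cong)
    fix w
    have "dens w * indicator {0..} w * (\<integral>\<^sup>+v. k v * indicator {0..t} v * indicator {t - w<..} v \<partial>lborel)
      = (\<integral>\<^sup>+v. dens w * indicator {0..} w * (k v * indicator {0..t} v * indicator {t - w<..} v) \<partial>lborel)"
      by (rule nn_integral_cmult[symmetric]) measurable
    also have "\<dots> = (\<integral>\<^sup>+v. ?f v w \<partial>lborel)"
      by (intro nn_integral_cong) (auto simp: indicator_def mult_ac)
    finally show "(\<integral>\<^sup>+v. ?f v w \<partial>lborel) = dens w * indicator {0..} w * (\<integral>\<^sup>+v. k v * indicator {0..t} v * indicator {t - w<..} v \<partial>lborel)"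
      by simp
  qed
  finally show ?thesis .
qed

lemma layer_g0:
  assumes w: "0 \<le> w"
  shows "(\<integral>\<^sup>+v. ennreal (g 0 v) * indicator {0..t} v * indicator {t - w<..} v \<partial>lborel) = ennreal (\<Gamma> t - \<Gamma> (t - w))"
proof -
  have "(\<integral>\<^sup>+v. ennreal (g 0 v) * indicator {0..t} v * indicator {t - w<..} v \<partial>lborel)
    = (\<integral>\<^sup>+v. ennreal (indicator {0..t} v * g 0 v - indicator {0..t - w} v * g 0 v) \<partial>lborel)"
    using w by (intro nn_integral_cong) (auto simp: indicator_def)
  also have "\<dots> = ennreal (\<integral>v. indicator {0..t} v * g 0 v - indicator {0..t - w} v * g 0 v \<partial>lborel)"
    using w g_nonneg by (intro nn_integral_eq_integral Bochner_Integration.integrable_diff g0_loc) (auto simp: indicator_def)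
  finally show ?thesis by (simp add: \<Gamma>_eq Bochner_Integration.integral_diff[OF g0_loc g0_loc])
qed

lemma layer_1:
  assumes w: "0 \<le> w" and t: "0 \<le> t"
  shows "(\<integral>\<^sup>+v. 1 * indicator {0..t} v * indicator {t - w<..} v \<partial>lborel) = ennreal (min w t)"
proof (cases "w \<le> t")
  case True
  have "(\<integral>\<^sup>+v. 1 * indicator {0..t} v * indicator {t - w<..} v \<partial>lborel) = (\<integral>\<^sup>+v. indicator {t - w<..t} v \<partial>lborel)"
    using True by (intro nn_integral_cong) (auto simp: indicator_def)
  then show ?thesis using True w by simp
next
  case False
  have "(\<integral>\<^sup>+v. 1 * indicator {0..t} v * indicator {t - w<..} v \<partial>lborel) = (\<integral>\<^sup>+v. indicator {0..t} v \<partial>lborel)"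
    using False by (intro nn_integral_cong) (auto simp: indicator_def)
  then show ?thesis using False t by simp
qed

text \<open>Where the remaining time is at least \<open>u0\<close>, the bound 1/sqrt integrates to
  at most 2 sqrt t; on the last stretch of length \<open>u0\<close> only \<open>T\<close> \<le>
  \<alpha> 0 is available.\<close>

lemma T_integral_bound:
  assumes u0: "1 \<le> u0" "\<And>u. u0 \<le> u \<Longrightarrow> T u \<le> 1 / sqrt u" and t: "u0 \<le> t"
  shows "(\<integral>\<^sup>+v. 1 * indicator {0..t} v * ennreal (T (t - v)) \<partial>lborel) \<le> ennreal (2 * sqrt t + u0 * \<alpha> 0)"
proof -
  let ?b = "\<lambda>v. ennreal (1 / sqrt (t - v)) * indicator {0..t - u0} v + ennreal (\<alpha> 0) * indicator {t - u0..t} v"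
  have "(\<integral>\<^sup>+v. 1 * indicator {0..t} v * ennreal (T (t - v)) \<partial>lborel) \<le> (\<integral>\<^sup>+v. ?b v \<partial>lborel)"
  proof (intro nn_integral_mono)
    fix v
    consider "v \<notin> {0..t}" | "v \<in> {0..t - u0}" | "v \<in> {t - u0..t}" by force
    then show "1 * indicator {0..t} v * ennreal (T (t - v)) \<le> ?b v"
    proof cases
      case 2
      then have "ennreal (T (t - v)) \<le> ennreal (1 / sqrt (t - v))" using u0(2)[of "t - v"] by (intro ennreal_leI) auto
      then show ?thesis using 2 u0(1) by (auto simp: indicator_def intro: add_increasing2)
    next
      case 3
      then show ?thesis using ennreal_leI[OF T_le[of "t - v"]] by (auto simp: indicator_def intro: add_increasing)
    qed auto
  qed
  also have "\<dots> = (\<integral>\<^sup>+v. ennreal (1 / sqrt (t - v)) * indicator {0..t - u0} v \<partial>lborel)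
      + ennreal (\<alpha> 0) * emeasure lborel {t - u0..t}"
    by (subst nn_integral_add) (auto simp: nn_integral_cmult_indicator)
  also have "(\<integral>\<^sup>+v. ennreal (1 / sqrt (t - v)) * indicator {0..t - u0} v \<partial>lborel)
      = ennreal ((- 2 * sqrt (t - (t - u0))) - (- 2 * sqrt (t - 0)))"
  proof (rule nn_integral_FTC_Icc[where F = "\<lambda>v. - 2 * sqrt (t - v)"])
    fix v assume v: "v \<in> {0..t - u0}"
    show "DERIV (\<lambda>v. - 2 * sqrt (t - v)) v :> 1 / sqrt (t - v)"
      using v u0(1) by (auto intro!: derivative_eq_intros simp: field_simps)
    show "0 \<le> 1 / sqrt (t - v)" using v u0(1) by simp
  qed (use t u0 in auto)
  also have "\<dots> + ennreal (\<alpha> 0) * emeasure lborel {t - u0..t} = ennreal (2 * sqrt t - 2 * sqrt u0 + u0 * \<alpha> 0)"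
    using u0 t \<alpha>0_ge by (simp add: mult.commute flip: ennreal_mult ennreal_plus)
  also have "\<dots> \<le> ennreal (2 * sqrt t + u0 * \<alpha> 0)" using u0 by (intro ennreal_leI) simp
  finally show ?thesis .
qed

text \<open>Layering writes \<open>T\<close> as a \<open>dens\<close>-mixture of windows ending at
  t. On each window the \<open>g 0\<close>-mass exceeds g0 times the length by at most
  \<open>D\<close>, whatever the length. Undoing the layering for Lebesgue measure leaves g0 times
  an integral of \<open>T\<close>, of order sqrt t, and the errors add up to \<open>D\<close> times
  the total mass of \<open>dens\<close>.\<close>

lemma conv_T_rate:
  obtains C t0 where "\<And>t. t0 \<le> t \<Longrightarrow> conv (g 0) T t \<le> C * sqrt t"
proof -
  obtain u0 where u0: "1 \<le> u0" "\<And>u. u0 \<le> u \<Longrightarrow> T u \<le> 1 / sqrt u" by (rule T_rate) blast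
  obtain C where C: "0 \<le> C" "\<And>t x. 1 \<le> t \<Longrightarrow> 0 \<le> x \<Longrightarrow> x \<le> t \<Longrightarrow> \<bar>\<Gamma> x - g0 * x\<bar> \<le> C * sqrt t"
    by (rule \<Gamma>_rate) blast
  have "conv (g 0) T t \<le> (g0 * (2 + u0 * \<alpha> 0) + 2 * C * (\<alpha> 0 - 1)) * sqrt t" if t: "u0 \<le> t" for t
  proof -
    have t1: "1 \<le> t" "0 \<le> t" "1 \<le> sqrt t" using t u0 by auto
    \<comment> \<open>One error C sqrt t for each end of a window.\<close>
    define D where "D = 2 * C * sqrt t"
    have D: "0 \<le> D" using C(1) t1 by (simp add: D_def)
    have "ennreal (conv (g 0) T t) = (\<integral>\<^sup>+v. ennreal (g 0 v) * indicator {0..t} v * ennreal (T (t - v)) \<partial>lborel)"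
      unfolding conv_nn[OF T_bounded T_nonneg] by (intro nn_integral_cong) (simp add: mult_ac)
    also have "\<dots> = (\<integral>\<^sup>+w. dens w * indicator {0..} w * (\<integral>\<^sup>+v. ennreal (g 0 v) * indicator {0..t} v * indicator {t - w<..} v \<partial>lborel) \<partial>lborel)"
      by (rule T_layers) (use t1 in auto)
    also have "\<dots> \<le> (\<integral>\<^sup>+w. ennreal g0 * (dens w * indicator {0..} w * (\<integral>\<^sup>+v. 1 * indicator {0..t} v * indicator {t - w<..} v \<partial>lborel))
        + ennreal D * (dens w * indicator {0..} w) \<partial>lborel)"
    proof (intro nn_integral_mono)
      fix w
      show "dens w * indicator {0..} w * (\<integral>\<^sup>+v. ennreal (g 0 v) * indicator {0..t} v * indicator {t - w<..} v \<partial>lborel)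
        \<le> ennreal g0 * (dens w * indicator {0..} w * (\<integral>\<^sup>+v. 1 * indicator {0..t} v * indicator {t - w<..} v \<partial>lborel))
          + ennreal D * (dens w * indicator {0..} w)"
      proof (cases "0 \<le> w")
        case True
        have "\<Gamma> t - \<Gamma> (t - w) \<le> g0 * min w t + D"
        proof (cases "w \<le> t")
          case wt: True
          have "g0 * w = g0 * t - g0 * (t - w)" by (simp add: algebra_simps)
          then show ?thesis using C(2)[of t t] C(2)[of t "t - w"] t1 True wt by (simp add: D_def)
        next
          case False
          then show ?thesis using C(2)[of t t] t1 \<Gamma>_nonneg[of "t - w"] D by (simp add: D_def)
        qed
        then have "ennreal (\<Gamma> t - \<Gamma> (t - w)) \<le> ennreal (g0 * min w t + D)" by (rule ennreal_leI)
        also have "\<dots> = ennreal g0 * ennreal (min w t) + ennreal D"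
          using g0_nonneg D t1 True by (simp add: ennreal_mult)
        finally have "dens w * ennreal (\<Gamma> t - \<Gamma> (t - w)) \<le> dens w * (ennreal g0 * ennreal (min w t) + ennreal D)"
          by (intro mult_left_mono) auto
        then show ?thesis using True unfolding layer_g0[OF True] layer_1[OF True t1(2)]
          by (simp add: distrib_left mult_ac)
      qed simp
    qed
    also have "\<dots> = ennreal g0 * (\<integral>\<^sup>+w. dens w * indicator {0..} w * (\<integral>\<^sup>+v. 1 * indicator {0..t} v * indicator {t - w<..} v \<partial>lborel) \<partial>lborel)
      + ennreal D * (\<integral>\<^sup>+w. dens w * indicator {0..} w \<partial>lborel)"
    proof -
      have m: "(\<lambda>w. \<integral>\<^sup>+v. 1 * indicator {0..t} v * indicator {t - w<..} v \<partial>lborel) \<in> borel_measurable borel"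
      proof -
        have "(\<lambda>w. \<integral>\<^sup>+v. 1 * indicator {0..t} v * indicator {t - w<..} v \<partial>lborel)
          = (\<lambda>w. \<integral>\<^sup>+v. (if 0 \<le> v \<and> v \<le> t \<and> t - w < v then 1 else 0 :: ennreal) \<partial>lborel)"
          by (intro ext nn_integral_cong) (auto simp: indicator_def)
        also have "\<dots> \<in> borel_measurable borel" by measurable
        finally show ?thesis .
      qed
      have "(\<integral>\<^sup>+w. a * (dens w * indicator {0..} w * J w) + b * (dens w * indicator {0..} w) \<partial>lborel)
        = a * (\<integral>\<^sup>+w. dens w * indicator {0..} w * J w \<partial>lborel) + b * (\<integral>\<^sup>+w. dens w * indicator {0..} w \<partial>lborel)"
        if [measurable]: "J \<in> borel_measurable borel" for J a b
        by (simp add: nn_integral_add nn_integral_cmult)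
      from this[OF m] show ?thesis .
    qed
    also have "\<dots> = ennreal g0 * (\<integral>\<^sup>+v. 1 * indicator {0..t} v * ennreal (T (t - v)) \<partial>lborel) + ennreal D * ennreal (\<alpha> 0 - 1)"
      unfolding dens_total using T_layers[of "\<lambda>_. 1" t] t1 by simp
    also have "\<dots> \<le> ennreal g0 * ennreal (2 * sqrt t + u0 * \<alpha> 0) + ennreal D * ennreal (\<alpha> 0 - 1)"
      by (intro add_right_mono mult_left_mono T_integral_bound[OF u0 t]) auto
    also have "\<dots> = ennreal (g0 * (2 * sqrt t + u0 * \<alpha> 0) + D * (\<alpha> 0 - 1))"
      using g0_nonneg D t1 \<alpha>0_ge u0(1) by (simp flip: ennreal_mult ennreal_plus)
    finally have "conv (g 0) T t \<le> g0 * (2 * sqrt t + u0 * \<alpha> 0) + D * (\<alpha> 0 - 1)"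
      using g0_nonneg D t1 \<alpha>0_ge u0(1) by (subst (asm) ennreal_le_iff) auto
    also have "\<dots> \<le> g0 * (2 * sqrt t + u0 * \<alpha> 0 * sqrt t) + D * (\<alpha> 0 - 1)"
      using g0_nonneg u0(1) \<alpha>0_ge t1 mult_left_mono[of 1 "sqrt t" "u0 * \<alpha> 0"]
      by (intro add_right_mono mult_left_mono add_left_mono) auto
    finally show ?thesis by (simp add: D_def algebra_simps)
  qed
  then show thesis by (rule that)
qed

lemma mean_count_rate:
  obtains C t0 where "\<And>t. t0 \<le> t \<Longrightarrow> \<bar>conv (g 0) (EA 0) t - g0 * \<alpha> 0 * t\<bar> \<le> C * sqrt t"
proof -
  obtain C where C: "0 \<le> C" "\<And>t x. 1 \<le> t \<Longrightarrow> 0 \<le> x \<Longrightarrow> x \<le> t \<Longrightarrow> \<bar>\<Gamma> x - g0 * x\<bar> \<le> C * sqrt t"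
    by (rule \<Gamma>_rate) blast
  obtain C' t0 where C': "\<And>t. t0 \<le> t \<Longrightarrow> conv (g 0) T t \<le> C' * sqrt t" by (rule conv_T_rate) blast
  have "\<bar>conv (g 0) (EA 0) t - g0 * \<alpha> 0 * t\<bar> \<le> (\<alpha> 0 * C + C') * sqrt t" if t: "max 1 t0 \<le> t" for t
  proof -
    have "conv (g 0) (\<lambda>u. \<alpha> 0 * 1 - T u) t = \<alpha> 0 * \<Gamma> t - conv (g 0) T t"
      using conv_diff[OF loc_kernel_g bdd_borel_cmult[OF bdd_borel_const[of 1]] T_bounded, of 0 "\<alpha> 0" t]
      by (simp add: \<Gamma>_def conv_cmult[of _ "\<alpha> 0" "\<lambda>_. 1", simplified])
    then have eq: "conv (g 0) (EA 0) t = \<alpha> 0 * \<Gamma> t - conv (g 0) T t" by (simp add: T_def)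
    have "\<alpha> 0 * \<bar>\<Gamma> t - g0 * t\<bar> \<le> \<alpha> 0 * (C * sqrt t)"
      using \<alpha>0_ge t by (intro mult_left_mono C(2)) auto
    moreover have "\<bar>\<alpha> 0 * (\<Gamma> t - g0 * t)\<bar> = \<alpha> 0 * \<bar>\<Gamma> t - g0 * t\<bar>" using \<alpha>0_ge by (simp add: abs_mult)
    moreover have "0 \<le> conv (g 0) T t" by (rule conv_nonneg[OF T_nonneg])
    moreover have "conv (g 0) T t \<le> C' * sqrt t" using C' t by simp
    moreover have "conv (g 0) (EA 0) t - g0 * \<alpha> 0 * t = \<alpha> 0 * (\<Gamma> t - g0 * t) - conv (g 0) T t"
      unfolding eq by (simp add: algebra_simps)
    moreover have "(\<alpha> 0 * C + C') * sqrt t = \<alpha> 0 * (C * sqrt t) + C' * sqrt t" by (simp add: algebra_simps)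
    ultimately show ?thesis by linarith
  qed
  then show thesis by (rule that)
qed

end

section \<open>Large deviations from a quadratic limit of the cumulants\<close>

definition quad_rate :: "real \<Rightarrow> real \<Rightarrow> ereal" where
  "quad_rate s x = (if s = 0 then (if x = 0 then 0 else \<infinity>) else ereal (x\<^sup>2 / (2 * s)))"

lemma elog_le:
  assumes "p \<le> exp b" "0 \<le> p"
  shows "elog p \<le> ereal b"
proof (cases "p = 0")
  case False
  then have "ln p \<le> b" using assms
    by (metis ln_exp ln_le_cancel_iff exp_gt_zero less_eq_real_def)
  then show ?thesis using False by (simp add: elog_def)
qed (simp add: elog_def)

lemma elog_ge:
  assumes "exp b \<le> p"
  shows "ereal b \<le> elog p"
proof -
  have "0 < p" using assms by (meson exp_gt_zero less_le_trans)
  then have "b \<le> ln p" using assms by (simp add: ln_ge_iff)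
  then show ?thesis using \<open>0 < p\<close> by (simp add: elog_def)
qed

text \<open>exp (c |x|) is at most the sum of the two one-sided exponentials, so a set on both sides
  of 0 is treated at once. The resulting factor 2 disappears on the logarithmic scale.\<close>

lemma chernoff_two_sided:
  fixes X :: "'a \<Rightarrow> real"
  assumes "prob_space M" "X \<in> borel_measurable M" "A \<in> sets borel"
    and "integrable M (\<lambda>\<omega>. exp (c * X \<omega>))" "integrable M (\<lambda>\<omega>. exp (- c * X \<omega>))"
    and d: "\<And>x. x \<in> A \<Longrightarrow> d \<le> \<bar>x\<bar>" and c: "0 \<le> c"
  shows "measure M {\<omega>\<in>space M. X \<omega> \<in> A}
    \<le> exp (- c * d) * ((\<integral>\<omega>. exp (c * X \<omega>) \<partial>M) + (\<integral>\<omega>. exp (- c * X \<omega>) \<partial>M))"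
proof -
  interpret prob_space M by fact
  let ?S = "{\<omega>\<in>space M. X \<omega> \<in> A}"
  have S: "?S \<in> sets M" using assms(2,3) by measurable
  have "measure M ?S = (\<integral>\<omega>. indicator ?S \<omega> \<partial>M)" using S by simp
  also have "\<dots> \<le> (\<integral>\<omega>. exp (- c * d) * (exp (c * X \<omega>) + exp (- c * X \<omega>)) \<partial>M)"
  proof (rule integral_mono)
    show "integrable M (indicator ?S :: 'a \<Rightarrow> real)"
      using S by (intro integrable_real_indicator) (auto simp: less_top[symmetric])
    show "integrable M (\<lambda>\<omega>. exp (- c * d) * (exp (c * X \<omega>) + exp (- c * X \<omega>)))"
      using assms by simp
    fix \<omega>
    show "indicator ?S \<omega> \<le> exp (- c * d) * (exp (c * X \<omega>) + exp (- c * X \<omega>))"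
    proof (cases "\<omega> \<in> ?S")
      case True
      have "1 \<le> exp (c * (\<bar>X \<omega>\<bar> - d))" using True d[of "X \<omega>"] c by simp
      also have "\<dots> = exp (- c * d) * exp (c * \<bar>X \<omega>\<bar>)" by (simp add: algebra_simps flip: exp_add)
      also have "\<dots> \<le> exp (- c * d) * (exp (c * X \<omega>) + exp (- c * X \<omega>))"
        by (intro mult_left_mono) (auto simp: abs_if)
      finally show ?thesis using True by simp
    qed (simp add: add_nonneg_nonneg)
  qed
  also have "\<dots> = exp (- c * d) * ((\<integral>\<omega>. exp (c * X \<omega>) \<partial>M) + (\<integral>\<omega>. exp (- c * X \<omega>) \<partial>M))"
    using assms by simp
  finally show ?thesis .
qed

text \<open>A change of measure without forming the tilted law. Within \<open>d\<close> of
  \<open>x\<close> the weight exp (c X) is nearly constant; outside, moving the tilt by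
  \<open>e\<close> towards the respective side bounds the contribution by another exponential
  moment.\<close>

lemma exp_moment_localisation:
  fixes X :: "'a \<Rightarrow> real"
  assumes "prob_space M" "X \<in> borel_measurable M" "A \<in> sets borel"
    and "integrable M (\<lambda>\<omega>. exp (c * X \<omega>))" "integrable M (\<lambda>\<omega>. exp ((c + e) * X \<omega>))"
      "integrable M (\<lambda>\<omega>. exp ((c - e) * X \<omega>))"
    and d: "\<And>y. \<bar>y - x\<bar> < d \<Longrightarrow> y \<in> A" and e: "0 \<le> e"
  shows "(\<integral>\<omega>. exp (c * X \<omega>) \<partial>M) \<le> exp (c * x + \<bar>c\<bar> * d) * measure M {\<omega>\<in>space M. X \<omega> \<in> A}
    + exp (- e * (x + d)) * (\<integral>\<omega>. exp ((c + e) * X \<omega>) \<partial>M)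
    + exp (e * (x - d)) * (\<integral>\<omega>. exp ((c - e) * X \<omega>) \<partial>M)"
proof -
  interpret prob_space M by fact
  let ?S = "{\<omega>\<in>space M. X \<omega> \<in> A}"
  have S: "?S \<in> sets M" using assms(2,3) by measurable
  have int1: "integrable M (indicator ?S :: 'a \<Rightarrow> real)"
    using S by (intro integrable_real_indicator) (auto simp: less_top[symmetric])
  have "(\<integral>\<omega>. exp (c * X \<omega>) \<partial>M) \<le> (\<integral>\<omega>. exp (c * x + \<bar>c\<bar> * d) * indicator ?S \<omega>
      + exp (- e * (x + d)) * exp ((c + e) * X \<omega>) + exp (e * (x - d)) * exp ((c - e) * X \<omega>) \<partial>M)"
  proof (rule integral_mono)
    show "integrable M (\<lambda>\<omega>. exp (c * X \<omega>))" by fact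
    show "integrable M (\<lambda>\<omega>. exp (c * x + \<bar>c\<bar> * d) * indicator ?S \<omega>
      + exp (- e * (x + d)) * exp ((c + e) * X \<omega>) + exp (e * (x - d)) * exp ((c - e) * X \<omega>))"
      using int1 assms(4-6) by simp
    fix \<omega> assume w: "\<omega> \<in> space M"
    consider "\<bar>X \<omega> - x\<bar> < d" | "X \<omega> \<ge> x + d" | "X \<omega> \<le> x - d" by linarith
    then show "exp (c * X \<omega>) \<le> exp (c * x + \<bar>c\<bar> * d) * indicator ?S \<omega>
      + exp (- e * (x + d)) * exp ((c + e) * X \<omega>) + exp (e * (x - d)) * exp ((c - e) * X \<omega>)"
      (is "_ \<le> ?r1 + ?r2 + ?r3")
    proof cases
      case 1
      have "c * (X \<omega> - x) \<le> \<bar>c\<bar> * \<bar>X \<omega> - x\<bar>" by (metis abs_ge_self abs_mult)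
      also have "\<dots> \<le> \<bar>c\<bar> * d" using 1 by (intro mult_left_mono) auto
      finally have "exp (c * X \<omega>) \<le> ?r1" using 1 w d by (simp add: algebra_simps)
      then show ?thesis by (simp add: add_increasing2)
    next
      case 2
      have "e * (X \<omega>) \<ge> e * (x + d)" using 2 e by (intro mult_left_mono) auto
      then have "exp (c * X \<omega>) \<le> ?r2" by (simp add: algebra_simps flip: exp_add)
      moreover have "0 \<le> ?r1" "0 \<le> ?r3" by auto
      ultimately show ?thesis by linarith
    next
      case 3
      have "e * (X \<omega>) \<le> e * (x - d)" using 3 e by (intro mult_left_mono) auto
      then have "exp (c * X \<omega>) \<le> ?r3" by (simp add: algebra_simps flip: exp_add)
      moreover have "0 \<le> ?r1" "0 \<le> ?r2" by auto
      ultimately show ?thesis by linarith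
    qed
  qed
  also have "\<dots> = exp (c * x + \<bar>c\<bar> * d) * measure M ?S
    + exp (- e * (x + d)) * (\<integral>\<omega>. exp ((c + e) * X \<omega>) \<partial>M)
    + exp (e * (x - d)) * (\<integral>\<omega>. exp ((c - e) * X \<omega>) \<partial>M)"
    using assms(4-6) int1 S by simp
  finally show ?thesis .
qed

text \<open>The Gaertner-Ellis situation with speed \<open>v\<close> and a quadratic limit.
  Integrability is asked only for large \<open>t\<close>, depending on \<theta>, which fits
  exponential moments that are available only near 0.\<close>

locale gaussian_cumulants = prob_space M for M :: "'a measure" +
  fixes X :: "real \<Rightarrow> 'a \<Rightarrow> real" and v :: "real \<Rightarrow> real" and s2 :: real
  assumes X_meas: "\<And>t. X t \<in> borel_measurable M"
    and v_lim: "filterlim v at_top at_top"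
    and exp_int: "\<And>\<theta>. \<forall>\<^sub>F t in at_top. integrable M (\<lambda>\<omega>. exp (\<theta> * v t * X t \<omega>))"
    and cum_lim: "\<And>\<theta>. ((\<lambda>t. ln (\<integral>\<omega>. exp (\<theta> * v t * X t \<omega>) \<partial>M) / v t) \<longlongrightarrow> \<theta>\<^sup>2 * s2 / 2) at_top"
    and s2_nonneg: "0 \<le> s2"
begin

lemma exp_moment_pos:
  "integrable M (\<lambda>\<omega>. exp (c * X t \<omega>)) \<Longrightarrow> 0 < (\<integral>\<omega>. exp (c * X t \<omega>) \<partial>M)"
  using integral_nonneg_eq_0_iff_AE[of M "\<lambda>\<omega>. exp (c * X t \<omega>)"]
    Bochner_Integration.integral_nonneg[of M "\<lambda>\<omega>. exp (c * X t \<omega>)"] AE_False by (simp add: less_le)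

lemma exp_moment_upper:
  assumes "0 < e"
  shows "\<forall>\<^sub>F t in at_top. (\<integral>\<omega>. exp (\<theta> * v t * X t \<omega>) \<partial>M) \<le> exp (v t * (\<theta>\<^sup>2 * s2 / 2 + e))"
proof -
  have "\<forall>\<^sub>F t in at_top. ln (\<integral>\<omega>. exp (\<theta> * v t * X t \<omega>) \<partial>M) / v t < \<theta>\<^sup>2 * s2 / 2 + e"
    using assms by (intro order_tendstoD(2)[OF cum_lim[of \<theta>]]) simp
  then show ?thesis
    using exp_int[of \<theta>] filterlim_at_top_dense[THEN iffD1, OF v_lim, rule_format, of 0]
  proof (eventually_elim)
    case (elim t)
    then have "ln (\<integral>\<omega>. exp (\<theta> * v t * X t \<omega>) \<partial>M) \<le> v t * (\<theta>\<^sup>2 * s2 / 2 + e)"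
      using assms by (simp add: field_simps)
    then show ?case using exp_moment_pos[OF elim(2)] by (metis exp_le_cancel_iff exp_ln)
  qed
qed

lemma exp_moment_lower:
  assumes "0 < e"
  shows "\<forall>\<^sub>F t in at_top. (\<integral>\<omega>. exp (\<theta> * v t * X t \<omega>) \<partial>M) \<ge> exp (v t * (\<theta>\<^sup>2 * s2 / 2 - e))"
proof -
  have "\<forall>\<^sub>F t in at_top. \<theta>\<^sup>2 * s2 / 2 - e < ln (\<integral>\<omega>. exp (\<theta> * v t * X t \<omega>) \<partial>M) / v t"
    using assms by (intro order_tendstoD(1)[OF cum_lim[of \<theta>]]) simp
  then show ?thesis
    using exp_int[of \<theta>] filterlim_at_top_dense[THEN iffD1, OF v_lim, rule_format, of 0]
  proof (eventually_elim)
    case (elim t)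
    then have "ln (\<integral>\<omega>. exp (\<theta> * v t * X t \<omega>) \<partial>M) \<ge> v t * (\<theta>\<^sup>2 * s2 / 2 - e)"
      using assms by (simp add: field_simps)
    then show ?case using exp_moment_pos[OF elim(2)] by (metis exp_le_cancel_iff exp_ln)
  qed
qed

section \<open>Upper large deviation bound\<close>

lemma Limsup_le_linear:
  assumes A: "A \<in> sets borel" and d: "\<And>x. x \<in> A \<Longrightarrow> d \<le> \<bar>x\<bar>" and e: "0 < e" and \<theta>: "0 \<le> \<theta>"
  shows "Limsup at_top (\<lambda>t. ereal (1 / v t) * elog (measure M {\<omega>\<in>space M. X t \<omega> \<in> A}))
     \<le> ereal (\<theta>\<^sup>2 * s2 / 2 - \<theta> * d + e)"
proof (rule Limsup_bounded)
  have e2: "0 < e / 2" using e by simp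
  \<comment> \<open>From here on the factor 2 of the two-sided bound costs at most e/2.\<close>
  have "\<forall>\<^sub>F t in at_top. v t > 2 * ln 2 / e"
    using filterlim_at_top_dense[THEN iffD1, OF v_lim] by blast
  moreover have "\<forall>\<^sub>F t in at_top. v t > 0"
    using filterlim_at_top_dense[THEN iffD1, OF v_lim] by blast
  ultimately show "\<forall>\<^sub>F t in at_top. ereal (1 / v t) * elog (measure M {\<omega>\<in>space M. X t \<omega> \<in> A})
    \<le> ereal (\<theta>\<^sup>2 * s2 / 2 - \<theta> * d + e)"
    using exp_int[of \<theta>] exp_int[of "-\<theta>"] exp_moment_upper[OF e2, of \<theta>] exp_moment_upper[OF e2, of "-\<theta>"]
  proof eventually_elim
    case (elim t)
    let ?P = "measure M {\<omega>\<in>space M. X t \<omega> \<in> A}"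
    have "?P \<le> exp (- (\<theta> * v t) * d) * ((\<integral>\<omega>. exp (\<theta> * v t * X t \<omega>) \<partial>M) + (\<integral>\<omega>. exp (- (\<theta> * v t) * X t \<omega>) \<partial>M))"
      using elim(3,4) d \<theta> elim(2) by (intro chernoff_two_sided A X_meas prob_space_axioms) auto
    also have "\<dots> \<le> exp (- (\<theta> * v t) * d) * (2 * exp (v t * (\<theta>\<^sup>2 * s2 / 2 + e / 2)))"
      using elim(5,6) by (intro mult_left_mono) auto
    also have "\<dots> = exp (ln 2 + (v t * (\<theta>\<^sup>2 * s2 / 2 + e / 2) - \<theta> * v t * d))"
    proof -
      have "exp (- b) * (2 * exp c) = exp (ln 2 + (c - b))" for b c :: real
        by (simp add: exp_add exp_diff exp_minus field_simps)
      then show ?thesis by simp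
    qed
    finally have "elog ?P \<le> ereal (ln 2 + (v t * (\<theta>\<^sup>2 * s2 / 2 + e / 2) - \<theta> * v t * d))"
      by (intro elog_le) auto
    then have "ereal (1 / v t) * elog ?P \<le> ereal (1 / v t) * ereal (ln 2 + (v t * (\<theta>\<^sup>2 * s2 / 2 + e / 2) - \<theta> * v t * d))"
      using elim(2) by (intro ereal_mult_left_mono) auto
    also have "\<dots> = ereal (ln 2 / v t + (\<theta>\<^sup>2 * s2 / 2 + e / 2) - \<theta> * d)"
      using elim(2) by (simp add: field_simps)
    also have "\<dots> \<le> ereal (\<theta>\<^sup>2 * s2 / 2 - \<theta> * d + e)"
    proof -
      have "ln 2 / v t \<le> e / 2" using elim(1,2) e by (simp add: field_simps)
      then show ?thesis unfolding ereal_less_eq by linarith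
    qed
    finally show ?case .
  qed
qed

lemma Limsup_le_rate:
  assumes A: "A \<in> sets borel"
  shows "Limsup at_top (\<lambda>t. ereal (1 / v t) * elog (measure M {\<omega>\<in>space M. X t \<omega> \<in> A}))
     \<le> - (INF x\<in>closure A. quad_rate s2 x)" (is "?L \<le> _")
proof -
  have vpos: "\<forall>\<^sub>F t in at_top. v t > 0"
    using filterlim_at_top_dense[THEN iffD1, OF v_lim] by blast
  show ?thesis
  proof (cases "A = {}")
    case True
    have "?L \<le> -\<infinity>"
      using vpos by (intro Limsup_bounded) (auto simp: True elog_def elim!: eventually_mono)
    then show ?thesis by simp
  next
    case False
    then have "closed (closure A)" "closure A \<noteq> {}" by auto
    \<comment> \<open>The rate grows with |x|, so only the distance from 0 matters, and the closure
      attains it.\<close>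
    then obtain z where z: "z \<in> closure A" and zle: "\<And>y. y \<in> closure A \<Longrightarrow> dist 0 z \<le> dist 0 y"
      using distance_attains_inf by blast
    have d: "x \<in> A \<Longrightarrow> \<bar>z\<bar> \<le> \<bar>x\<bar>" for x
      using zle[of x] closure_subset by (auto simp: dist_real_def)
    have lin: "?L \<le> ereal (\<theta>\<^sup>2 * s2 / 2 - \<theta> * \<bar>z\<bar>)" if "0 \<le> \<theta>" for \<theta>
    proof (rule ereal_le_epsilon2)
      fix e :: real assume "0 < e"
      from Limsup_le_linear[OF A d this that]
      show "?L \<le> ereal (\<theta>\<^sup>2 * s2 / 2 - \<theta> * \<bar>z\<bar>) + ereal e" by simp
    qed
    have "?L \<le> - quad_rate s2 z"
    proof (cases "s2 = 0")
      case True
      show ?thesis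
      proof (cases "z = 0")
        case True then show ?thesis using lin[of 0] by (simp add: quad_rate_def zero_ereal_def)
      next
        case False
        \<comment> \<open>Without a quadratic term the bound -\<theta> |z| improves without limit as
          \<theta> grows.\<close>
        have "?L \<le> ereal B" for B
        proof -
          have "?L \<le> ereal (- (\<bar>B\<bar> / \<bar>z\<bar>) * \<bar>z\<bar>)" using lin[of "\<bar>B\<bar> / \<bar>z\<bar>"] True by simp
          also have "\<dots> \<le> ereal B" using False by simp
          finally show ?thesis .
        qed
        then have "?L = -\<infinity>" by (rule ereal_bot)
        then show ?thesis by simp
      qed
    next
      case False
      \<comment> \<open>The parameter |z|/s2 minimises \<theta>^2 s2/2 - \<theta> |z|.\<close>
      then have "?L \<le> ereal ((\<bar>z\<bar> / s2)\<^sup>2 * s2 / 2 - \<bar>z\<bar> / s2 * \<bar>z\<bar>)"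
        using lin[of "\<bar>z\<bar> / s2"] s2_nonneg by simp
      also have "(\<bar>z\<bar> / s2)\<^sup>2 * s2 / 2 - \<bar>z\<bar> / s2 * \<bar>z\<bar> = - (z\<^sup>2 / (2 * s2))"
        using False by (simp add: field_simps power2_eq_square)
      finally show ?thesis using False by (simp add: quad_rate_def)
    qed
    also have "\<dots> \<le> - (INF x\<in>closure A. quad_rate s2 x)"
      using z by (simp add: INF_lower)
    finally show ?thesis .
  qed
qed

section \<open>Lower large deviation bound\<close>

lemma Liminf_ge_local:
  assumes A: "A \<in> sets borel" and d: "\<And>y. \<bar>y - \<theta> * s2\<bar> < d \<Longrightarrow> y \<in> A" and d0: "0 < d"
  shows "ereal (- (\<theta>\<^sup>2 * s2 / 2) - \<bar>\<theta>\<bar> * d)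
    \<le> Liminf at_top (\<lambda>t. ereal (1 / v t) * elog (measure M {\<omega>\<in>space M. X t \<omega> \<in> A}))" (is "_ \<le> ?L")
proof (rule ereal_le_epsilon2)
  fix e0 :: real assume e0: "0 < e0"
  \<comment> \<open>The derivative of \<theta>^2 s2/2, that is, the value that the tilt \<theta>
    makes typical.\<close>
  define x where "x = \<theta> * s2"
  \<comment> \<open>Nearly the minimiser d/s2 of \<eta>^2 s2/2 - \<eta> d, but meaningful for s2 = 0
    as well. Since \<eta> s2 \<le> d, shifting the tilt by \<eta> in either direction gains at least
    \<eta> d/2 in the exponent outside the window.\<close>
  define \<eta> where "\<eta> = d / (s2 + 1)"
  define \<kappa> where "\<kappa> = \<eta> * d / 2"
  have \<eta>: "0 < \<eta>" and \<kappa>: "0 < \<kappa>" using d0 s2_nonneg by (auto simp: \<eta>_def \<kappa>_def)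
  have "\<eta> * s2 \<le> d" using d0 s2_nonneg by (simp add: \<eta>_def field_simps)
  then have "\<eta> * (\<eta> * s2) \<le> \<eta> * d" using \<eta> by (intro mult_left_mono) auto
  then have \<eta>2: "\<eta>\<^sup>2 * s2 / 2 - \<eta> * d \<le> - \<kappa>" by (simp add: \<kappa>_def power2_eq_square algebra_simps)
  \<comment> \<open>The error \<open>e\<close> is lost once in the lower and once in the upper
    moment bound, so half of the gain \<kappa> survives; \<open>e0 / 2\<close> leaves the other half
    of \<open>e0\<close> for ln 2 / v t.\<close>
  define e where "e = min (\<kappa> / 4) (e0 / 2)"
  have e: "0 < e" "e \<le> \<kappa> / 4" "e \<le> e0 / 2" using \<kappa> e0 by (auto simp: e_def)
  define l where "l = \<theta>\<^sup>2 * s2 / 2"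
  have lx: "\<theta> * x = 2 * l" by (simp add: l_def x_def power2_eq_square)
  have lp: "(\<theta> + \<eta>)\<^sup>2 * s2 / 2 - \<eta> * (x + d) \<le> l - \<kappa>"
    using \<eta>2 by (simp add: l_def x_def power2_eq_square algebra_simps add_divide_distrib)
  have lm: "(\<theta> - \<eta>)\<^sup>2 * s2 / 2 + \<eta> * (x - d) \<le> l - \<kappa>"
    using \<eta>2 by (simp add: l_def x_def power2_eq_square algebra_simps add_divide_distrib diff_divide_distrib)
  have "\<forall>\<^sub>F t in at_top. v t > 2 * ln 4 / \<kappa>" "\<forall>\<^sub>F t in at_top. v t > 0" "\<forall>\<^sub>F t in at_top. v t > 2 * ln 2 / e0"
    using filterlim_at_top_dense[THEN iffD1, OF v_lim] by blast+
  then have "\<forall>\<^sub>F t in at_top. ereal (- l - \<bar>\<theta>\<bar> * d - e0) \<le> ereal (1 / v t) * elog (measure M {\<omega>\<in>space M. X t \<omega> \<in> A})"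
    using exp_int[of \<theta>] exp_int[of "\<theta> + \<eta>"] exp_int[of "\<theta> - \<eta>"] exp_moment_lower[OF e(1), of \<theta>]
      exp_moment_upper[OF e(1), of "\<theta> + \<eta>"] exp_moment_upper[OF e(1), of "\<theta> - \<eta>"]
  proof eventually_elim
    case (elim t)
    let ?P = "measure M {\<omega>\<in>space M. X t \<omega> \<in> A}"
    have v0: "0 < v t" by fact
    have "exp (v t * (l - e)) \<le> (\<integral>\<omega>. exp (\<theta> * v t * X t \<omega>) \<partial>M)"
      using elim(7) by (simp only: l_def)
    also have "\<dots> \<le> exp (\<theta> * v t * x + \<bar>\<theta> * v t\<bar> * d) * ?P
      + exp (- (\<eta> * v t) * (x + d)) * (\<integral>\<omega>. exp ((\<theta> * v t + \<eta> * v t) * X t \<omega>) \<partial>M)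
      + exp (\<eta> * v t * (x - d)) * (\<integral>\<omega>. exp ((\<theta> * v t - \<eta> * v t) * X t \<omega>) \<partial>M)"
      using elim(4-6) d \<eta> v0 by (intro exp_moment_localisation A X_meas prob_space_axioms)
        (simp_all add: distrib_right left_diff_distrib x_def)
    also have "\<dots> \<le> exp (\<theta> * v t * x + \<bar>\<theta> * v t\<bar> * d) * ?P
      + exp (- (\<eta> * v t) * (x + d)) * exp (v t * ((\<theta> + \<eta>)\<^sup>2 * s2 / 2 + e))
      + exp (\<eta> * v t * (x - d)) * exp (v t * ((\<theta> - \<eta>)\<^sup>2 * s2 / 2 + e))"
      using elim(8,9) by (intro add_mono mult_left_mono order_refl) (simp_all add: distrib_right left_diff_distrib)
    also have "\<dots> = exp (v t * (2 * l + \<bar>\<theta>\<bar> * d)) * ?P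
      + exp (v t * ((\<theta> + \<eta>)\<^sup>2 * s2 / 2 - \<eta> * (x + d) + e)) + exp (v t * ((\<theta> - \<eta>)\<^sup>2 * s2 / 2 + \<eta> * (x - d) + e))"
    proof -
      have "\<theta> * v t * x + \<bar>\<theta> * v t\<bar> * d = v t * (\<theta> * x + \<bar>\<theta>\<bar> * d)"
        using v0 by (simp add: abs_mult algebra_simps)
      then show ?thesis by (simp add: lx algebra_simps flip: exp_add)
    qed
    also have "\<dots> \<le> exp (v t * (2 * l + \<bar>\<theta>\<bar> * d)) * ?P + exp (v t * (l - \<kappa> + e)) + exp (v t * (l - \<kappa> + e))"
      using v0 lp lm by (intro add_mono order_refl) (auto intro!: mult_left_mono)
    finally have 1: "exp (v t * (l - e)) - 2 * exp (v t * (l - \<kappa> + e)) \<le> exp (v t * (2 * l + \<bar>\<theta>\<bar> * d)) * ?P"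
      by simp
    \<comment> \<open>Each of the two outer terms is then at most a quarter of the lower bound for
      the moment, so the window carries at least half of it.\<close>
    have "ln 4 \<le> v t * (\<kappa> / 2)" using elim(1) \<kappa> by (simp add: field_simps)
    also have "\<dots> \<le> v t * (\<kappa> - 2 * e)" using v0 e by (intro mult_left_mono) auto
    finally have "ln 4 + v t * (l - \<kappa> + e) \<le> v t * (l - e)" by (simp add: algebra_simps)
    then have "exp (ln 4 + v t * (l - \<kappa> + e)) \<le> exp (v t * (l - e))" by simp
    then have "4 * exp (v t * (l - \<kappa> + e)) \<le> exp (v t * (l - e))" by (simp add: exp_add)
    then have "exp (v t * (l - e)) / 2 \<le> exp (v t * (2 * l + \<bar>\<theta>\<bar> * d)) * ?P" using 1 by simp
    then have "exp (v t * (l - e)) / 2 / exp (v t * (2 * l + \<bar>\<theta>\<bar> * d)) \<le> ?P"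
      by (simp add: divide_le_eq mult.commute)
    also have "exp (v t * (l - e)) / 2 / exp (v t * (2 * l + \<bar>\<theta>\<bar> * d)) = exp (v t * (l - e) - v t * (2 * l + \<bar>\<theta>\<bar> * d) - ln 2)"
      by (simp add: exp_diff)
    finally have "ereal (v t * (l - e) - v t * (2 * l + \<bar>\<theta>\<bar> * d) - ln 2) \<le> elog ?P"
      by (rule elog_ge)
    then have "ereal (1 / v t) * ereal (v t * (l - e) - v t * (2 * l + \<bar>\<theta>\<bar> * d) - ln 2) \<le> ereal (1 / v t) * elog ?P"
      using v0 by (intro ereal_mult_left_mono) auto
    moreover have "- l - \<bar>\<theta>\<bar> * d - e0 \<le> (1 / v t) * (v t * (l - e) - v t * (2 * l + \<bar>\<theta>\<bar> * d) - ln 2)"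
    proof -
      have "(1 / v t) * (v t * (l - e) - v t * (2 * l + \<bar>\<theta>\<bar> * d) - ln 2) = (l - e) - (2 * l + \<bar>\<theta>\<bar> * d) - ln 2 / v t"
        using v0 by (simp add: field_simps)
      moreover have "ln 2 / v t \<le> e0 / 2" using elim(3) v0 e0 by (simp add: field_simps)
      ultimately show ?thesis using e by simp
    qed
    then have "ereal (- l - \<bar>\<theta>\<bar> * d - e0)
      \<le> ereal (1 / v t) * ereal (v t * (l - e) - v t * (2 * l + \<bar>\<theta>\<bar> * d) - ln 2)"
      by (simp only: times_ereal.simps ereal_less_eq)
    ultimately show ?case by (blast intro: order_trans)
  qed
  then have "ereal (- l - \<bar>\<theta>\<bar> * d - e0) \<le> ?L" by (intro Liminf_bounded)
  then have "ereal (- l - \<bar>\<theta>\<bar> * d - e0) + ereal e0 \<le> ?L + ereal e0" by (rule add_right_mono)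
  then show "ereal (- (\<theta>\<^sup>2 * s2 / 2) - \<bar>\<theta>\<bar> * d) \<le> ?L + ereal e0" by (simp add: l_def)
qed

lemma Liminf_ge_rate:
  assumes A: "A \<in> sets borel"
  shows "- (INF x\<in>interior A. quad_rate s2 x)
    \<le> Liminf at_top (\<lambda>t. ereal (1 / v t) * elog (measure M {\<omega>\<in>space M. X t \<omega> \<in> A}))" (is "_ \<le> ?L")
proof -
  have "- ?L \<le> quad_rate s2 x" if x: "x \<in> interior A" for x
  proof (cases "s2 = 0 \<and> x \<noteq> 0")
    case False
    \<comment> \<open>If s2 = 0 then x = 0 in this case, and division by zero gives \<theta> = 0,
      which still satisfies x = \<theta> s2.\<close>
    define \<theta> where "\<theta> = x / s2"
    have x\<theta>: "x = \<theta> * s2" and rate: "quad_rate s2 x = ereal (\<theta>\<^sup>2 * s2 / 2)"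
      using False by (auto simp: \<theta>_def quad_rate_def power2_eq_square zero_ereal_def)
    obtain d0 where d0: "0 < d0" "\<And>y. \<bar>y - x\<bar> < d0 \<Longrightarrow> y \<in> A"
      using x unfolding mem_interior by (auto simp: subset_iff dist_real_def abs_minus_commute)
    have "ereal (- (\<theta>\<^sup>2 * s2 / 2)) \<le> ?L"
    proof (rule ereal_le_epsilon2)
      fix e :: real assume e: "0 < e"
      define d where "d = min d0 (e / (\<bar>\<theta>\<bar> + 1))"
      have d: "0 < d" "d \<le> d0" "d \<le> e / (\<bar>\<theta>\<bar> + 1)" using d0 e by (auto simp: d_def)
      have "\<bar>\<theta>\<bar> * d \<le> (\<bar>\<theta>\<bar> + 1) * d" using d by (simp add: algebra_simps)
      also have "\<dots> \<le> e" using d(3) by (simp add: field_simps)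
      finally have le: "\<bar>\<theta>\<bar> * d \<le> e" .
      have "ereal (- (\<theta>\<^sup>2 * s2 / 2)) \<le> ereal (- (\<theta>\<^sup>2 * s2 / 2) - \<bar>\<theta>\<bar> * d) + ereal e" using le by simp
      also have "\<dots> \<le> ?L + ereal e"
        using d d0 by (intro add_right_mono Liminf_ge_local A) (auto simp: x\<theta>)
      finally show "ereal (- (\<theta>\<^sup>2 * s2 / 2)) \<le> ?L + ereal e" .
    qed
    then have "- ?L \<le> - ereal (- (\<theta>\<^sup>2 * s2 / 2))" by (simp only: ereal_minus_le_minus)
    then show ?thesis unfolding rate by simp
  qed (simp add: quad_rate_def)
  then have "- ?L \<le> (INF x\<in>interior A. quad_rate s2 x)" by (rule INF_greatest)
  then show ?thesis by (simp add: ereal_uminus_le_reorder)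
qed

end

section \<open>Sums over conditionally Poisson points\<close>

text \<open>If the configuration is infinite on (0, t], the sum is 0 by the convention for infinite
  index sets; such configurations are later shown to have probability 0.\<close>

definition psum :: "real set \<Rightarrow> real \<Rightarrow> (real \<Rightarrow> real) \<Rightarrow> real" where
  "psum S t f = (\<Sum>\<tau>\<in>S \<inter> {0<..t}. f \<tau>)"

lemma pcount_infinite_iff: "pcount S B = \<infinity> \<longleftrightarrow> infinite (S \<inter> B)"
  by (simp add: pcount_def)

lemma pcount_finite: "finite (S \<inter> B) \<Longrightarrow> pcount S B = of_nat (card (S \<inter> B))"
  by (simp add: pcount_def)

lemma enn2real_pcount: "finite (S \<inter> B) \<Longrightarrow> enn2real (pcount S B) = real (card (S \<inter> B))"
  by (simp add: pcount_finite ennreal_of_nat_eq_real_of_nat)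

lemma psum_simple:
  assumes fin: "finite (S \<inter> {0<..t})" and V: "finite V" "range f \<subseteq> V"
  shows "psum S t f = (\<Sum>y\<in>V. y * enn2real (pcount S (f -` {y} \<inter> {0<..t})))"
proof -
  have "psum S t f = (\<Sum>y\<in>V. \<Sum>\<tau> | \<tau> \<in> S \<inter> {0<..t} \<and> f \<tau> = y. f \<tau>)"
    unfolding psum_def using V by (intro sum.group[symmetric] fin) auto
  also have "\<dots> = (\<Sum>y\<in>V. y * enn2real (pcount S (f -` {y} \<inter> {0<..t})))"
  proof (intro sum.cong refl)
    fix y
    have eq: "{\<tau>. \<tau> \<in> S \<inter> {0<..t} \<and> f \<tau> = y} = S \<inter> (f -` {y} \<inter> {0<..t})" by auto
    have "finite (S \<inter> (f -` {y} \<inter> {0<..t}))" using fin by (rule finite_subset[rotated]) auto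
    moreover have "(\<Sum>\<tau>\<in>S \<inter> (f -` {y} \<inter> {0<..t}). f \<tau>) = (\<Sum>\<tau>\<in>S \<inter> (f -` {y} \<inter> {0<..t}). y)"
      by (intro sum.cong) auto
    ultimately show "(\<Sum>\<tau> | \<tau> \<in> S \<inter> {0<..t} \<and> f \<tau> = y. f \<tau>) = y * enn2real (pcount S (f -` {y} \<inter> {0<..t}))"
      unfolding eq by (simp add: enn2real_pcount mult.commute)
  qed
  finally show ?thesis .
qed

text \<open>Adding \<open>c\<close> makes \<open>f\<close> nonnegative, where increasing simple
  approximations exist; subtracting it again keeps the two-sided bound \<open>c\<close>.\<close>

lemma simple_approximation:
  assumes "bdd_borel c f"
  obtains F :: "nat \<Rightarrow> real \<Rightarrow> real" where "\<And>i. simple_function borel (F i)" "\<And>i x. F i x \<le> F (Suc i) x"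
    "\<And>i. bdd_borel c (F i)" "\<And>x. (\<lambda>i. F i x) \<longlonglongrightarrow> f x"
proof -
  note [measurable] = bdd_borelD(1)[OF assms]
  have "0 \<le> f x + c" for x using bdd_borelD(2)[OF assms, of x] by linarith
  moreover have "(\<lambda>x. f x + c) \<in> borel_measurable borel" by measurable
  ultimately obtain F where F: "incseq F" "\<And>i. simple_function borel (F i)" "\<And>x. bdd_above (range (\<lambda>i. F i x))"
    "\<And>i x. 0 \<le> F i x" "(\<lambda>x. f x + c) = (SUP i. F i)"
    using borel_measurable_implies_simple_function_sequence_real[of "\<lambda>x. f x + c" borel] by blast
  have eq: "f x + c = (SUP i. F i x)" for x
    using fun_cong[OF F(5), of x] by (simp add: image_image)
  have inc: "incseq (\<lambda>i. F i x)" for x using F(1) by (auto simp: incseq_def le_fun_def)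
  have lim: "(\<lambda>i. F i x) \<longlonglongrightarrow> f x + c" for x
    unfolding eq by (rule LIMSEQ_incseq_SUP[OF F(3) inc])
  have le: "F i x \<le> f x + c" for i x by (rule incseq_le[OF inc lim])
  show thesis
  proof
    show "simple_function borel (\<lambda>x. F i x - c)" for i by (intro simple_function_diff F) simp
    show "F i x - c \<le> F (Suc i) x - c" for i x using incseq_SucD[OF inc[of x], of i] by simp
    show "bdd_borel c (\<lambda>x. F i x - c)" for i
    proof -
      have [measurable]: "F i \<in> borel_measurable borel" using F(2) by (rule borel_measurable_simple_function)
      have "\<bar>F i x - c\<bar> \<le> c" for x
        using le[of i x] F(4)[of i x] bdd_borelD(2)[OF assms, of x] by linarith
      then show ?thesis by (simp add: bdd_borel_def)
    qed
    show "(\<lambda>i. F i x - c) \<longlonglongrightarrow> f x" for x using tendsto_diff[OF lim tendsto_const, of x c] by simp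
  qed
qed

text \<open>Only the counts of Borel sets are known to be measurable. For a simple function the sum
  is a combination of the counts of its level sets, except on infinite configurations, where the
  default value 0 has to be put in by cases.\<close>

lemma psum_measurable:
  assumes pc: "\<And>B. B \<in> sets borel \<Longrightarrow> (\<lambda>\<omega>. pcount (X \<omega>) B) \<in> borel_measurable K"
    and f: "bdd_borel c f"
  shows "(\<lambda>\<omega>. psum (X \<omega>) t f) \<in> borel_measurable K"
proof -
  from simple_approximation[OF f] obtain F where F: "\<And>i. simple_function borel (F i)"
    "\<And>i. bdd_borel c (F i)" "\<And>x. (\<lambda>i. F i x) \<longlonglongrightarrow> f x" by metis
  have [measurable]: "F i \<in> borel_measurable borel" for i by (rule bdd_borelD(1)[OF F(2)])
  have fin: "finite (range (F i))" for i using F(1)[of i] by (simp add: simple_function_def)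
  show ?thesis
  proof (rule borel_measurable_LIMSEQ_real)
    show "(\<lambda>i. psum (X \<omega>) t (F i)) \<longlonglongrightarrow> psum (X \<omega>) t f" for \<omega>
      unfolding psum_def by (intro tendsto_sum F)
    show "(\<lambda>\<omega>. psum (X \<omega>) t (F i)) \<in> borel_measurable K" for i
    proof -
      have "psum (X \<omega>) t (F i) = (if pcount (X \<omega>) {0<..t} = \<infinity> then 0
        else \<Sum>y\<in>range (F i). y * enn2real (pcount (X \<omega>) (F i -` {y} \<inter> {0<..t})))" for \<omega>
      proof (cases "finite (X \<omega> \<inter> {0<..t})")
        case True
        then show ?thesis using psum_simple[OF True fin order_refl, of i] pcount_infinite_iff[of "X \<omega>" "{0<..t}"] by simp
      next
        case False
        then show ?thesis using pcount_infinite_iff[of "X \<omega>" "{0<..t}"] by (simp add: psum_def)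
      qed
      moreover have "F i -` {y} \<inter> {0<..t} \<in> sets borel" for y
        using measurable_sets_borel[of "F i" borel "{y}"] by auto
      note [measurable] = pc[OF this] pc[of "{0<..t}"]
      have "(\<lambda>\<omega>. if pcount (X \<omega>) {0<..t} = \<infinity> then 0
        else \<Sum>y\<in>range (F i). y * enn2real (pcount (X \<omega>) (F i -` {y} \<inter> {0<..t}))) \<in> borel_measurable K"
        by measurable
      ultimately show ?thesis by simp
    qed
  qed
qed

text \<open>Equality of two conditional expectations, expressed without forming them: tested on
  events of the smaller algebra, it extends to all nonnegative weights measurable for that
  algebra.\<close>

lemma nn_integral_eq_subalgebra:
  fixes Y Z1 Z2 :: "'a \<Rightarrow> ennreal"
  assumes sub: "space N = space M" "sets N \<subseteq> sets M"
    and [measurable]: "Z1 \<in> borel_measurable M" "Z2 \<in> borel_measurable M"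
    and eq: "\<And>E. E \<in> sets N \<Longrightarrow> (\<integral>\<^sup>+\<omega>. indicator E \<omega> * Z1 \<omega> \<partial>M) = (\<integral>\<^sup>+\<omega>. indicator E \<omega> * Z2 \<omega> \<partial>M)"
    and Y: "Y \<in> borel_measurable N"
  shows "(\<integral>\<^sup>+\<omega>. Y \<omega> * Z1 \<omega> \<partial>M) = (\<integral>\<^sup>+\<omega>. Y \<omega> * Z2 \<omega> \<partial>M)"
proof -
  have up: "f \<in> borel_measurable M" if "f \<in> borel_measurable N" for f :: "'a \<Rightarrow> ennreal"
    using sub that by (intro measurable_from_subalg[of M N]) (auto simp: subalgebra_def)
  show ?thesis
    using Y
  proof (induction rule: borel_measurable_induct)
    case (cong f f')
    then have "(\<integral>\<^sup>+\<omega>. f \<omega> * Z \<omega> \<partial>M) = (\<integral>\<^sup>+\<omega>. f' \<omega> * Z \<omega> \<partial>M)" for Z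
      using sub by (intro nn_integral_cong) simp
    then show ?case using cong by simp
  next
    case (set A) then show ?case by (rule eq)
  next
    case (mult u c)
    have [measurable]: "u \<in> borel_measurable M" using mult(2) by (rule up)
    show ?case using mult by (simp add: mult.assoc nn_integral_cmult)
  next
    case (add u v)
    have [measurable]: "u \<in> borel_measurable M" "v \<in> borel_measurable M"
      using add by (auto intro: up)
    show ?case using add by (simp add: distrib_right nn_integral_add)
  next
    case (seq U)
    have [measurable]: "U i \<in> borel_measurable M" for i
      using seq(1) by (rule up)
    have "(\<integral>\<^sup>+\<omega>. (SUP i. U i) \<omega> * Z \<omega> \<partial>M) = (SUP i. \<integral>\<^sup>+\<omega>. U i \<omega> * Z \<omega> \<partial>M)"
      if [measurable]: "Z \<in> borel_measurable M" for Z
    proof -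
      have "(\<integral>\<^sup>+\<omega>. (SUP i. U i) \<omega> * Z \<omega> \<partial>M) = (\<integral>\<^sup>+\<omega>. (SUP i. U i \<omega> * Z \<omega>) \<partial>M)"
        by (simp add: SUP_mult_right_ennreal image_image)
      also have "\<dots> = (SUP i. \<integral>\<^sup>+\<omega>. U i \<omega> * Z \<omega> \<partial>M)"
        using \<open>incseq U\<close> by (intro nn_integral_monotone_convergence_SUP) (auto simp: incseq_def le_fun_def intro!: mult_right_mono)
      finally show ?thesis .
    qed
    then show ?case using seq by simp
  qed
qed

text \<open>The exponential series; for \<open>a\<close> = 0 it says that the Poisson probabilities
  sum to 1.\<close>

lemma exp_poisson_suminf:
  assumes "0 \<le> x"
  shows "(\<Sum>c. ennreal (exp (a * real c)) * ennreal (exp (- x) * x ^ c / fact c)) = ennreal (exp (x * (exp a - 1)))"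
proof -
  have "(\<lambda>c. exp (- x) * ((x * exp a) ^ c /\<^sub>R fact c)) sums (exp (- x) * exp (x * exp a))"
    by (intro sums_mult exp_converges)
  moreover have "exp (- x) * ((x * exp a) ^ c /\<^sub>R fact c) = exp (a * real c) * (exp (- x) * x ^ c / fact c)" for c
    by (simp add: power_mult_distrib exp_of_nat_mult[symmetric] mult.commute divide_inverse mult_ac)
  moreover have "exp (- x) * exp (x * exp a) = exp (x * (exp a - 1))"
    by (simp add: algebra_simps flip: exp_add)
  ultimately have "(\<lambda>c. exp (a * real c) * (exp (- x) * x ^ c / fact c)) sums exp (x * (exp a - 1))" by simp
  then have "(\<Sum>c. ennreal (exp (a * real c) * (exp (- x) * x ^ c / fact c))) = ennreal (exp (x * (exp a - 1)))"
    using assms by (intro suminf_ennreal_eq) auto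
  moreover have "ennreal (exp (a * real c)) * ennreal (exp (- x) * x ^ c / fact c)
    = ennreal (exp (a * real c) * (exp (- x) * x ^ c / fact c))" for c
    using assms by (intro ennreal_mult[symmetric]) auto
  ultimately show ?thesis by simp
qed

text \<open>\<open>l\<close> is a real-valued version of the intensity \<open>lam\<close> on \<open>{0<..t}\<close>, defined and integrable for every \<open>\<omega>\<close>;
  the two agree only when the points that generate \<open>lam\<close> are finitely many.\<close>
locale conditional_poisson = prob_space M for M :: "'a measure" +
  fixes F :: "'a measure" and X :: "'a \<Rightarrow> real set" and lam :: "'a \<Rightarrow> real \<Rightarrow> ennreal"
    and t :: real and l :: "'a \<Rightarrow> real \<Rightarrow> real"
  assumes sub: "space F = space M" "sets F \<subseteq> sets M"
    and cp: "cond_poisson M (sets F) X lam"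
    and pc [measurable]: "\<And>B. B \<in> sets borel \<Longrightarrow> (\<lambda>\<omega>. pcount (X \<omega>) B) \<in> borel_measurable M"
    and l_nonneg: "\<And>\<omega> s. 0 \<le> l \<omega> s"
    and l_supp: "\<And>\<omega> s. s \<notin> {0<..t} \<Longrightarrow> l \<omega> s = 0"
    and l_int: "\<And>\<omega>. integrable lborel (l \<omega>)"
    and l_lam: "AE \<omega> in M. \<forall>B\<in>sets borel. B \<subseteq> {0<..t} \<longrightarrow>
      (\<integral>\<^sup>+s. lam \<omega> s * indicator B s \<partial>lborel) = (\<integral>\<^sup>+s. ennreal (l \<omega> s) * indicator B s \<partial>lborel)"
    and l_meas: "\<And>c h. bdd_borel c h \<Longrightarrow> (\<lambda>\<omega>. \<integral>s. l \<omega> s * h s \<partial>lborel) \<in> borel_measurable M"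
begin

section \<open>Exponential functionals of one conditionally Poisson configuration\<close>

definition L :: "'a \<Rightarrow> real set \<Rightarrow> real" where
  "L \<omega> B = (\<integral>s. l \<omega> s * indicator B s \<partial>lborel)"

lemma L_nonneg: "0 \<le> L \<omega> B"
  unfolding L_def using l_nonneg by (intro Bochner_Integration.integral_nonneg) simp

lemma L_meas: "B \<in> sets borel \<Longrightarrow> (\<lambda>\<omega>. L \<omega> B) \<in> borel_measurable M"
  unfolding L_def by (rule l_meas[of 1]) (simp add: bdd_borel_def)

lemma l_mult_int:
  assumes "bdd_borel c h"
  shows "integrable lborel (\<lambda>s. l \<omega> s * h s)"
proof (rule Bochner_Integration.integrable_bound)
  note [measurable] = bdd_borelD(1)[OF assms] borel_measurable_integrable[OF l_int]
  show "integrable lborel (\<lambda>s. c * l \<omega> s)" using l_int by simp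
  show "(\<lambda>s. l \<omega> s * h s) \<in> borel_measurable lborel" by measurable
  show "AE s in lborel. norm (l \<omega> s * h s) \<le> norm (c * l \<omega> s)"
  proof (intro AE_I2)
    fix s
    have "l \<omega> s * \<bar>h s\<bar> \<le> l \<omega> s * c" by (intro mult_left_mono bdd_borelD(2)[OF assms] l_nonneg)
    also have "\<dots> \<le> \<bar>c * l \<omega> s\<bar>" by (simp add: mult.commute)
    finally show "norm (l \<omega> s * h s) \<le> norm (c * l \<omega> s)" using l_nonneg[of \<omega> s] by (simp add: abs_mult)
  qed
qed

definition pois :: "'a \<Rightarrow> real set \<Rightarrow> nat \<Rightarrow> ennreal" where
  "pois \<omega> B c = ennreal (exp (- L \<omega> B) * L \<omega> B ^ c / fact c)"

lemma pois_meas [measurable]: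
  assumes "B \<in> sets borel"
  shows "(\<lambda>\<omega>. pois \<omega> B c) \<in> borel_measurable M"
proof -
  note [measurable] = L_meas[OF assms]
  show ?thesis unfolding pois_def by measurable
qed

lemma counts_prob:
  fixes k :: nat
  assumes E: "E \<in> sets F" and B: "\<And>i. i < k \<Longrightarrow> B i \<in> sets borel" "\<And>i. i < k \<Longrightarrow> B i \<subseteq> {0<..t}"
    and disj: "disjoint_family_on B {..<k}"
  shows "emeasure M (E \<inter> {\<omega>\<in>space M. \<forall>i<k. pcount (X \<omega>) (B i) = of_nat (c i)})
    = (\<integral>\<^sup>+\<omega>. indicator E \<omega> * (\<Prod>i<k. pois \<omega> (B i) (c i)) \<partial>M)"
proof -
  have B': "\<forall>i<k. B i \<in> sets borel \<and> (\<exists>T. B i \<subseteq> {0<..T})" using B by blast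
  have "emeasure M (E \<inter> {\<omega>\<in>space M. \<forall>i<k. pcount (X \<omega>) (B i) = of_nat (c i)})
    = (\<integral>\<^sup>+\<omega>. indicator E \<omega> * (\<Prod>i<k. poisson_prob (\<integral>\<^sup>+s. lam \<omega> s * indicator (B i) s \<partial>lborel) (c i)) \<partial>M)"
    by (rule cp[unfolded cond_poisson_def, THEN bspec, OF E, THEN spec[of _ k], THEN spec[of _ B],
          THEN spec[of _ c], THEN mp, OF B', THEN mp, OF disj])
  also have "\<dots> = (\<integral>\<^sup>+\<omega>. indicator E \<omega> * (\<Prod>i<k. pois \<omega> (B i) (c i)) \<partial>M)"
  proof (rule nn_integral_cong_AE)
    show "AE \<omega> in M. indicator E \<omega> * (\<Prod>i<k. poisson_prob (\<integral>\<^sup>+s. lam \<omega> s * indicator (B i) s \<partial>lborel) (c i))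
      = indicator E \<omega> * (\<Prod>i<k. pois \<omega> (B i) (c i))"
      using l_lam
    proof eventually_elim
      case (elim \<omega>)
      have "poisson_prob (\<integral>\<^sup>+s. lam \<omega> s * indicator (B i) s \<partial>lborel) (c i) = pois \<omega> (B i) (c i)" if "i < k" for i
      proof -
        have "(\<integral>\<^sup>+s. lam \<omega> s * indicator (B i) s \<partial>lborel) = (\<integral>\<^sup>+s. ennreal (l \<omega> s * indicator (B i) s) \<partial>lborel)"
          using elim B that by (simp add: l_nonneg ennreal_mult ennreal_indicator)
        also have "\<dots> = ennreal (L \<omega> (B i))" unfolding L_def
          using that l_nonneg by (intro nn_integral_eq_integral l_mult_int[OF indicator_bdd_borel] B) auto
        finally show ?thesis by (simp add: poisson_prob_def pois_def L_nonneg)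
      qed
      then show ?case by (intro arg_cong2[where f = times] refl prod.cong) auto
    qed
  qed
  finally show ?thesis .
qed

text \<open>The conditional law prescribes the probabilities of finite counts only, but these
  already sum to 1, so nothing is left for an infinite count.\<close>

lemma AE_finite: "AE \<omega> in M. finite (X \<omega> \<inter> {0<..t})"
proof -
  let ?A = "\<lambda>c. {\<omega>\<in>space M. pcount (X \<omega>) {0<..t} = of_nat c}"
  have A: "?A c \<in> sets M" for c by measurable
  have sp: "space M \<in> sets F" using sub(1) sets.top[of F] by simp
  have "emeasure M (\<Union>c. ?A c) = (\<Sum>c. emeasure M (?A c))"
    using A by (intro suminf_emeasure[symmetric]) (auto simp: disjoint_family_on_def)
  also have "\<dots> = (\<Sum>c. \<integral>\<^sup>+\<omega>. pois \<omega> {0<..t} c \<partial>M)"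
  proof (intro suminf_cong)
    fix c
    have "emeasure M (?A c) = emeasure M (space M \<inter> {\<omega>\<in>space M. \<forall>i<1::nat. pcount (X \<omega>) {0<..t} = of_nat c})"
      by (rule arg_cong[where f = "emeasure M"]) auto
    also have "\<dots> = (\<integral>\<^sup>+\<omega>. indicator (space M) \<omega> * (\<Prod>i<1::nat. pois \<omega> {0<..t} c) \<partial>M)"
      by (rule counts_prob[where B = "\<lambda>_. {0<..t}" and c = "\<lambda>_. c" and k = 1, OF sp]) (auto simp: disjoint_family_on_def)
    also have "\<dots> = (\<integral>\<^sup>+\<omega>. pois \<omega> {0<..t} c \<partial>M)" by (intro nn_integral_cong) simp
    finally show "emeasure M (?A c) = (\<integral>\<^sup>+\<omega>. pois \<omega> {0<..t} c \<partial>M)" .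
  qed
  also have "\<dots> = (\<integral>\<^sup>+\<omega>. (\<Sum>c. pois \<omega> {0<..t} c) \<partial>M)" by (intro nn_integral_suminf[symmetric]) measurable
  also have "\<dots> = (\<integral>\<^sup>+\<omega>. 1 \<partial>M)"
    using exp_poisson_suminf[OF L_nonneg, where a = 0] by (simp add: pois_def)
  finally have "emeasure M (\<Union>c. ?A c) = 1" by (simp add: emeasure_space_1)
  then have "AE \<omega> in M. \<omega> \<in> (\<Union>c. ?A c)"
    using A by (intro prob_eq_1[THEN iffD1]) (auto simp: measure_def)
  then show ?thesis
    by eventually_elim (auto simp: pcount_def split: if_splits)
qed

text \<open>A hybrid induction: sets with index below \<open>j\<close> carry their exponential
  factor, the others are still pinned to prescribed counts. Each step sums over the value of a
  single count, which avoids a series over multi-indices; \<open>c\<close> must vary because its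
  entry at \<open>j\<close> runs through all values.\<close>

lemma exp_counts:
  fixes j k :: nat
  assumes E: "E \<in> sets F" and B: "\<And>i. i < k \<Longrightarrow> B i \<in> sets borel" "\<And>i. i < k \<Longrightarrow> B i \<subseteq> {0<..t}"
    and disj: "disjoint_family_on B {..<k}" and j: "j \<le> k"
  shows "(\<integral>\<^sup>+\<omega>. indicator E \<omega> * (\<Prod>i<j. ennreal (exp (a i * enn2real (pcount (X \<omega>) (B i)))))
        * indicator {\<omega>\<in>space M. \<forall>i\<in>{j..<k}. pcount (X \<omega>) (B i) = of_nat (c i)} \<omega> \<partial>M)
    = (\<integral>\<^sup>+\<omega>. indicator E \<omega> * (\<Prod>i<j. ennreal (exp (L \<omega> (B i) * (exp (a i) - 1)))) * (\<Prod>i\<in>{j..<k}. pois \<omega> (B i) (c i)) \<partial>M)"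
  using j
proof (induction j arbitrary: c)
  case 0
  have "E \<inter> {\<omega>\<in>space M. \<forall>i\<in>{0..<k}. pcount (X \<omega>) (B i) = of_nat (c i)} \<in> sets M"
    using E sub B(1) by (intro sets.Int) (auto intro!: sets.sets_Collect_finite_All' pc borel_measurable_eq)
  moreover have "{\<omega>\<in>space M. \<forall>i<k. pcount (X \<omega>) (B i) = of_nat (c i)} = {\<omega>\<in>space M. \<forall>i\<in>{0..<k}. pcount (X \<omega>) (B i) = of_nat (c i)}"
    by auto
  ultimately show ?case using counts_prob[OF E B disj, of c]
    by (simp add: indicator_inter_arith[symmetric] atLeast0LessThan)
next
  case (Suc j)
  then have jk: "j < k" by simp
  have [measurable]: "E \<in> sets M" using E sub by auto
  have Bm [measurable]: "B i \<in> sets borel" if "i \<le> j" for i using that jk B by simp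
  have Lm [measurable]: "(\<lambda>\<omega>. L \<omega> (B i)) \<in> borel_measurable M" if "i \<le> j" for i using that Bm L_meas by blast
  let ?ind = "\<lambda>j c. indicator {\<omega>\<in>space M. \<forall>i\<in>{j..<k}. pcount (X \<omega>) (B i) = of_nat (c i)} :: 'a \<Rightarrow> ennreal"
  let ?e = "\<lambda>j \<omega>. \<Prod>i<j. ennreal (exp (a i * enn2real (pcount (X \<omega>) (B i))))"
  let ?r = "\<lambda>j \<omega>. \<Prod>i<j. ennreal (exp (L \<omega> (B i) * (exp (a i) - 1)))"
  have indm [measurable]: "?ind j c \<in> borel_measurable M" for c
    using B(1) by (intro borel_measurable_indicator) (auto intro!: sets.sets_Collect_finite_All' pc borel_measurable_eq)
  have em [measurable]: "?e j \<in> borel_measurable M"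
  proof (intro borel_measurable_prod_ennreal)
    fix i assume "i \<in> {..<j}"
    then have [measurable]: "B i \<in> sets borel" using Bm by simp
    show "(\<lambda>\<omega>. ennreal (exp (a i * enn2real (pcount (X \<omega>) (B i))))) \<in> borel_measurable M" by measurable
  qed
  have rm [measurable]: "?r j \<in> borel_measurable M"
  proof (intro borel_measurable_prod_ennreal)
    fix i assume "i \<in> {..<j}"
    then have [measurable]: "(\<lambda>\<omega>. L \<omega> (B i)) \<in> borel_measurable M" using Lm by simp
    show "(\<lambda>\<omega>. ennreal (exp (L \<omega> (B i) * (exp (a i) - 1)))) \<in> borel_measurable M" by measurable
  qed
  have pm [measurable]: "(\<lambda>\<omega>. \<Prod>i\<in>{j..<k}. pois \<omega> (B i) (c i)) \<in> borel_measurable M" for c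
    using B(1) by (intro borel_measurable_prod_ennreal pois_meas) simp
  have "(\<integral>\<^sup>+\<omega>. indicator E \<omega> * ?e (Suc j) \<omega> * ?ind (Suc j) c \<omega> \<partial>M)
    = (\<integral>\<^sup>+\<omega>. (\<Sum>x. ennreal (exp (a j * real x)) * (indicator E \<omega> * ?e j \<omega> * ?ind j (c(j := x)) \<omega>)) \<partial>M)"
  proof (rule nn_integral_cong_AE)
    show "AE \<omega> in M. indicator E \<omega> * ?e (Suc j) \<omega> * ?ind (Suc j) c \<omega>
      = (\<Sum>x. ennreal (exp (a j * real x)) * (indicator E \<omega> * ?e j \<omega> * ?ind j (c(j := x)) \<omega>))"
      using AE_finite
    proof (eventually_elim)
      case (elim \<omega>)
      have fin: "finite (X \<omega> \<inter> B j)" using B(2)[OF jk] by (intro finite_subset[OF _ elim]) auto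
      define n where "n = card (X \<omega> \<inter> B j)"
      have n: "pcount (X \<omega>) (B j) = of_nat n" using fin by (simp add: n_def pcount_finite)
      have set: "{j..<k} = insert j {Suc j..<k}" using jk by auto
      \<comment> \<open>Only the actual count contributes to the series; almost sure finiteness
        guarantees that it is a natural number.\<close>
      have ind: "?ind j (c(j := x)) \<omega> = (if x = n then ?ind (Suc j) c \<omega> else 0)" for x
        unfolding set using n by (auto simp: indicator_def)
      have "(\<Sum>x. ennreal (exp (a j * real x)) * (indicator E \<omega> * ?e j \<omega> * ?ind j (c(j := x)) \<omega>))
        = (\<Sum>x\<in>{n}. ennreal (exp (a j * real x)) * (indicator E \<omega> * ?e j \<omega> * ?ind j (c(j := x)) \<omega>))"
        by (rule suminf_finite) (simp_all add: ind del: fun_upd_apply)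
      also have "\<dots> = ennreal (exp (a j * real n)) * (indicator E \<omega> * ?e j \<omega> * ?ind (Suc j) c \<omega>)"
        by (simp add: ind del: fun_upd_apply)
      also have "\<dots> = indicator E \<omega> * ?e (Suc j) \<omega> * ?ind (Suc j) c \<omega>"
        by (simp add: n ennreal_of_nat_eq_real_of_nat mult_ac)
      finally show ?case by simp
    qed
  qed
  also have "\<dots> = (\<Sum>x. \<integral>\<^sup>+\<omega>. ennreal (exp (a j * real x)) * (indicator E \<omega> * ?e j \<omega> * ?ind j (c(j := x)) \<omega>) \<partial>M)"
    by (rule nn_integral_suminf) measurable
  also have "\<dots> = (\<Sum>x. \<integral>\<^sup>+\<omega>. ennreal (exp (a j * real x)) * (indicator E \<omega> * ?r j \<omega> * (\<Prod>i\<in>{j..<k}. pois \<omega> (B i) ((c(j := x)) i))) \<partial>M)"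
    using Suc.IH[of "c(j := x)" for x] jk by (simp add: nn_integral_cmult)
  also have "\<dots> = (\<integral>\<^sup>+\<omega>. (\<Sum>x. ennreal (exp (a j * real x)) * (indicator E \<omega> * ?r j \<omega> * (\<Prod>i\<in>{j..<k}. pois \<omega> (B i) ((c(j := x)) i)))) \<partial>M)"
    by (rule nn_integral_suminf[symmetric]) measurable
  also have "\<dots> = (\<integral>\<^sup>+\<omega>. indicator E \<omega> * ?r (Suc j) \<omega> * (\<Prod>i\<in>{Suc j..<k}. pois \<omega> (B i) (c i)) \<partial>M)"
  proof (rule nn_integral_cong)
    fix \<omega>
    have set: "{j..<k} = insert j {Suc j..<k}" using jk by auto
    have pr: "(\<Prod>i\<in>{j..<k}. pois \<omega> (B i) ((c(j := x)) i)) = pois \<omega> (B j) x * (\<Prod>i\<in>{Suc j..<k}. pois \<omega> (B i) (c i))" for x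
    proof -
      have "(\<Prod>i\<in>{Suc j..<k}. pois \<omega> (B i) ((c(j := x)) i)) = (\<Prod>i\<in>{Suc j..<k}. pois \<omega> (B i) (c i))"
        by (intro prod.cong) auto
      then show ?thesis unfolding set by (subst prod.insert) auto
    qed
    have "(\<Sum>x. ennreal (exp (a j * real x)) * (indicator E \<omega> * ?r j \<omega> * (\<Prod>i\<in>{j..<k}. pois \<omega> (B i) ((c(j := x)) i))))
      = (\<Sum>x. ennreal (exp (a j * real x)) * pois \<omega> (B j) x * (indicator E \<omega> * ?r j \<omega> * (\<Prod>i\<in>{Suc j..<k}. pois \<omega> (B i) (c i))))"
      unfolding pr by (simp add: mult_ac)
    also have "\<dots> = (\<Sum>x. ennreal (exp (a j * real x)) * pois \<omega> (B j) x) * (indicator E \<omega> * ?r j \<omega> * (\<Prod>i\<in>{Suc j..<k}. pois \<omega> (B i) (c i)))"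
      by (rule ennreal_suminf_multc)
    also have "(\<Sum>x. ennreal (exp (a j * real x)) * pois \<omega> (B j) x) = ennreal (exp (L \<omega> (B j) * (exp (a j) - 1)))"
      unfolding pois_def by (rule exp_poisson_suminf[OF L_nonneg])
    finally show "(\<Sum>x. ennreal (exp (a j * real x)) * (indicator E \<omega> * ?r j \<omega> * (\<Prod>i\<in>{j..<k}. pois \<omega> (B i) ((c(j := x)) i))))
      = indicator E \<omega> * ?r (Suc j) \<omega> * (\<Prod>i\<in>{Suc j..<k}. pois \<omega> (B i) (c i))" by (simp add: mult_ac)
  qed
  finally show ?case .
qed

lemma exp_psum_simple:
  assumes f: "simple_function borel f" "bdd_borel c f" and E: "E \<in> sets F"
  shows "(\<integral>\<^sup>+\<omega>. indicator E \<omega> * ennreal (exp (psum (X \<omega>) t f)) \<partial>M)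
    = (\<integral>\<^sup>+\<omega>. indicator E \<omega> * ennreal (exp (\<integral>s. l \<omega> s * (exp (f s) - 1) \<partial>lborel)) \<partial>M)"
proof -
  have fin: "finite (range f)" using f(1) by (simp add: simple_function_def)
  then obtain e where e: "bij_betw e {0..<card (range f)} (range f)" using ex_bij_betw_nat_finite by blast
  define k where "k = card (range f)"
  define B where "B i = f -` {e i} \<inter> {0<..t}" for i
  have e': "bij_betw e {..<k} (range f)" using e by (simp add: k_def atLeast0LessThan)
  note [measurable] = bdd_borelD(1)[OF f(2)]
  have B: "B i \<in> sets borel" "B i \<subseteq> {0<..t}" for i
    using measurable_sets_borel[of f borel "{e i}"] by (auto simp: B_def)
  have disj: "disjoint_family_on B {..<k}"
    using e' by (auto simp: disjoint_family_on_def B_def bij_betw_def inj_on_def)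
  have 1: "AE \<omega> in M. ennreal (exp (psum (X \<omega>) t f)) = (\<Prod>i<k. ennreal (exp (e i * enn2real (pcount (X \<omega>) (B i)))))"
    using AE_finite
  proof eventually_elim
    case (elim \<omega>)
    have "psum (X \<omega>) t f = (\<Sum>i<k. e i * enn2real (pcount (X \<omega>) (B i)))"
      unfolding psum_simple[OF elim fin order_refl] B_def
      by (rule sum.reindex_bij_betw[OF e', symmetric])
    then show ?case by (simp add: exp_sum prod_ennreal)
  qed
  have 2: "ennreal (exp (\<integral>s. l \<omega> s * (exp (f s) - 1) \<partial>lborel)) = (\<Prod>i<k. ennreal (exp (L \<omega> (B i) * (exp (e i) - 1))))" for \<omega>
  proof -
    have "l \<omega> s * (exp (f s) - 1) = (\<Sum>i<k. l \<omega> s * indicator (B i) s * (exp (e i) - 1))" for s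
    proof (cases "s \<in> {0<..t}")
      case True
      have "f s \<in> e ` {..<k}" using e' by (simp add: bij_betw_def)
      then obtain i where i: "i < k" "f s = e i" by auto
      have "s \<in> B j \<longleftrightarrow> j = i" if "j < k" for j
        using True i that e' by (auto simp: B_def bij_betw_def inj_on_def)
      then have "(\<Sum>j<k. l \<omega> s * indicator (B j) s * (exp (e j) - 1)) = (\<Sum>j<k. if j = i then l \<omega> s * (exp (e i) - 1) else 0)"
        by (intro sum.cong) (auto simp: indicator_def)
      then show ?thesis using i by simp
    qed (simp add: l_supp)
    then have "(\<integral>s. l \<omega> s * (exp (f s) - 1) \<partial>lborel) = (\<Sum>i<k. L \<omega> (B i) * (exp (e i) - 1))"
      unfolding L_def by (simp add: Bochner_Integration.integral_sum integrable_mult_left l_mult_int[OF indicator_bdd_borel[OF B(1)]])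
    then show ?thesis by (simp add: exp_sum prod_ennreal)
  qed
  \<comment> \<open>The case j = k of \<open>exp_counts\<close>: no count is pinned any more, and
    the condition over the empty index range always holds.\<close>
  have "(\<integral>\<^sup>+\<omega>. indicator E \<omega> * ennreal (exp (psum (X \<omega>) t f)) \<partial>M)
    = (\<integral>\<^sup>+\<omega>. indicator E \<omega> * (\<Prod>i<k. ennreal (exp (e i * enn2real (pcount (X \<omega>) (B i)))))
        * indicator {\<omega>\<in>space M. \<forall>i\<in>{k..<k}. pcount (X \<omega>) (B i) = of_nat 0} \<omega> \<partial>M)"
    using 1 AE_space by (intro nn_integral_cong_AE) (auto elim!: eventually_elim2)
  also have "\<dots> = (\<integral>\<^sup>+\<omega>. indicator E \<omega> * (\<Prod>i<k. ennreal (exp (L \<omega> (B i) * (exp (e i) - 1)))) * (\<Prod>i\<in>{k..<k}. pois \<omega> (B i) 0) \<partial>M)"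
    by (rule exp_counts[OF E B disj order_refl, where c = "\<lambda>_. 0"])
  finally show ?thesis by (simp add: 2)
qed

text \<open>With simple approximations from below both sides increase, so monotone convergence
  applies before either side is known to be finite. The integral inside the exponent has no sign and
  is handled by dominated convergence, using that \<open>l\<close> is integrable.\<close>

lemma exp_psum:
  assumes f: "bdd_borel c f" and y: "y \<in> borel_measurable F" "\<And>\<omega>. 0 \<le> y \<omega>"
  shows "(\<integral>\<^sup>+\<omega>. ennreal (y \<omega> * exp (psum (X \<omega>) t f)) \<partial>M)
    = (\<integral>\<^sup>+\<omega>. ennreal (y \<omega> * exp (\<integral>s. l \<omega> s * (exp (f s) - 1) \<partial>lborel)) \<partial>M)"
proof -
  from simple_approximation[OF f] obtain S where S: "\<And>i. simple_function borel (S i)" "\<And>i x. S i x \<le> S (Suc i) x"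
    "\<And>i. bdd_borel c (S i)" "\<And>x. (\<lambda>i. S i x) \<longlonglongrightarrow> f x" by metis
  have y' [measurable]: "y \<in> borel_measurable M"
    using sub y(1) by (intro measurable_from_subalg[of M F]) (auto simp: subalgebra_def)
  have pm: "(\<lambda>\<omega>. psum (X \<omega>) t h) \<in> borel_measurable M" if "bdd_borel c h" for h
    by (rule psum_measurable[OF pc that])
  have lm: "(\<lambda>\<omega>. \<integral>s. l \<omega> s * (exp (h s) - 1) \<partial>lborel) \<in> borel_measurable M" if "bdd_borel c h" for h
    by (rule l_meas[OF bdd_borel_exp_diff[OF that]])
  have eq: "(\<integral>\<^sup>+\<omega>. ennreal (y \<omega> * exp (psum (X \<omega>) t (S i))) \<partial>M)
    = (\<integral>\<^sup>+\<omega>. ennreal (y \<omega> * exp (\<integral>s. l \<omega> s * (exp (S i s) - 1) \<partial>lborel)) \<partial>M)" for i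
  proof -
    note [measurable] = pm[OF S(3)[of i]] lm[OF S(3)[of i]]
    have "(\<integral>\<^sup>+\<omega>. ennreal (y \<omega>) * ennreal (exp (psum (X \<omega>) t (S i))) \<partial>M)
      = (\<integral>\<^sup>+\<omega>. ennreal (y \<omega>) * ennreal (exp (\<integral>s. l \<omega> s * (exp (S i s) - 1) \<partial>lborel)) \<partial>M)"
    proof (rule nn_integral_eq_subalgebra[OF sub _ _ exp_psum_simple[OF S(1,3)]])
      show "(\<lambda>\<omega>. ennreal (y \<omega>)) \<in> borel_measurable F" using y(1) by measurable
    qed measurable
    then show ?thesis using y(2) by (simp add: ennreal_mult)
  qed
  have "(\<lambda>i. \<integral>\<^sup>+\<omega>. ennreal (y \<omega> * exp (psum (X \<omega>) t (S i))) \<partial>M) \<longlonglongrightarrow> (\<integral>\<^sup>+\<omega>. ennreal (y \<omega> * exp (psum (X \<omega>) t f)) \<partial>M)"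
  proof (rule nn_integral_LIMSEQ)
    show "incseq (\<lambda>i \<omega>. ennreal (y \<omega> * exp (psum (X \<omega>) t (S i))))"
      using S(2) y(2) by (intro incseq_SucI le_funI ennreal_leI mult_left_mono) (auto simp: psum_def intro: sum_mono)
    show "(\<lambda>i. ennreal (y \<omega> * exp (psum (X \<omega>) t (S i)))) \<longlonglongrightarrow> ennreal (y \<omega> * exp (psum (X \<omega>) t f))" for \<omega>
      unfolding psum_def by (intro tendsto_ennrealI tendsto_intros S)
    show "(\<lambda>\<omega>. ennreal (y \<omega> * exp (psum (X \<omega>) t (S i)))) \<in> borel_measurable M" for i
      using pm[OF S(3)] by (intro measurable_compose[OF _ measurable_ennreal] borel_measurable_times y'
          measurable_compose[OF _ borel_measurable_exp])
  qed
  moreover have "(\<lambda>i. \<integral>\<^sup>+\<omega>. ennreal (y \<omega> * exp (\<integral>s. l \<omega> s * (exp (S i s) - 1) \<partial>lborel)) \<partial>M)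
    \<longlonglongrightarrow> (\<integral>\<^sup>+\<omega>. ennreal (y \<omega> * exp (\<integral>s. l \<omega> s * (exp (f s) - 1) \<partial>lborel)) \<partial>M)"
  proof (rule nn_integral_LIMSEQ)
    show "incseq (\<lambda>i \<omega>. ennreal (y \<omega> * exp (\<integral>s. l \<omega> s * (exp (S i s) - 1) \<partial>lborel)))"
      using S(2) y(2) l_nonneg
      by (intro incseq_SucI le_funI ennreal_leI mult_left_mono exp_le_cancel_iff[THEN iffD2] integral_mono
          l_mult_int[OF bdd_borel_exp_diff[OF S(3)]]) auto
    show "(\<lambda>i. ennreal (y \<omega> * exp (\<integral>s. l \<omega> s * (exp (S i s) - 1) \<partial>lborel)))
      \<longlonglongrightarrow> ennreal (y \<omega> * exp (\<integral>s. l \<omega> s * (exp (f s) - 1) \<partial>lborel))" for \<omega>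
    proof (intro tendsto_ennrealI tendsto_mult tendsto_const tendsto_exp)
      note [measurable] = borel_measurable_integrable[OF l_int] bdd_borelD(1)[OF f] bdd_borelD(1)[OF S(3)]
      show "(\<lambda>i. \<integral>s. l \<omega> s * (exp (S i s) - 1) \<partial>lborel) \<longlonglongrightarrow> (\<integral>s. l \<omega> s * (exp (f s) - 1) \<partial>lborel)"
      proof (rule integral_dominated_convergence[where w = "\<lambda>s. (exp c + 1) * l \<omega> s"])
        show "integrable lborel (\<lambda>s. (exp c + 1) * l \<omega> s)" using l_int by simp
        show "AE s in lborel. (\<lambda>i. l \<omega> s * (exp (S i s) - 1)) \<longlonglongrightarrow> l \<omega> s * (exp (f s) - 1)"
          by (intro AE_I2 tendsto_intros S)
        show "AE s in lborel. norm (l \<omega> s * (exp (S i s) - 1)) \<le> (exp c + 1) * l \<omega> s" for i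
        proof (intro AE_I2)
          fix s
          show "norm (l \<omega> s * (exp (S i s) - 1)) \<le> (exp c + 1) * l \<omega> s"
            using mult_left_mono[OF bdd_borelD(2)[OF bdd_borel_exp_diff[OF S(3)[of i]], of s] l_nonneg[of \<omega> s]] l_nonneg[of \<omega> s]
            by (simp add: abs_mult mult.commute)
        qed
      qed measurable
    qed
    show "(\<lambda>\<omega>. ennreal (y \<omega> * exp (\<integral>s. l \<omega> s * (exp (S i s) - 1) \<partial>lborel))) \<in> borel_measurable M" for i
      using lm[OF S(3)] by (intro measurable_compose[OF _ measurable_ennreal] borel_measurable_times y'
          measurable_compose[OF _ borel_measurable_exp])
  qed
  ultimately show ?thesis unfolding eq by (rule LIMSEQ_unique)
qed

end

section \<open>Exponential moments of the Hawkes process\<close>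

locale hawkes_process = kernels g \<rho> + prob_space M for g \<rho> and M :: "'a measure" +
  fixes Nn :: "nat \<Rightarrow> 'a \<Rightarrow> real set"
  assumes hawkes: "hawkes M g Nn"
begin

section \<open>Generations as conditionally Poisson configurations\<close>

lemma pcount_meas: "B \<in> sets borel \<Longrightarrow> (\<lambda>\<omega>. pcount (Nn n \<omega>) B) \<in> borel_measurable M"
  using hawkes by (simp add: hawkes_def)

definition gen :: "nat \<Rightarrow> 'a measure" where
  "gen n = sigma (space M) {{\<omega>\<in>space M. pcount (Nn j \<omega>) B = c} | j B c. j \<le> n \<and> B \<in> sets borel}"

lemma space_gen: "space (gen n) = space M"
  by (simp add: gen_def space_measure_of_conv)

lemma sets_gen: "sets (gen n) = gen_sigma M Nn n"
  unfolding gen_def gen_sigma_def by (rule sets_measure_of) auto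

lemma sets_gen_subset: "sets (gen n) \<subseteq> sets M"
  unfolding sets_gen gen_sigma_def
  by (rule sets.sigma_sets_subset) (auto intro!: borel_measurable_eq pcount_meas)

text \<open>The generating events only fix the value of a count. As counts take countably many
  values, every preimage is a countable union of such events.\<close>

lemma pcount_gen_meas:
  assumes "j \<le> n" "B \<in> sets borel"
  shows "(\<lambda>\<omega>. pcount (Nn j \<omega>) B) \<in> borel_measurable (gen n)"
proof (rule measurableI)
  fix A :: "ennreal set"
  let ?C = "insert \<infinity> (range of_nat) :: ennreal set"
  have "pcount (Nn j \<omega>) B \<in> ?C" for \<omega> by (simp add: pcount_def)
  then have "(\<lambda>\<omega>. pcount (Nn j \<omega>) B) -` A \<inter> space (gen n) = (\<Union>c\<in>A \<inter> ?C. {\<omega>\<in>space M. pcount (Nn j \<omega>) B = c})"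
    by (auto simp: space_gen)
  also have "\<dots> \<in> sets (gen n)"
  proof (rule sets.countable_UN')
    show "countable (A \<inter> ?C)" by (intro countable_Int2) auto
    show "(\<lambda>c. {\<omega>\<in>space M. pcount (Nn j \<omega>) B = c}) ` (A \<inter> ?C) \<subseteq> sets (gen n)"
      unfolding sets_gen gen_sigma_def using assms by (auto intro!: sigma_sets.Basic)
  qed
  finally show "(\<lambda>\<omega>. pcount (Nn j \<omega>) B) -` A \<inter> space (gen n) \<in> sets (gen n)" .
qed simp

lemma integral_base:
  assumes "bdd_borel c h"
  shows "(\<integral>s. (indicator {0<..t} s * g 0 s) * h s \<partial>lborel) = conv (g 0) (\<lambda>u. h (t - u)) t"
proof -
  note [measurable] = bdd_borelD(1)[OF assms]
  show ?thesis unfolding conv_def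
  proof (rule integral_cong_AE)
    show "AE s in lborel. indicator {0<..t} s * g 0 s * h s = indicator {0..t} s * g 0 s * h (t - (t - s))"
      using AE_lborel_singleton[of 0] by eventually_elim (auto simp: indicator_def)
  qed measurable
qed

text \<open>Generation 0 is specified for the full space only. The framework conditions on a
  sigma-algebra, so the trivial one is used; for its empty event both sides vanish.\<close>

lemma conditional_poisson_base:
  "conditional_poisson M (sigma (space M) {}) (Nn 0) (\<lambda>\<omega> s. ennreal (g 0 s)) t (\<lambda>\<omega> s. indicator {0<..t} s * g 0 s)"
proof
  show "space (sigma (space M) {}) = space M" by (simp add: space_measure_of_conv)
  have s: "sets (sigma (space M) {}) = {{}, space M}" by (simp add: sigma_sets_empty_eq)
  show "sets (sigma (space M) {}) \<subseteq> events" unfolding s by auto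
  have cp: "cond_poisson M {space M} (Nn 0) (\<lambda>\<omega> t. ennreal (g 0 t))" using hawkes by (simp add: hawkes_def)
  show "cond_poisson M (sets (sigma (space M) {})) (Nn 0) (\<lambda>\<omega> s. ennreal (g 0 s))"
    unfolding s cond_poisson_def
  proof (rule ballI)
    fix E assume "E \<in> {{}, space M}"
    then consider "E = {}" | "E \<in> {space M}" by auto
    then show "\<forall>k (B :: nat \<Rightarrow> real set) c. (\<forall>i<k. B i \<in> sets borel \<and> (\<exists>T. B i \<subseteq> {0<..T})) \<longrightarrow>
        disjoint_family_on B {..<k} \<longrightarrow>
        emeasure M (E \<inter> {\<omega>\<in>space M. \<forall>i<k. pcount (Nn 0 \<omega>) (B i) = of_nat (c i)})
        = (\<integral>\<^sup>+\<omega>. indicator E \<omega> * (\<Prod>i<k. poisson_prob (\<integral>\<^sup>+t. ennreal (g 0 t) * indicator (B i) t \<partial>lborel) (c i)) \<partial>M)"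
    proof cases
      case 1
      show ?thesis by (intro allI impI) (simp only: 1 Int_empty_left emeasure_empty indicator_def empty_iff of_bool_eq mult_zero_left nn_integral_const)
    next
      case 2
      show ?thesis by (rule bspec[OF cp[unfolded cond_poisson_def] 2])
    qed
  qed
  show "integrable lborel (\<lambda>s. indicator {0<..t} s * g 0 s)" for t
  proof (rule Bochner_Integration.integrable_bound[OF g0_loc[of t]])
    show "AE s in lborel. norm (indicator {0<..t} s * g 0 s) \<le> norm (indicator {0..t} s * g 0 s :: real)"
      by (auto simp: indicator_def)
  qed measurable
  show "AE \<omega> in M. \<forall>B\<in>sets borel. B \<subseteq> {0<..t} \<longrightarrow> (\<integral>\<^sup>+s. ennreal (g 0 s) * indicator B s \<partial>lborel)
    = (\<integral>\<^sup>+s. ennreal (indicator {0<..t} s * g 0 s) * indicator B s \<partial>lborel)"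
    by (intro AE_I2 ballI impI nn_integral_cong) (auto simp: indicator_def)
qed (auto simp: pcount_meas g_nonneg)

text \<open>The parents range over (0, t] for every \<open>s\<close>, later ones contributing 0, so
  the index set does not move and sum and integral can be exchanged. An infinite parent set gives
  the harmless value 0.\<close>

definition lam_real :: "nat \<Rightarrow> real \<Rightarrow> 'a \<Rightarrow> real \<Rightarrow> real" where
  "lam_real n t \<omega> s = (\<Sum>\<tau>\<in>Nn n \<omega> \<inter> {0<..t}. if \<tau> < s \<and> s \<le> t then g (Suc n) (s - \<tau>) else 0)"

lemma shifted_integrable: "integrable lborel (\<lambda>s. if \<tau> < s \<and> s \<le> t then g (Suc n) (s - \<tau>) else 0)"
proof (rule Bochner_Integration.integrable_bound)
  show "integrable lborel (\<lambda>s. g (Suc n) (- \<tau> + 1 * s))"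
    by (rule lborel_integrable_real_affine[OF g_int]) simp
  show "AE s in lborel. norm (if \<tau> < s \<and> s \<le> t then g (Suc n) (s - \<tau>) else 0) \<le> norm (g (Suc n) (- \<tau> + 1 * s))"
    by (auto simp: add.commute)
qed measurable

text \<open>The substitution s = \<tau> + v turns calendar time into the remaining time of the
  parent, t - s = (t - \<tau>) - v. The two integrands can differ only at v = 0, a null set.\<close>

lemma integral_shifted:
  assumes "bdd_borel c h"
  shows "integrable lborel (\<lambda>s. (if \<tau> < s \<and> s \<le> t then g (Suc n) (s - \<tau>) else 0) * h s)"
    "(\<integral>s. (if \<tau> < s \<and> s \<le> t then g (Suc n) (s - \<tau>) else 0) * h s \<partial>lborel)
      = conv (g (Suc n)) (\<lambda>u. h (t - u)) (t - \<tau>)"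
proof -
  note [measurable] = bdd_borelD(1)[OF assms]
  let ?k = "\<lambda>s. if \<tau> < s \<and> s \<le> t then g (Suc n) (s - \<tau>) else 0"
  show "integrable lborel (\<lambda>s. ?k s * h s)"
  proof (rule Bochner_Integration.integrable_bound)
    show "integrable lborel (\<lambda>s. c * ?k s)" by (rule integrable_mult_right[OF shifted_integrable])
    show "AE s in lborel. norm (?k s * h s) \<le> norm (c * ?k s)"
    proof (intro AE_I2)
      fix s
      have "?k s * \<bar>h s\<bar> \<le> ?k s * c" by (intro mult_left_mono bdd_borelD(2)[OF assms]) (simp add: g_nonneg)
      also have "\<dots> \<le> \<bar>c * ?k s\<bar>" by (simp add: mult.commute)
      finally show "norm (?k s * h s) \<le> norm (c * ?k s)" by (simp add: abs_mult g_nonneg)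
    qed
  qed measurable
  have "(\<integral>s. ?k s * h s \<partial>lborel) = (\<integral>v. ?k (\<tau> + 1 * v) * h (\<tau> + 1 * v) \<partial>lborel)"
    using lborel_integral_real_affine[of 1 "\<lambda>s. ?k s * h s" \<tau>] by simp
  also have "\<dots> = conv (g (Suc n)) (\<lambda>u. h (t - u)) (t - \<tau>)"
    unfolding conv_def
  proof (rule integral_cong_AE)
    show "AE v in lborel. ?k (\<tau> + 1 * v) * h (\<tau> + 1 * v)
      = indicator {0..t - \<tau>} v * g (Suc n) v * h (t - (t - \<tau> - v))"
      using AE_lborel_singleton[of 0] by eventually_elim (auto simp: indicator_def algebra_simps)
  qed measurable
  finally show "(\<integral>s. ?k s * h s \<partial>lborel) = conv (g (Suc n)) (\<lambda>u. h (t - u)) (t - \<tau>)" .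
qed

lemma integral_lam_real:
  assumes h: "bdd_borel c h"
  shows "(\<integral>s. lam_real n t \<omega> s * h s \<partial>lborel) = psum (Nn n \<omega>) t (\<lambda>\<tau>. conv (g (Suc n)) (\<lambda>u. h (t - u)) (t - \<tau>))"
  unfolding lam_real_def psum_def sum_distrib_right
  by (simp add: Bochner_Integration.integral_sum integral_shifted[OF h])

lemma conditional_poisson_step:
  assumes fin: "AE \<omega> in M. finite (Nn n \<omega> \<inter> {0<..t})"
  shows "conditional_poisson M (gen n) (Nn (Suc n)) (\<lambda>\<omega> s. \<Sum>\<^sub>\<infinity>\<tau>\<in>Nn n \<omega> \<inter> {0<..<s}. ennreal (g (Suc n) (s - \<tau>)))
    t (lam_real n t)"
proof
  show "space (gen n) = space M" "sets (gen n) \<subseteq> events" by (fact space_gen sets_gen_subset)+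
  show "cond_poisson M (sets (gen n)) (Nn (Suc n))
     (\<lambda>\<omega> s. \<Sum>\<^sub>\<infinity>\<tau>\<in>Nn n \<omega> \<inter> {0<..<s}. ennreal (g (Suc n) (s - \<tau>)))"
    unfolding sets_gen using hawkes by (simp add: hawkes_def)
  show "(\<lambda>\<omega>. pcount (Nn (Suc n) \<omega>) B) \<in> borel_measurable M" if "B \<in> sets borel" for B
    using that by (rule pcount_meas)
  show "0 \<le> lam_real n t \<omega> s" for \<omega> s
    unfolding lam_real_def by (intro sum_nonneg) (simp add: g_nonneg)
  show "lam_real n t \<omega> s = 0" if "s \<notin> {0<..t}" for \<omega> s
    unfolding lam_real_def using that by (intro sum.neutral) auto
  show "integrable lborel (lam_real n t \<omega>)" for \<omega>
    unfolding lam_real_def[abs_def] by (intro Bochner_Integration.integrable_sum shifted_integrable)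
  show "(\<lambda>\<omega>. \<integral>s. lam_real n t \<omega> s * h s \<partial>lborel) \<in> borel_measurable M" if h: "bdd_borel c h" for c h
  proof -
    have "bdd_borel c (\<lambda>u. h (t - u))" by (rule bdd_borel_compose[OF h]) measurable
    then have b: "bdd_borel (\<rho> * c) (\<lambda>\<tau>. conv (g (Suc n)) (\<lambda>u. h (t - u)) (t - \<tau>))"
      by (intro bdd_borel_compose[OF conv_contracts]) measurable
    show ?thesis unfolding integral_lam_real[OF h] by (intro psum_measurable[OF _ b] pcount_meas)
  qed
  show "AE \<omega> in M. \<forall>B\<in>sets borel. B \<subseteq> {0<..t} \<longrightarrow>
      (\<integral>\<^sup>+s. (\<Sum>\<^sub>\<infinity>\<tau>\<in>Nn n \<omega> \<inter> {0<..<s}. ennreal (g (Suc n) (s - \<tau>))) * indicator B s \<partial>lborel)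
      = (\<integral>\<^sup>+s. ennreal (lam_real n t \<omega> s) * indicator B s \<partial>lborel)"
    using fin
  proof (eventually_elim, intro ballI impI nn_integral_cong)
    fix \<omega> B and s :: real
    assume fin: "finite (Nn n \<omega> \<inter> {0<..t})" and B: "B \<subseteq> {0<..t}"
    show "(\<Sum>\<^sub>\<infinity>\<tau>\<in>Nn n \<omega> \<inter> {0<..<s}. ennreal (g (Suc n) (s - \<tau>))) * indicator B s
      = ennreal (lam_real n t \<omega> s) * indicator B s"
    proof (cases "s \<in> B")
      case True
      then have s: "0 < s" "s \<le> t" using B by auto
      have sub: "Nn n \<omega> \<inter> {0<..<s} \<subseteq> Nn n \<omega> \<inter> {0<..t}" using s by auto
      have "(\<Sum>\<^sub>\<infinity>\<tau>\<in>Nn n \<omega> \<inter> {0<..<s}. ennreal (g (Suc n) (s - \<tau>))) = (\<Sum>\<tau>\<in>Nn n \<omega> \<inter> {0<..<s}. ennreal (g (Suc n) (s - \<tau>)))"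
        by (rule infsum_finite[OF finite_subset[OF sub fin]])
      also have "\<dots> = ennreal (\<Sum>\<tau>\<in>Nn n \<omega> \<inter> {0<..<s}. g (Suc n) (s - \<tau>))"
        by (rule sum_ennreal) (rule g_nonneg)
      also have "(\<Sum>\<tau>\<in>Nn n \<omega> \<inter> {0<..<s}. g (Suc n) (s - \<tau>)) = lam_real n t \<omega> s"
        unfolding lam_real_def using s by (intro sum.mono_neutral_cong_left fin sub) auto
      finally show ?thesis by simp
    qed simp
  qed
qed

text \<open>Finitely many parents make the real-valued intensity valid, and its finite integral in
  turn makes the offspring finite.\<close>

lemma AE_finite_generation: "AE \<omega> in M. finite (Nn n \<omega> \<inter> {0<..t})"
proof (induction n)
  case 0
  interpret conditional_poisson M "sigma (space M) {}" "Nn 0" "\<lambda>\<omega> s. ennreal (g 0 s)" t "\<lambda>\<omega> s. indicator {0<..t} s * g 0 s"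
    by (rule conditional_poisson_base)
  show ?case by (rule AE_finite)
next
  case (Suc n)
  interpret conditional_poisson M "gen n" "Nn (Suc n)"
    "\<lambda>\<omega> s. \<Sum>\<^sub>\<infinity>\<tau>\<in>Nn n \<omega> \<inter> {0<..<s}. ennreal (g (Suc n) (s - \<tau>))" t "lam_real n t"
    by (rule conditional_poisson_step[OF Suc])
  show ?case by (rule AE_finite)
qed

section \<open>Exponential moments of partial and total counts\<close>

definition cnt :: "nat \<Rightarrow> real \<Rightarrow> 'a \<Rightarrow> real" where
  "cnt n t \<omega> = (\<Sum>j<n. psum (Nn j \<omega>) t (\<lambda>_. 1))"

lemma cnt_meas_gen: "cnt (Suc n) t \<in> borel_measurable (gen n)"
  unfolding cnt_def[abs_def] using bdd_borel_const[of 1]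
  by (intro borel_measurable_sum psum_measurable[OF pcount_gen_meas]) auto

lemma cnt_meas [measurable]: "cnt n t \<in> borel_measurable M"
  unfolding cnt_def[abs_def] using bdd_borel_const[of 1]
  by (intro borel_measurable_sum psum_measurable[OF pcount_meas]) auto

text \<open>\<open>cumulant \<theta> m n\<close> is the cumulant of \<open>\<theta>\<close> times the number of descendants, during the next
  \<open>m\<close> generations and within a given remaining time, of a point of generation \<open>n\<close>.\<close>
lemma exp_moment_generations:
  assumes \<theta>: "\<bar>\<theta>\<bar> \<le> \<theta>0"
  shows "(\<integral>\<^sup>+\<omega>. ennreal (exp (\<theta> * cnt n t \<omega>) * exp (psum (Nn n \<omega>) t (\<lambda>\<tau>. cumulant \<theta> m n (t - \<tau>)))) \<partial>M)
    = ennreal (exp (conv (g 0) (\<lambda>w. exp (cumulant \<theta> (n + m) 0 w) - 1) t))"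
proof (induction n arbitrary: m)
  case 0
  interpret conditional_poisson M "sigma (space M) {}" "Nn 0" "\<lambda>\<omega> s. ennreal (g 0 s)" t "\<lambda>\<omega> s. indicator {0<..t} s * g 0 s"
    by (rule conditional_poisson_base)
  have f: "bdd_borel (\<kappa> * \<bar>\<theta>\<bar>) (\<lambda>\<tau>. cumulant \<theta> m 0 (t - \<tau>))"
    by (rule bdd_borel_compose[OF cumulant_bounded[OF \<theta>]]) measurable
  have "(\<integral>s. indicator {0<..t} s * g 0 s * (exp (cumulant \<theta> m 0 (t - s)) - 1) \<partial>lborel)
    = conv (g 0) (\<lambda>w. exp (cumulant \<theta> m 0 w) - 1) t"
    using integral_base[OF bdd_borel_exp_diff[OF f], of t] by simp
  then show ?case using exp_psum[OF f, of "\<lambda>_. 1"] by (simp add: cnt_def emeasure_space_1)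
next
  case (Suc n)
  interpret conditional_poisson M "gen n" "Nn (Suc n)"
    "\<lambda>\<omega> s. \<Sum>\<^sub>\<infinity>\<tau>\<in>Nn n \<omega> \<inter> {0<..<s}. ennreal (g (Suc n) (s - \<tau>))" t "lam_real n t"
    by (rule conditional_poisson_step[OF AE_finite_generation])
  have f: "bdd_borel (\<kappa> * \<bar>\<theta>\<bar>) (\<lambda>\<tau>. cumulant \<theta> m (Suc n) (t - \<tau>))"
    by (rule bdd_borel_compose[OF cumulant_bounded[OF \<theta>]]) measurable
  have y: "(\<lambda>\<omega>. exp (\<theta> * cnt (Suc n) t \<omega>)) \<in> borel_measurable (gen n)"
    using cnt_meas_gen by measurable
  \<comment> \<open>Integrating out generation n + 1 yields the convolution in
    \<open>cumulant \<theta> (Suc m) n\<close>; its summand \<theta> comes from the points of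
    generation \<open>n\<close> counted in \<open>cnt (Suc n)\<close>. So \<open>n\<close> is traded
    for \<open>m\<close> with n + m fixed.\<close>
  have eq: "exp (\<theta> * cnt (Suc n) t \<omega>) * exp (\<integral>s. lam_real n t \<omega> s * (exp (cumulant \<theta> m (Suc n) (t - s)) - 1) \<partial>lborel)
    = exp (\<theta> * cnt n t \<omega>) * exp (psum (Nn n \<omega>) t (\<lambda>\<tau>. cumulant \<theta> (Suc m) n (t - \<tau>)))" for \<omega>
  proof -
    have "(\<integral>s. lam_real n t \<omega> s * (exp (cumulant \<theta> m (Suc n) (t - s)) - 1) \<partial>lborel)
      = psum (Nn n \<omega>) t (\<lambda>\<tau>. conv (g (Suc n)) (\<lambda>w. exp (cumulant \<theta> m (Suc n) w) - 1) (t - \<tau>))"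
      using integral_lam_real[OF bdd_borel_exp_diff[OF f], of n t \<omega>] by simp
    then have "\<theta> * cnt (Suc n) t \<omega> + (\<integral>s. lam_real n t \<omega> s * (exp (cumulant \<theta> m (Suc n) (t - s)) - 1) \<partial>lborel)
      = \<theta> * cnt n t \<omega> + psum (Nn n \<omega>) t (\<lambda>\<tau>. cumulant \<theta> (Suc m) n (t - \<tau>))"
      by (simp add: cnt_def psum_def sum.distrib sum_distrib_left distrib_left)
    then show ?thesis by (simp only: exp_add[symmetric])
  qed
  show ?case using exp_psum[OF f y] Suc.IH[of "Suc m"] unfolding eq by simp
qed

text \<open>The case m = 0: generation \<open>n\<close> enters with the constant \<theta>, which is
  its own share of the count. Since \<open>cnt n\<close> covers generations 0 to n - 1, the count
  has \<open>Suc n\<close> where the cumulant has \<open>n\<close>.\<close>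

lemma exp_moment_cnt:
  assumes \<theta>: "\<bar>\<theta>\<bar> \<le> \<theta>0"
  shows "(\<integral>\<^sup>+\<omega>. ennreal (exp (\<theta> * cnt (Suc n) t \<omega>)) \<partial>M)
    = ennreal (exp (conv (g 0) (\<lambda>w. exp (cumulant \<theta> n 0 w) - 1) t))"
proof -
  have "exp (\<theta> * cnt n t \<omega>) * exp (psum (Nn n \<omega>) t (\<lambda>\<tau>. cumulant \<theta> 0 n (t - \<tau>))) = exp (\<theta> * cnt (Suc n) t \<omega>)" for \<omega>
    by (simp add: cnt_def psum_def distrib_left sum_distrib_left mult.commute flip: exp_add)
  then show ?thesis using exp_moment_generations[OF \<theta>, of n t 0] by simp
qed

definition NR :: "real \<Rightarrow> 'a \<Rightarrow> real" where "NR t \<omega> = enn2real (Ncount Nn t \<omega>)"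

lemma Ncount_meas: "Ncount Nn t \<in> borel_measurable M"
  unfolding Ncount_def[abs_def] by (intro borel_measurable_suminf_order pcount_meas) auto

lemma NR_meas [measurable]: "NR t \<in> borel_measurable M"
  unfolding NR_def[abs_def] by (intro measurable_compose[OF Ncount_meas]) auto

lemma exp_moment_cnt_le:
  assumes \<theta>: "\<bar>\<theta>\<bar> \<le> \<theta>0"
  obtains K :: real where "\<And>n. (\<integral>\<^sup>+\<omega>. ennreal (exp (\<theta> * cnt (Suc n) t \<omega>)) \<partial>M) \<le> ennreal K"
proof -
  let ?K = "(\<kappa> * \<bar>\<theta>\<bar> + 2 * (\<kappa> * \<bar>\<theta>\<bar>)\<^sup>2) * conv (g 0) (\<lambda>_. 1) t"
  have "conv (g 0) (\<lambda>w. exp (cumulant \<theta> n 0 w) - 1) t \<le> ?K" for n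
    using conv_bound[OF loc_kernel_g cumulant_exp_bounded[OF \<theta>, of n 0], of 0 t] by linarith
  then have "\<And>n. (\<integral>\<^sup>+\<omega>. ennreal (exp (\<theta> * cnt (Suc n) t \<omega>)) \<partial>M) \<le> ennreal (exp ?K)"
    unfolding exp_moment_cnt[OF \<theta>] by (intro ennreal_leI) simp
  then show thesis by (rule that)
qed

lemma cnt_eq_pcount:
  assumes "\<And>n. finite (Nn n \<omega> \<inter> {0<..t})"
  shows "ennreal (cnt n t \<omega>) = (\<Sum>j<n. pcount (Nn j \<omega>) {0<..t})"
  unfolding cnt_def psum_def using assms
  by (simp add: pcount_finite ennreal_of_nat_eq_real_of_nat sum_ennreal)

text \<open>From x \<le> exp (\<theta>0 x)/\<theta>0 and exponential moments bounded uniformly in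
  the number of generations, monotone convergence gives a finite mean for the total count.\<close>

lemma AE_Ncount:
  "AE \<omega> in M. Ncount Nn t \<omega> \<noteq> \<infinity> \<and> (\<lambda>n. cnt n t \<omega>) \<longlonglongrightarrow> NR t \<omega> \<and> (\<forall>n. 0 \<le> cnt n t \<omega> \<and> cnt n t \<omega> \<le> NR t \<omega>)"
proof -
  have fin: "AE \<omega> in M. \<forall>n. finite (Nn n \<omega> \<inter> {0<..t})"
    unfolding AE_all_countable by (intro allI AE_finite_generation)
  obtain K :: real where K: "\<And>n. (\<integral>\<^sup>+\<omega>. ennreal (exp (\<theta>0 * cnt (Suc n) t \<omega>)) \<partial>M) \<le> ennreal K"
    using exp_moment_cnt_le[of \<theta>0 t] \<theta>0 by auto
  have le: "(\<integral>\<^sup>+\<omega>. (\<Sum>j<Suc n. pcount (Nn j \<omega>) {0<..t}) \<partial>M) \<le> ennreal (1 / \<theta>0) * ennreal K" for n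
  proof -
    have "(\<integral>\<^sup>+\<omega>. (\<Sum>j<Suc n. pcount (Nn j \<omega>) {0<..t}) \<partial>M) \<le> (\<integral>\<^sup>+\<omega>. ennreal (1 / \<theta>0) * ennreal (exp (\<theta>0 * cnt (Suc n) t \<omega>)) \<partial>M)"
    proof (rule nn_integral_mono_AE)
      show "AE \<omega> in M. (\<Sum>j<Suc n. pcount (Nn j \<omega>) {0<..t}) \<le> ennreal (1 / \<theta>0) * ennreal (exp (\<theta>0 * cnt (Suc n) t \<omega>))"
        using fin
      proof eventually_elim
        case (elim \<omega>)
        have "\<theta>0 * cnt (Suc n) t \<omega> \<le> exp (\<theta>0 * cnt (Suc n) t \<omega>)"
          using exp_ge_add_one_self[of "\<theta>0 * cnt (Suc n) t \<omega>"] by linarith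
        then have "cnt (Suc n) t \<omega> \<le> 1 / \<theta>0 * exp (\<theta>0 * cnt (Suc n) t \<omega>)"
          using \<theta>0 by (simp add: field_simps)
        then have "ennreal (cnt (Suc n) t \<omega>) \<le> ennreal (1 / \<theta>0) * ennreal (exp (\<theta>0 * cnt (Suc n) t \<omega>))"
          using \<theta>0 by (subst ennreal_mult[symmetric]) (auto intro: ennreal_leI)
        then show ?case by (simp only: cnt_eq_pcount[OF elim[rule_format]])
      qed
    qed
    also have "\<dots> = ennreal (1 / \<theta>0) * (\<integral>\<^sup>+\<omega>. ennreal (exp (\<theta>0 * cnt (Suc n) t \<omega>)) \<partial>M)"
      by (rule nn_integral_cmult) measurable
    also have "\<dots> \<le> ennreal (1 / \<theta>0) * ennreal K" by (intro mult_left_mono K) simp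
    finally show ?thesis .
  qed
  have "(\<lambda>n. \<integral>\<^sup>+\<omega>. (\<Sum>j<n. pcount (Nn j \<omega>) {0<..t}) \<partial>M) \<longlonglongrightarrow> (\<integral>\<^sup>+\<omega>. Ncount Nn t \<omega> \<partial>M)"
  proof (rule nn_integral_LIMSEQ)
    show "incseq (\<lambda>n \<omega>. \<Sum>j<n. pcount (Nn j \<omega>) {0<..t})"
      by (intro incseq_SucI le_funI) simp
    show "(\<lambda>n. \<Sum>j<n. pcount (Nn j \<omega>) {0<..t}) \<longlonglongrightarrow> Ncount Nn t \<omega>" for \<omega>
      unfolding Ncount_def by (rule summable_LIMSEQ) (rule summableI)
  qed (auto intro!: borel_measurable_sum pcount_meas)
  then have "(\<integral>\<^sup>+\<omega>. Ncount Nn t \<omega> \<partial>M) \<le> ennreal (1 / \<theta>0) * ennreal K"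
    using le by (intro LIMSEQ_le_const2[OF LIMSEQ_Suc]) auto
  also have "\<dots> < \<infinity>" by (simp add: ennreal_mult_less_top)
  finally have "AE \<omega> in M. Ncount Nn t \<omega> \<noteq> \<infinity>"
    using Ncount_meas by (intro nn_integral_PInf_AE) auto
  with fin show ?thesis
  proof eventually_elim
    case (elim \<omega>)
    have eq: "ennreal (NR t \<omega>) = Ncount Nn t \<omega>"
      using elim(2) by (simp add: NR_def less_top)
    have c0: "0 \<le> cnt n t \<omega>" for n by (simp add: cnt_def psum_def sum_nonneg)
    have lim: "(\<lambda>n. ennreal (cnt n t \<omega>)) \<longlonglongrightarrow> ennreal (NR t \<omega>)"
      unfolding eq cnt_eq_pcount[OF elim(1)[rule_format]] Ncount_def by (rule summable_LIMSEQ) (rule summableI)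
    have "incseq (\<lambda>n. cnt n t \<omega>)" by (rule incseq_SucI) (simp add: cnt_def psum_def sum_nonneg)
    moreover from lim have "(\<lambda>n. cnt n t \<omega>) \<longlonglongrightarrow> NR t \<omega>"
      by (rule tendsto_ennrealD) (auto simp: c0 NR_def)
    ultimately show ?case using incseq_le[of "\<lambda>n. cnt n t \<omega>"] elim(2) c0 by blast
  qed
qed

text \<open>Fatou along the generations. The absolute value makes this an integrable majorant for
  either sign of the parameter.\<close>

lemma exp_NR_integrable:
  assumes \<theta>: "\<bar>\<theta>\<bar> \<le> \<theta>0"
  shows "integrable M (\<lambda>\<omega>. exp (\<bar>\<theta>\<bar> * NR t \<omega>))"
proof (rule integrableI_nonneg)
  obtain K :: real where K: "\<And>n. (\<integral>\<^sup>+\<omega>. ennreal (exp (\<bar>\<theta>\<bar> * cnt (Suc n) t \<omega>)) \<partial>M) \<le> ennreal K"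
    using exp_moment_cnt_le[of "\<bar>\<theta>\<bar>" t] \<theta> by auto
  have "(\<integral>\<^sup>+\<omega>. ennreal (exp (\<bar>\<theta>\<bar> * NR t \<omega>)) \<partial>M) = (\<integral>\<^sup>+\<omega>. liminf (\<lambda>n. ennreal (exp (\<bar>\<theta>\<bar> * cnt (Suc n) t \<omega>))) \<partial>M)"
  proof (rule nn_integral_cong_AE)
    show "AE \<omega> in M. ennreal (exp (\<bar>\<theta>\<bar> * NR t \<omega>)) = liminf (\<lambda>n. ennreal (exp (\<bar>\<theta>\<bar> * cnt (Suc n) t \<omega>)))"
      using AE_Ncount[of t]
    proof eventually_elim
      case (elim \<omega>)
      then have "(\<lambda>n. ennreal (exp (\<bar>\<theta>\<bar> * cnt (Suc n) t \<omega>))) \<longlonglongrightarrow> ennreal (exp (\<bar>\<theta>\<bar> * NR t \<omega>))"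
        by (intro tendsto_ennrealI tendsto_intros LIMSEQ_Suc) auto
      then show ?case by (intro lim_imp_Liminf[symmetric]) auto
    qed
  qed
  also have "\<dots> \<le> liminf (\<lambda>n. \<integral>\<^sup>+\<omega>. ennreal (exp (\<bar>\<theta>\<bar> * cnt (Suc n) t \<omega>)) \<partial>M)"
    by (rule nn_integral_liminf) measurable
  also have "\<dots> \<le> liminf (\<lambda>n. ennreal K)" by (intro Liminf_mono always_eventually allI K)
  also have "\<dots> < \<infinity>" by (simp add: Liminf_const)
  finally show "(\<integral>\<^sup>+\<omega>. ennreal (exp (\<bar>\<theta>\<bar> * NR t \<omega>)) \<partial>M) < \<infinity>" .
qed auto

text \<open>The expansion holds for all large cut-offs \<open>n\<close> with constants free of
  \<open>n\<close>, so it survives the limit of the moments; the limit of the cumulants need not be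
  identified.\<close>

lemma log_exp_moment_NR:
  assumes \<theta>: "\<bar>\<theta>\<bar> \<le> \<theta>0" "\<theta> \<noteq> 0"
  shows "integrable M (\<lambda>\<omega>. exp (\<theta> * NR t \<omega>))" (is ?int)
    and "0 < (\<integral>\<omega>. exp (\<theta> * NR t \<omega>) \<partial>M)"
    and "\<bar>ln (\<integral>\<omega>. exp (\<theta> * NR t \<omega>) \<partial>M) - \<theta> * conv (g 0) (EA 0) t - \<theta>\<^sup>2 / 2 * conv (g 0) (EV 0) t\<bar>
      \<le> C0 * \<bar>\<theta>\<bar> ^ 3 * conv (g 0) (\<lambda>_. 1) t"
proof -
  have dom: "AE \<omega> in M. norm (exp (\<theta> * cnt (Suc n) t \<omega>)) \<le> exp (\<bar>\<theta>\<bar> * NR t \<omega>)" for n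
    using AE_Ncount[of t]
  proof eventually_elim
    case (elim \<omega>)
    have "\<theta> * cnt (Suc n) t \<omega> \<le> \<bar>\<theta>\<bar> * NR t \<omega>" using elim by (intro mult_mono) auto
    then show ?case by simp
  qed
  have lim: "AE \<omega> in M. (\<lambda>n. exp (\<theta> * cnt (Suc n) t \<omega>)) \<longlonglongrightarrow> exp (\<theta> * NR t \<omega>)"
    using AE_Ncount[of t]
  proof eventually_elim
    case (elim \<omega>)
    then show ?case by (intro tendsto_intros LIMSEQ_Suc) auto
  qed
  note dc = exp_NR_integrable[OF \<theta>(1), of t] lim dom
  show ?int by (rule integrable_dominated_convergence[OF _ _ dc]) measurable
  have I: "(\<lambda>n. \<integral>\<omega>. exp (\<theta> * cnt (Suc n) t \<omega>) \<partial>M) \<longlonglongrightarrow> (\<integral>\<omega>. exp (\<theta> * NR t \<omega>) \<partial>M)"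
    by (rule integral_dominated_convergence[OF _ _ dc]) measurable
  have "(\<integral>\<omega>. exp (\<theta> * cnt (Suc n) t \<omega>) \<partial>M) = exp (conv (g 0) (\<lambda>w. exp (cumulant \<theta> n 0 w) - 1) t)" for n
    by (subst integral_eq_nn_integral) (auto simp: exp_moment_cnt[OF \<theta>(1)])
  with I have I: "(\<lambda>n. exp (conv (g 0) (\<lambda>w. exp (cumulant \<theta> n 0 w) - 1) t)) \<longlonglongrightarrow> (\<integral>\<omega>. exp (\<theta> * NR t \<omega>) \<partial>M)" by simp
  define y where "y = \<theta> * conv (g 0) (EA 0) t + \<theta>\<^sup>2 / 2 * conv (g 0) (EV 0) t"
  define e where "e = C0 * \<bar>\<theta>\<bar> ^ 3 * conv (g 0) (\<lambda>_. 1) t"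
  have ev: "\<forall>\<^sub>F n in sequentially. exp (y - e) \<le> exp (conv (g 0) (\<lambda>w. exp (cumulant \<theta> n 0 w) - 1) t)
      \<and> exp (conv (g 0) (\<lambda>w. exp (cumulant \<theta> n 0 w) - 1) t) \<le> exp (y + e)"
    using conv_cumulant_second_order[OF \<theta>, of t] by eventually_elim (auto simp: y_def e_def abs_le_iff)
  have lo: "exp (y - e) \<le> (\<integral>\<omega>. exp (\<theta> * NR t \<omega>) \<partial>M)"
    using ev by (intro tendsto_lowerbound[OF I]) (auto elim: eventually_mono)
  have hi: "(\<integral>\<omega>. exp (\<theta> * NR t \<omega>) \<partial>M) \<le> exp (y + e)"
    using ev by (intro tendsto_upperbound[OF I]) (auto elim: eventually_mono)
  show pos: "0 < (\<integral>\<omega>. exp (\<theta> * NR t \<omega>) \<partial>M)" using lo by (meson exp_gt_zero less_le_trans)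
  have "y - e \<le> ln (\<integral>\<omega>. exp (\<theta> * NR t \<omega>) \<partial>M)" using lo pos by (simp add: ln_ge_iff)
  moreover have "ln (\<integral>\<omega>. exp (\<theta> * NR t \<omega>) \<partial>M) \<le> y + e" using hi pos by (metis ln_exp ln_le_cancel_iff exp_gt_zero)
  ultimately show "\<bar>ln (\<integral>\<omega>. exp (\<theta> * NR t \<omega>) \<partial>M) - \<theta> * conv (g 0) (EA 0) t - \<theta>\<^sup>2 / 2 * conv (g 0) (EV 0) t\<bar>
      \<le> C0 * \<bar>\<theta>\<bar> ^ 3 * conv (g 0) (\<lambda>_. 1) t"
    by (simp add: y_def e_def abs_le_iff)
qed

end

section \<open>Moderate deviations\<close>

locale hawkes_moderate = hawkes_process g \<rho> M Nn + cesaro_kernels g \<rho> g0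
  for g \<rho> and M :: "'a measure" and Nn g0 +
  fixes a :: "real \<Rightarrow> real"
  assumes a_pos: "\<And>t. 0 < t \<Longrightarrow> 0 < a t"
    and a_sqrt: "filterlim (\<lambda>t. a t / sqrt t) at_top at_top"
    and a_lin: "((\<lambda>t. a t / t) \<longlongrightarrow> 0) at_top"
begin

definition m :: real where "m = g0 * \<alpha> 0"
definition s2 :: real where "s2 = g0 * (\<Sum>j. (\<Prod>i\<in>{1..j}. G i) * (\<alpha> j)\<^sup>2)"
definition X :: "real \<Rightarrow> 'a \<Rightarrow> real" where "X t \<omega> = (NR t \<omega> - m * t) / a t"
definition v :: "real \<Rightarrow> real" where "v t = (a t)\<^sup>2 / t"

lemma v_times_X:
  assumes "0 < t"
  shows "\<theta> * v t * X t \<omega> = (\<theta> * (a t / t)) * NR t \<omega> - \<theta> * (a t / t) * (m * t)"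
proof -
  have "\<theta> * v t * X t \<omega> = (\<theta> * (a t / t)) * (NR t \<omega> - m * t)"
    using a_pos[OF assms] assms by (simp add: v_def X_def power2_eq_square)
  then show ?thesis by (simp only: right_diff_distrib)
qed

lemma scaled_small: "\<forall>\<^sub>F t in at_top. \<bar>\<theta> * (a t / t)\<bar> \<le> \<theta>0"
proof -
  have "((\<lambda>t. \<theta> * (a t / t)) \<longlongrightarrow> \<theta> * 0) at_top" by (intro tendsto_intros a_lin)
  then have "\<forall>\<^sub>F t in at_top. \<bar>\<theta> * (a t / t)\<bar> < \<theta>0" using tendstoD[OF _ \<theta>0] by force
  then show ?thesis by (rule eventually_mono) simp
qed

text \<open>For \<phi> = \<theta> a/t, division by v = a^2/t turns \<phi> into \<theta>/a, \<phi>^2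
  into \<theta>^2/t and |\<phi>|^3 into |\<theta>|^3 (a/t)/t. So the centring error is measured
  against a, the variance term against t, and the cubic error gains a factor a/t.\<close>

lemma log_moment_expansion:
  assumes t: "0 < t" and \<theta>: "\<theta> \<noteq> 0" "\<bar>\<theta> * (a t / t)\<bar> \<le> \<theta>0"
  shows "integrable M (\<lambda>\<omega>. exp (\<theta> * v t * X t \<omega>))"
    and "\<bar>ln (\<integral>\<omega>. exp (\<theta> * v t * X t \<omega>) \<partial>M) / v t - \<theta>\<^sup>2 / 2 * (conv (g 0) (EV 0) t / t)\<bar>
      \<le> \<bar>\<theta>\<bar> / a t * \<bar>conv (g 0) (EA 0) t - m * t\<bar> + C0 * \<bar>\<theta>\<bar> ^ 3 * (a t / t) * (\<Gamma> t / t)"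
proof -
  define \<phi> where "\<phi> = \<theta> * (a t / t)"
  have at: "0 < a t" by (rule a_pos[OF t])
  have \<phi>: "\<bar>\<phi>\<bar> \<le> \<theta>0" "\<phi> \<noteq> 0" using \<theta> at t by (auto simp: \<phi>_def)
  have v: "0 < v t" using at t by (simp add: v_def)
  note E = log_exp_moment_NR[OF \<phi>, of t]
  have eq: "exp (\<theta> * v t * X t \<omega>) = exp (- \<phi> * (m * t)) * exp (\<phi> * NR t \<omega>)" for \<omega>
    unfolding v_times_X[OF t] \<phi>_def exp_add[symmetric] by (simp add: algebra_simps)
  show "integrable M (\<lambda>\<omega>. exp (\<theta> * v t * X t \<omega>))" unfolding eq using E(1) by simp
  have "(\<integral>\<omega>. exp (\<theta> * v t * X t \<omega>) \<partial>M) = exp (- \<phi> * (m * t)) * (\<integral>\<omega>. exp (\<phi> * NR t \<omega>) \<partial>M)"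
    unfolding eq by simp
  then have ln: "ln (\<integral>\<omega>. exp (\<theta> * v t * X t \<omega>) \<partial>M) = - \<phi> * (m * t) + ln (\<integral>\<omega>. exp (\<phi> * NR t \<omega>) \<partial>M)"
    using E(2) by (simp add: ln_mult)
  have \<phi>v: "\<phi> = \<theta> / a t * v t" "\<phi>\<^sup>2 = \<theta>\<^sup>2 / t * v t" "\<bar>\<phi>\<bar> ^ 3 = \<bar>\<theta>\<bar> ^ 3 * (a t / t) / t * v t"
    using at t by (auto simp: \<phi>_def v_def power2_eq_square power3_eq_cube abs_mult)
  let ?L = "ln (\<integral>\<omega>. exp (\<theta> * v t * X t \<omega>) \<partial>M)"
  have "\<bar>?L - \<phi>\<^sup>2 / 2 * conv (g 0) (EV 0) t\<bar> \<le> \<bar>\<phi> * (conv (g 0) (EA 0) t - m * t)\<bar> + C0 * \<bar>\<phi>\<bar> ^ 3 * \<Gamma> t"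
    using E(3) unfolding ln \<Gamma>_def right_diff_distrib[of \<phi>] by linarith
  also have "\<bar>\<phi> * (conv (g 0) (EA 0) t - m * t)\<bar> = \<bar>\<theta>\<bar> / a t * v t * \<bar>conv (g 0) (EA 0) t - m * t\<bar>"
    using at v by (simp add: \<phi>v(1) abs_mult)
  finally have "\<bar>?L - \<phi>\<^sup>2 / 2 * conv (g 0) (EV 0) t\<bar> / v t
    \<le> (\<bar>\<theta>\<bar> / a t * v t * \<bar>conv (g 0) (EA 0) t - m * t\<bar> + C0 * \<bar>\<phi>\<bar> ^ 3 * \<Gamma> t) / v t"
    using v by (intro divide_right_mono) auto
  also have "\<dots> = \<bar>\<theta>\<bar> / a t * \<bar>conv (g 0) (EA 0) t - m * t\<bar> + C0 * \<bar>\<theta>\<bar> ^ 3 * (a t / t) * (\<Gamma> t / t)"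
    using v unfolding \<phi>v(3) by (simp add: add_divide_distrib)
  also have "\<bar>?L - \<phi>\<^sup>2 / 2 * conv (g 0) (EV 0) t\<bar> / v t = \<bar>?L / v t - \<theta>\<^sup>2 / 2 * (conv (g 0) (EV 0) t / t)\<bar>"
  proof -
    have "?L / v t - \<theta>\<^sup>2 / 2 * (conv (g 0) (EV 0) t / t) = (?L - \<phi>\<^sup>2 / 2 * conv (g 0) (EV 0) t) / v t"
      using v unfolding \<phi>v(2) by (simp add: diff_divide_distrib)
    then show ?thesis using v by simp
  qed
  finally show "\<bar>?L / v t - \<theta>\<^sup>2 / 2 * (conv (g 0) (EV 0) t / t)\<bar>
      \<le> \<bar>\<theta>\<bar> / a t * \<bar>conv (g 0) (EA 0) t - m * t\<bar> + C0 * \<bar>\<theta>\<bar> ^ 3 * (a t / t) * (\<Gamma> t / t)" .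
qed

lemma error_tendsto_0:
  "((\<lambda>t. \<bar>\<theta>\<bar> / a t * \<bar>conv (g 0) (EA 0) t - m * t\<bar> + C0 * \<bar>\<theta>\<bar> ^ 3 * (a t / t) * (\<Gamma> t / t)) \<longlongrightarrow> 0) at_top"
proof -
  obtain C t0 where C: "\<And>t. t0 \<le> t \<Longrightarrow> \<bar>conv (g 0) (EA 0) t - g0 * \<alpha> 0 * t\<bar> \<le> C * sqrt t"
    by (rule mean_count_rate) blast
  have "((\<lambda>t. \<bar>\<theta>\<bar> * C * inverse (a t / sqrt t)) \<longlongrightarrow> \<bar>\<theta>\<bar> * C * 0) at_top"
    by (intro tendsto_intros tendsto_inverse_0_at_top a_sqrt)
  then have lim: "((\<lambda>t. \<bar>\<theta>\<bar> * C * inverse (a t / sqrt t)) \<longlongrightarrow> 0) at_top" by simp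
  have "((\<lambda>t. \<bar>\<theta>\<bar> / a t * \<bar>conv (g 0) (EA 0) t - m * t\<bar>) \<longlongrightarrow> 0) at_top"
  proof (rule real_tendsto_sandwich[OF _ _ tendsto_const lim])
    show "\<forall>\<^sub>F t in at_top. 0 \<le> \<bar>\<theta>\<bar> / a t * \<bar>conv (g 0) (EA 0) t - m * t\<bar>"
      using eventually_gt_at_top[of 0] by eventually_elim (simp add: less_imp_le[OF a_pos])
    show "\<forall>\<^sub>F t in at_top. \<bar>\<theta>\<bar> / a t * \<bar>conv (g 0) (EA 0) t - m * t\<bar> \<le> \<bar>\<theta>\<bar> * C * inverse (a t / sqrt t)"
      using eventually_gt_at_top[of "max 0 t0"]
    proof eventually_elim
      case (elim t)
      have "\<bar>\<theta>\<bar> / a t * \<bar>conv (g 0) (EA 0) t - m * t\<bar> \<le> \<bar>\<theta>\<bar> / a t * (C * sqrt t)"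
        using C[of t] elim a_pos[of t] by (intro mult_left_mono) (auto simp: m_def)
      also have "\<dots> = \<bar>\<theta>\<bar> * C * inverse (a t / sqrt t)" by simp
      finally show ?case .
    qed
  qed
  moreover have "((\<lambda>t. C0 * \<bar>\<theta>\<bar> ^ 3 * (a t / t) * (\<Gamma> t / t)) \<longlongrightarrow> C0 * \<bar>\<theta>\<bar> ^ 3 * 0 * g0) at_top"
    by (intro tendsto_intros a_lin mean[folded \<Gamma>_def])
  ultimately show ?thesis using tendsto_add by fastforce
qed

lemma s2_nonneg: "0 \<le> s2"
proof -
  have "0 \<le> (\<Sum>j. (\<Prod>i\<in>{1..j}. G i) * (\<alpha> j)\<^sup>2)"
    using gen_sum_tendsto(2)[OF EA_sq_bounded tendsto_power[OF EA_tendsto], where k = 0]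
    by (intro suminf_nonneg mult_nonneg_nonneg prod_nonneg) (auto simp: G_nonneg)
  then show ?thesis using g0_nonneg by (simp add: s2_def)
qed

sublocale gaussian_cumulants M X v s2
proof
  show "X t \<in> borel_measurable M" for t unfolding X_def[abs_def] by measurable
  have "filterlim (\<lambda>t. (a t / sqrt t)\<^sup>2) at_top at_top" by (intro filterlim_pow_at_top a_sqrt) simp
  then show "filterlim v at_top at_top"
    by (rule filterlim_cong[OF refl refl, THEN iffD1, rotated])
      (auto intro!: eventually_mono[OF eventually_gt_at_top[of 0]] simp: v_def power_divide)
  show "0 \<le> s2" by (rule s2_nonneg)
  fix \<theta> :: real
  show "\<forall>\<^sub>F t in at_top. integrable M (\<lambda>\<omega>. exp (\<theta> * v t * X t \<omega>))"
  proof (cases "\<theta> = 0")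
    case False
    show ?thesis using scaled_small[of \<theta>] eventually_gt_at_top[of 0]
      by eventually_elim (rule log_moment_expansion(1)[OF _ False])
  qed simp
  show "((\<lambda>t. ln (\<integral>\<omega>. exp (\<theta> * v t * X t \<omega>) \<partial>M) / v t) \<longlongrightarrow> \<theta>\<^sup>2 * s2 / 2) at_top"
  proof (cases "\<theta> = 0")
    case True
    then show ?thesis by (simp add: prob_space)
  next
    case False
    have "((\<lambda>t. ln (\<integral>\<omega>. exp (\<theta> * v t * X t \<omega>) \<partial>M) / v t - \<theta>\<^sup>2 / 2 * (conv (g 0) (EV 0) t / t)) \<longlongrightarrow> 0) at_top"
    proof (rule Lim_null_comparison[OF _ error_tendsto_0[of \<theta>]])
      show "\<forall>\<^sub>F t in at_top. norm (ln (\<integral>\<omega>. exp (\<theta> * v t * X t \<omega>) \<partial>M) / v t - \<theta>\<^sup>2 / 2 * (conv (g 0) (EV 0) t / t))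
        \<le> \<bar>\<theta>\<bar> / a t * \<bar>conv (g 0) (EA 0) t - m * t\<bar> + C0 * \<bar>\<theta>\<bar> ^ 3 * (a t / t) * (\<Gamma> t / t)"
        using scaled_small[of \<theta>] eventually_gt_at_top[of 0]
      proof eventually_elim
        case (elim t)
        show ?case unfolding real_norm_def by (rule log_moment_expansion(2)[OF elim(2) False elim(1)])
      qed
    qed
    moreover have "((\<lambda>t. \<theta>\<^sup>2 / 2 * (conv (g 0) (EV 0) t / t)) \<longlongrightarrow> \<theta>\<^sup>2 / 2 * s2) at_top"
      unfolding s2_def by (intro tendsto_mult tendsto_const conv_cesaro[OF EV_bounded EV_tendsto])
    ultimately have "((\<lambda>t. (ln (\<integral>\<omega>. exp (\<theta> * v t * X t \<omega>) \<partial>M) / v t - \<theta>\<^sup>2 / 2 * (conv (g 0) (EV 0) t / t))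
      + \<theta>\<^sup>2 / 2 * (conv (g 0) (EV 0) t / t)) \<longlongrightarrow> 0 + \<theta>\<^sup>2 / 2 * s2) at_top" by (rule tendsto_add)
    then show ?thesis by simp
  qed
qed

lemma prob_X:
  assumes A: "A \<in> sets borel"
  shows "measure M {\<omega>\<in>space M. Ncount Nn t \<omega> \<noteq> \<infinity> \<and> (enn2real (Ncount Nn t \<omega>) - m * t) / a t \<in> A}
    = measure M {\<omega>\<in>space M. X t \<omega> \<in> A}"
proof (rule measure_eq_AE)
  note [measurable] = Ncount_meas A
  show "AE \<omega> in M. \<omega> \<in> {\<omega>\<in>space M. Ncount Nn t \<omega> \<noteq> \<infinity> \<and> (enn2real (Ncount Nn t \<omega>) - m * t) / a t \<in> A}
    \<longleftrightarrow> \<omega> \<in> {\<omega>\<in>space M. X t \<omega> \<in> A}"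
    using AE_Ncount[of t] by eventually_elim (simp add: X_def NR_def)
  show "{\<omega>\<in>space M. Ncount Nn t \<omega> \<noteq> \<infinity> \<and> (enn2real (Ncount Nn t \<omega>) - m * t) / a t \<in> A} \<in> sets M"
    by measurable
  show "{\<omega>\<in>space M. X t \<omega> \<in> A} \<in> sets M" unfolding X_def by measurable
qed

end

section \<open>Reduction to kernels vanishing at negative times\<close>

lemma cond_poisson_cong:
  assumes "cond_poisson M F X lam" and eq: "\<And>\<omega> s. 0 < s \<Longrightarrow> lam \<omega> s = lam' \<omega> s"
  shows "cond_poisson M F X lam'"
  unfolding cond_poisson_def
proof (intro ballI allI impI)
  fix E k c and B :: "nat \<Rightarrow> real set"
  assume E: "E \<in> F" and B: "\<forall>i<k. B i \<in> sets borel \<and> (\<exists>T. B i \<subseteq> {0<..T})" and disj: "disjoint_family_on B {..<k}"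
  have "(\<integral>\<^sup>+t. lam \<omega> t * indicator (B i) t \<partial>lborel) = (\<integral>\<^sup>+t. lam' \<omega> t * indicator (B i) t \<partial>lborel)" if "i < k" for i \<omega>
    using B[rule_format, OF that] eq by (intro nn_integral_cong) (auto simp: indicator_def)
  then have "(\<integral>\<^sup>+\<omega>. indicator E \<omega> * (\<Prod>i<k. poisson_prob (\<integral>\<^sup>+t. lam \<omega> t * indicator (B i) t \<partial>lborel) (c i)) \<partial>M)
    = (\<integral>\<^sup>+\<omega>. indicator E \<omega> * (\<Prod>i<k. poisson_prob (\<integral>\<^sup>+t. lam' \<omega> t * indicator (B i) t \<partial>lborel) (c i)) \<partial>M)"
    by (intro nn_integral_cong arg_cong2[where f = times] refl prod.cong) auto
  moreover note assms(1)[unfolded cond_poisson_def, THEN bspec, OF E, THEN spec[of _ k], THEN spec[of _ B],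
      THEN spec[of _ c], THEN mp, OF B, THEN mp, OF disj]
  ultimately show "emeasure M (E \<inter> {\<omega>\<in>space M. \<forall>i<k. pcount (X \<omega>) (B i) = of_nat (c i)})
    = (\<integral>\<^sup>+\<omega>. indicator E \<omega> * (\<Prod>i<k. poisson_prob (\<integral>\<^sup>+t. lam' \<omega> t * indicator (B i) t \<partial>lborel) (c i)) \<partial>M)"
    by simp
qed

text \<open>The values of \<open>\<gamma>\<close> at negative times are arbitrary, not even measurable.\<close>
definition restrict_pos :: "(nat \<Rightarrow> real \<Rightarrow> real) \<Rightarrow> nat \<Rightarrow> real \<Rightarrow> real" where
  "restrict_pos \<gamma> k t = (if 0 \<le> t then \<gamma> k t else 0)"

lemma gchain_restrict_pos: "0 \<le> t \<Longrightarrow> gchain (restrict_pos \<gamma>) p t = gchain \<gamma> p t"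
proof (induction \<gamma> p arbitrary: t rule: gchain.induct)
  case (3 \<gamma> p)
  have "hconv (\<lambda>t. ennreal (restrict_pos \<gamma> (Suc (Suc p)) t)) (gchain (restrict_pos \<gamma>) (Suc p)) t
    = hconv (\<lambda>t. ennreal (\<gamma> (Suc (Suc p)) t)) (gchain \<gamma> (Suc p)) t"
    unfolding hconv_def
  proof (intro nn_integral_cong)
    fix s
    show "ennreal (restrict_pos \<gamma> (Suc (Suc p)) (t - s)) * gchain (restrict_pos \<gamma>) (Suc p) s * indicator {0..t} s
      = ennreal (\<gamma> (Suc (Suc p)) (t - s)) * gchain \<gamma> (Suc p) s * indicator {0..t} s"
      using "3.IH"[of s] by (auto simp: restrict_pos_def[of \<gamma> "Suc (Suc p)"] indicator_def)
  qed
  then show ?case by simp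
qed (auto simp: restrict_pos_def)

text \<open>Intensities are tested only on subsets of (0, oo), and a contributing parent \<tau> < t
  gives a positive argument t - \<tau>, so values at negative times never enter.\<close>

lemma hawkes_restrict_pos:
  assumes "hawkes M \<gamma> Nn"
  shows "hawkes M (restrict_pos \<gamma>) Nn"
proof -
  have 0: "cond_poisson M {space M} (Nn 0) (\<lambda>\<omega> t. ennreal (restrict_pos \<gamma> 0 t))"
    by (rule cond_poisson_cong[of _ _ _ "\<lambda>\<omega> t. ennreal (\<gamma> 0 t)"])
      (use assms in \<open>auto simp: hawkes_def restrict_pos_def\<close>)
  have 1: "cond_poisson M (gen_sigma M Nn n) (Nn (Suc n))
      (\<lambda>\<omega> t. \<Sum>\<^sub>\<infinity>\<tau>\<in>Nn n \<omega> \<inter> {0<..<t}. ennreal (restrict_pos \<gamma> (Suc n) (t - \<tau>)))" for n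
    by (rule cond_poisson_cong[of _ _ _ "\<lambda>\<omega> t. \<Sum>\<^sub>\<infinity>\<tau>\<in>Nn n \<omega> \<inter> {0<..<t}. ennreal (\<gamma> (Suc n) (t - \<tau>))"])
      (use assms in \<open>auto simp: hawkes_def restrict_pos_def intro!: infsum_cong\<close>)
  show ?thesis using assms 0 1 by (simp add: hawkes_def)
qed

theorem theorem4p4:
  fixes M :: "'a measure" and \<gamma> :: "nat \<Rightarrow> real \<Rightarrow> real" and Nn :: "nat \<Rightarrow> 'a \<Rightarrow> real set"
    and g0 :: real and a :: "real \<Rightarrow> real" and A :: "real set"
  assumes "prob_space M"
    and "\<forall>n t. t \<ge> 0 \<longrightarrow> \<gamma> n t \<ge> 0"
    and "\<forall>n T. set_integrable lborel {0..T} (\<gamma> n)"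
    and "hawkes M \<gamma> Nn"
    and "((\<lambda>t. (LBINT s:{0..t}. \<gamma> 0 s) / t) \<longlongrightarrow> g0) at_top"
    and "(SUP n\<in>{1..}. \<integral>\<^sup>+u\<in>{0..}. ennreal (\<gamma> n u) \<partial>lborel) < 1"
    and "((\<lambda>t. sqrt t * ((LBINT s:{0..t}. \<gamma> 0 s) / t - g0)) \<longlongrightarrow> 0) at_top"
    and "((\<lambda>t. ennreal (sqrt t) * (\<integral>\<^sup>+s\<in>{t..}. (\<Sum>p. gchain \<gamma> (Suc p) s) \<partial>lborel))
           \<longlongrightarrow> 0) at_top"
    and "\<forall>t>0. a t > 0"
    and "filterlim (\<lambda>t. a t / sqrt t) at_top at_top"
    and "((\<lambda>t. a t / t) \<longlongrightarrow> 0) at_top"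
    and "A \<in> sets borel"
  shows "- (INF x\<in>interior A. Jrate \<gamma> g0 x) \<le> Liminf at_top (ldp_quantity M \<gamma> Nn g0 a A)
       \<and> Liminf at_top (ldp_quantity M \<gamma> Nn g0 a A) \<le> Limsup at_top (ldp_quantity M \<gamma> Nn g0 a A)
       \<and> Limsup at_top (ldp_quantity M \<gamma> Nn g0 a A) \<le> - (INF x\<in>closure A. Jrate \<gamma> g0 x)"
proof -
  define g where "g = restrict_pos \<gamma>"
  define S where "S = (SUP n\<in>{1..}. \<integral>\<^sup>+u\<in>{0..}. ennreal (\<gamma> n u) \<partial>lborel)"
  define \<rho> where "\<rho> = enn2real S"
  have S: "S < 1" using assms(6) by (simp add: S_def)
  then have S_eq: "S = ennreal \<rho>" unfolding \<rho>_def by (intro ennreal_enn2real[symmetric]) (auto intro: less_trans)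
  have nonneg: "0 \<le> g k t" for k t using assms(2) by (simp add: g_def restrict_pos_def)
  have loc_eq: "indicator {0..T} s * g k s = indicator {0..T} s *\<^sub>R \<gamma> k s" for k s T
    by (simp add: g_def restrict_pos_def indicator_def)
  have loc: "integrable lborel (\<lambda>s. indicator {0..T} s * g k s)" for k T
    unfolding loc_eq using assms(3) by (simp add: set_integrable_def)
  \<comment> \<open>Measurability is implicit in local integrability: it holds for each truncation
    to [0, n], and the truncations converge pointwise.\<close>
  have meas: "g k \<in> borel_measurable borel" for k
  proof (rule borel_measurable_LIMSEQ_real)
    show "(\<lambda>s. indicator {0..real n} s * g k s) \<in> borel_measurable borel" for n
      using borel_measurable_integrable[OF loc] by simp
    fix s
    obtain N where "s \<le> real N" using real_arch_simple by blast
    then have "\<forall>\<^sub>F n in sequentially. indicator {0..real n} s * g k s = g k s"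
      by (auto simp: eventually_sequentially indicator_def g_def restrict_pos_def intro!: exI[of _ N])
    then show "(\<lambda>n. indicator {0..real n} s * g k s) \<longlonglongrightarrow> g k s" by (rule tendsto_eventually)
  qed
  have nn: "(\<integral>\<^sup>+u. ennreal (g k u) \<partial>lborel) = (\<integral>\<^sup>+u\<in>{0..}. ennreal (\<gamma> k u) \<partial>lborel)" for k
    by (intro nn_integral_cong) (simp add: g_def restrict_pos_def indicator_def)
  have nn_le: "(\<integral>\<^sup>+u. ennreal (g (Suc k) u) \<partial>lborel) \<le> ennreal \<rho>" for k
    unfolding nn S_eq[symmetric] S_def by (rule SUP_upper) simp
  have int: "integrable lborel (g (Suc k))" for k
    using nn_le[of k] meas nonneg by (intro integrableI_nonneg) (auto intro: le_less_trans)
  have Gam: "(\<integral>u. g k u \<partial>lborel) = Gam \<gamma> k" for k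
    unfolding Gam_def nn[symmetric] using meas nonneg by (intro integral_eq_nn_integral) auto
  have conv1: "conv (g 0) (\<lambda>_. 1) t = (LBINT s:{0..t}. \<gamma> 0 s)" for t
    unfolding conv_def set_lebesgue_integral_def by (simp add: loc_eq)
  interpret M: prob_space M by fact
  interpret hawkes_moderate g \<rho> M Nn g0 a
  proof
    show "(\<integral>v. g (Suc k) v \<partial>lborel) \<le> \<rho>" for k
    proof -
      have "(\<integral>v. g (Suc k) v \<partial>lborel) = enn2real (\<integral>\<^sup>+v. ennreal (g (Suc k) v) \<partial>lborel)"
        using meas nonneg by (intro integral_eq_nn_integral) auto
      also have "\<dots> \<le> enn2real (ennreal \<rho>)" by (intro enn2real_mono nn_le) simp
      finally show ?thesis by (simp add: \<rho>_def)
    qed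
    show "\<rho> < 1" using S unfolding S_eq by simp
    show "hawkes M g Nn" unfolding g_def by (rule hawkes_restrict_pos[OF assms(4)])
    show "((\<lambda>t. conv (g 0) (\<lambda>_. 1) t / t) \<longlongrightarrow> g0) at_top" unfolding conv1 by fact
    show "((\<lambda>t. sqrt t * (conv (g 0) (\<lambda>_. 1) t / t - g0)) \<longlongrightarrow> 0) at_top" unfolding conv1 by fact
    show "((\<lambda>t. ennreal (sqrt t) * (\<integral>\<^sup>+s\<in>{t..}. (\<Sum>p. gchain g (Suc p) s) \<partial>lborel)) \<longlongrightarrow> 0) at_top"
    proof (rule Lim_transform_eventually[OF assms(8)])
      show "\<forall>\<^sub>F t in at_top. ennreal (sqrt t) * (\<integral>\<^sup>+s\<in>{t..}. (\<Sum>p. gchain \<gamma> (Suc p) s) \<partial>lborel)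
        = ennreal (sqrt t) * (\<integral>\<^sup>+s\<in>{t..}. (\<Sum>p. gchain g (Suc p) s) \<partial>lborel)"
        using eventually_ge_at_top[of 0]
        by eventually_elim (rule arg_cong2[where f = times, OF refl], rule nn_integral_cong,
            auto simp: g_def gchain_restrict_pos split: split_indicator)
    qed
  qed (use assms meas nonneg loc int in \<open>auto simp: g_def restrict_pos_def\<close>)
  have G: "G = Gam \<gamma>" by (simp add: fun_eq_iff G_def Gam)
  have m_eq: "mrate \<gamma> g0 = m"
    unfolding mrate_def mgen_def m_def \<alpha>_def using suminf_mult[OF \<alpha>_summable[of 0], of g0] by (simp add: G)
  \<comment> \<open>The term p = 0, an empty product, is the root of the cluster and gives the 1 in
    the variance formula.\<close>
  have \<alpha>_eq: "\<alpha> j = 1 + (\<Sum>p. \<Prod>i\<in>{Suc j..Suc p + j}. Gam \<gamma> i)" for j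
    using suminf_split_head[OF \<alpha>_summable[of j]] by (simp add: \<alpha>_def G)
  have s2_eq: "sigma2 \<gamma> g0 = s2"
    unfolding sigma2_def mgen_def \<alpha>_eq[symmetric] s2_def
    using suminf_mult[OF gen_sum_tendsto(2)[OF EA_sq_bounded tendsto_power[OF EA_tendsto], where k = 0], of g0]
    by (simp add: G mult_ac)
  have J: "Jrate \<gamma> g0 = quad_rate s2"
    by (simp add: fun_eq_iff Jrate_def quad_rate_def s2_eq)
  have "\<forall>\<^sub>F t in at_top. ldp_quantity M \<gamma> Nn g0 a A t = ereal (1 / v t) * elog (measure M {\<omega>\<in>space M. X t \<omega> \<in> A})"
    using eventually_gt_at_top[of 0]
    by eventually_elim (simp only: ldp_quantity_def m_eq prob_X[OF assms(12)] v_def divide_divide_eq_right mult_1_left)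
  note Liminf_eq[OF this] Limsup_eq[OF this]
  then show ?thesis
    using Liminf_ge_rate[OF assms(12)] Limsup_le_rate[OF assms(12)]
    by (auto simp: J intro: Liminf_le_Limsup)
qed

end
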